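(* Let $(R,\mathfrak{m},k)$ be a Noetherian local domain and $\varphi$ a finite local self-map of $R$. Then (a) $\log\deg(\varphi)\le\log[\varphi_*k:k]+h_{\mathrm{alg}}(\varphi,R)$; (b) if in addition $R$ is Cohen–Macaulay, then $\log\deg(\varphi)=\log[\varphi_*k:k]+h_{\mathrm{alg}}(\varphi,R)$.
   Context: "Finite" means $R$ is a finitely generated module via $\varphi$; such a local self-map $\varphi$ has $\varphi(\mathfrak{m})R$ $\mathfrak{m}$-primary. $\varphi_*R$ denotes $R$ as an $R$-module via $\varphi$; $\deg(\varphi)$ is the rank of $\varphi_*R$. $[\varphi_*k:k]$ is the dimension of the residue field $k$ as a $k$-vector space via $\varphi$. Put $\lambda(\varphi^n):=\ell_R(R/\varphi^n(\mathfrak{m})R)$; the algebraic entropy is $h_{\mathrm{alg}}(\varphi,R):=\lim_{n\to\infty}\frac1n\log\lambda(\varphi^n)$ (the limit exists). *)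

theory Defs
  imports Complex_Main "HOL-Algebra.Algebra" "HOL-Library.Extended_Nat"
begin

definition local_ring :: "('a, 'b) ring_scheme \<Rightarrow> 'a set \<Rightarrow> bool" where
  "local_ring R m \<longleftrightarrow> maximalideal m R \<and> (\<forall>M. maximalideal M R \<longrightarrow> M = m)"

definition lin_indep :: "('r, 'c) ring_scheme \<Rightarrow> ('r, 'm, 'd) module_scheme \<Rightarrow> 'm set \<Rightarrow> bool" where
  "lin_indep R M S \<longleftrightarrow> finite S \<and> S \<subseteq> carrier M \<and>
     (\<forall>c. c \<in> S \<rightarrow> carrier R \<longrightarrow>
        finsum M (\<lambda>s. smult M (c s) s) S = \<zero>\<^bsub>M\<^esub> \<longrightarrow> (\<forall>s\<in>S. c s = \<zero>\<^bsub>R\<^esub>))"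

definition module_rank :: "('r, 'c) ring_scheme \<Rightarrow> ('r, 'm, 'd) module_scheme \<Rightarrow> enat" where
  "module_rank R M = Sup {enat (card S) | S. lin_indep R M S}"

definition fin_gen_module :: "('r, 'c) ring_scheme \<Rightarrow> ('r, 'm, 'd) module_scheme \<Rightarrow> bool" where
  "fin_gen_module R M \<longleftrightarrow> (\<exists>S. finite S \<and> S \<subseteq> carrier M \<and>
     (\<forall>x\<in>carrier M. \<exists>c \<in> S \<rightarrow> carrier R. x = finsum M (\<lambda>s. smult M (c s) s) S))"

definition module_length :: "('r, 'c) ring_scheme \<Rightarrow> ('r, 'm, 'd) module_scheme \<Rightarrow> enat" where
  "module_length R M = Sup {enat n | n. \<exists>N. (\<forall>i\<le>n. submodule (N i) R M) \<and> (\<forall>i<n. N i \<subset> N (Suc i))}"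

definition pushforward :: "('a, 'b) ring_scheme \<Rightarrow> ('a \<Rightarrow> 'a) \<Rightarrow> ('a, 'a) module" where
  "pushforward R \<phi> = \<lparr>carrier = carrier R, Group.monoid.mult = Group.monoid.mult R,  Group.monoid.one = Group.monoid.one R, Ring.ring.zero = Ring.ring.zero R,
      Ring.ring.add = add R, smult = (\<lambda>r x. \<phi> r \<otimes>\<^bsub>R\<^esub> x)\<rparr>"

definition quot_module :: "('a, 'b) ring_scheme \<Rightarrow> 'a set \<Rightarrow> ('a, 'a set) module" where
  "quot_module R I = \<lparr>carrier = a_rcosets\<^bsub>R\<^esub> I, Group.monoid.mult = rcoset_mult R I,
       Group.monoid.one = I +>\<^bsub>R\<^esub> \<one>\<^bsub>R\<^esub>, Ring.ring.zero = I, Ring.ring.add = set_add R,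
      smult = (\<lambda>r Y. I <+>\<^bsub>R\<^esub> ((\<lambda>x. r \<otimes>\<^bsub>R\<^esub> x) ` Y))\<rparr>"

text \<open>The residue field \<open>k = R/m\<close> viewed as a k-vector space via \<open>\<phi>\<close> (i.e. \<open>\<phi>\<^sub>*k\<close>);
  a module over the ring \<open>R Quot m\<close>.\<close>
definition residue_push :: "('a, 'b) ring_scheme \<Rightarrow> 'a set \<Rightarrow> ('a \<Rightarrow> 'a) \<Rightarrow> ('a set, 'a set) module" where
  "residue_push R m \<phi> = \<lparr>carrier = a_rcosets\<^bsub>R\<^esub> m, Group.monoid.mult = rcoset_mult R m,
       Group.monoid.one = m +>\<^bsub>R\<^esub> \<one>\<^bsub>R\<^esub>, Ring.ring.zero = m, Ring.ring.add = set_add R,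
      smult = (\<lambda>A Y. m <+>\<^bsub>R\<^esub> {\<phi> a \<otimes>\<^bsub>R\<^esub> x | a x. a \<in> A \<and> x \<in> Y})\<rparr>"

definition finite_local_self_map :: "('a, 'b) ring_scheme \<Rightarrow> 'a set \<Rightarrow> ('a \<Rightarrow> 'a) \<Rightarrow> bool" where
  "finite_local_self_map R m \<phi> \<longleftrightarrow> \<phi> \<in> ring_hom R R \<and> \<phi> ` m \<subseteq> m \<and>
     fin_gen_module R (pushforward R \<phi>)"

definition map_degree :: "('a, 'b) ring_scheme \<Rightarrow> ('a \<Rightarrow> 'a) \<Rightarrow> enat" where
  "map_degree R \<phi> = module_rank R (pushforward R \<phi>)"

definition residue_degree :: "('a, 'b) ring_scheme \<Rightarrow> 'a set \<Rightarrow> ('a \<Rightarrow> 'a) \<Rightarrow> enat" where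
  "residue_degree R m \<phi> = module_rank (R Quot m) (residue_push R m \<phi>)"

definition lambda_len :: "('a, 'b) ring_scheme \<Rightarrow> 'a set \<Rightarrow> ('a \<Rightarrow> 'a) \<Rightarrow> nat \<Rightarrow> enat" where
  "lambda_len R m \<phi> n = module_length R (quot_module R (Idl\<^bsub>R\<^esub> ((\<phi> ^^ n) ` m)))"

definition alg_entropy :: "('a, 'b) ring_scheme \<Rightarrow> 'a set \<Rightarrow> ('a \<Rightarrow> 'a) \<Rightarrow> real" where
  "alg_entropy R m \<phi> = lim (\<lambda>n. ln (real (the_enat (lambda_len R m \<phi> n))) / real n)"

definition krull_dim :: "('a, 'b) ring_scheme \<Rightarrow> enat" where
  "krull_dim R = Sup {enat n | n. \<exists>P. (\<forall>i\<le>n. primeideal (P i) R) \<and> (\<forall>i<n. P i \<subset> P (Suc i))}"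

definition regular_seq :: "('a, 'b) ring_scheme \<Rightarrow> 'a list \<Rightarrow> bool" where
  "regular_seq R xs \<longleftrightarrow> set xs \<subseteq> carrier R \<and> Idl\<^bsub>R\<^esub> (set xs) \<noteq> carrier R \<and>
     (\<forall>i<length xs. \<forall>y\<in>carrier R.
        xs ! i \<otimes>\<^bsub>R\<^esub> y \<in> Idl\<^bsub>R\<^esub> (set (take i xs)) \<longrightarrow> y \<in> Idl\<^bsub>R\<^esub> (set (take i xs)))"

definition local_depth :: "('a, 'b) ring_scheme \<Rightarrow> 'a set \<Rightarrow> enat" where
  "local_depth R m = Sup {enat (length xs) | xs. set xs \<subseteq> m \<and> regular_seq R xs}"

definition cohen_macaulay_local :: "('a, 'b) ring_scheme \<Rightarrow> 'a set \<Rightarrow> bool" where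
  "cohen_macaulay_local R m \<longleftrightarrow> local_depth R m = krull_dim R"

end

theory Submission
  imports Defs
begin

text \<open>Let \<open>\<mu> n\<close> be the minimal number of generators of \<open>R\<close> as a module through \<open>\<phi>\<^sup>n\<close>. Refining a composition
  series gives \<open>\<mu> n = [\<phi>\<^sub>*k : k]\<^sup>n \<lambda>(\<phi>\<^sup>n)\<close>, and \<open>\<mu>\<close> is submultiplicative, so \<open>ln (\<mu> n) / n\<close> converges to
  \<open>ln [\<phi>\<^sub>*k : k] + h\<^sub>a\<^sub>l\<^sub>g\<close>. The rank is at most the number of generators and is multiplicative, whence
  \<open>deg(\<phi>)\<^sup>n \<le> \<mu> n\<close> and part (a).

  If \<open>R\<close> is Cohen--Macaulay, let \<open>xs\<close> be a regular sequence of length \<open>d = dim R\<close>. Every ideal with \<open>d\<close> generators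
  that contains powers of \<open>xs\<close> is again generated by a regular sequence; this applies to \<open>\<phi>\<^sup>n(xs) R\<close>.
  Colengths of powers of regular sequences grow exactly like \<open>a\<^sup>d\<close>, and comparing leading coefficients yields
  \<open>\<mu> n \<le> C deg(\<phi>)\<^sup>n\<close> with \<open>C\<close> independent of \<open>n\<close>, which gives part (b).\<close>

section \<open>Lengths of chains of sets\<close>

text \<open>Length over \<open>R\<close>, dimension over the residue field and rank over the
  fraction field are all chain lengths in one kind of lattice: the subsets of \<open>R\<close>
  stable under the scalars \<psi>(R) and closed under division by \<psi>(T). Every module in play is
  \<open>R\<close> itself with a twisted action, so no localization is ever built. One additivity
  statement (\<open>tlen_add\<close>) and one scaling statement (\<open>tlen_scale\<close>) yield
  both the multiplicativity of the rank and the product formula for \<mu>.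

  For part (b) the familiar tool is Hilbert-Samuel multiplicity: the multiplicity of a module is its
  rank times that of the ring. Powers of ideals are replaced here by ideals generated by powers of a
  regular sequence, where colengths are known exactly and not only asymptotically. Passing between
  the two kinds of powers costs a factor \<open>(d + 1) ^ d\<close>. It does not depend on n, so it
  disappears once the logarithm is divided by n, and no exact leading coefficient has to be
  identified.\<close>

definition chain_in :: "'a set set \<Rightarrow> 'a set \<Rightarrow> 'a set \<Rightarrow> nat \<Rightarrow> (nat \<Rightarrow> 'a set) \<Rightarrow> bool" where
  "chain_in F Y V n N \<longleftrightarrow> (\<forall>i\<le>n. N i \<in> F \<and> Y \<subseteq> N i \<and> N i \<subseteq> V) \<and> (\<forall>i<n. N i \<subset> N (Suc i))"

text \<open>Chains need not start at \<open>Y\<close> or end at \<open>V\<close>, so neither bound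
  has to belong to \<open>F\<close>. The supremum is \<open>0\<close> also when no member of
  \<open>F\<close> lies in between.\<close>

definition clen :: "'a set set \<Rightarrow> 'a set \<Rightarrow> 'a set \<Rightarrow> enat" where
  "clen F Y V = Sup {enat n | n. \<exists>N. chain_in F Y V n N}"

lemma chain_inD:
  assumes "chain_in F Y V n N"
  shows "i \<le> n \<Longrightarrow> N i \<in> F" "i \<le> n \<Longrightarrow> Y \<subseteq> N i" "i \<le> n \<Longrightarrow> N i \<subseteq> V" "i < n \<Longrightarrow> N i \<subset> N (Suc i)"
  using assms unfolding chain_in_def by auto

lemma chain_inI:
  assumes "\<And>i. i \<le> n \<Longrightarrow> N i \<in> F" "\<And>i. i \<le> n \<Longrightarrow> Y \<subseteq> N i" "\<And>i. i \<le> n \<Longrightarrow> N i \<subseteq> V" "\<And>i. i < n \<Longrightarrow> N i \<subset> N (Suc i)"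
  shows "chain_in F Y V n N"
  using assms unfolding chain_in_def by auto

lemma clen_upper: "chain_in F Y V n N \<Longrightarrow> enat n \<le> clen F Y V"
  unfolding clen_def by (rule Sup_upper) blast

lemma clen_least: "(\<And>n N. chain_in F Y V n N \<Longrightarrow> enat n \<le> B) \<Longrightarrow> clen F Y V \<le> B"
  unfolding clen_def by (rule Sup_least) blast

lemma chain_in_truncate: "chain_in F Y V n N \<Longrightarrow> k \<le> n \<Longrightarrow> chain_in F Y V k N"
  unfolding chain_in_def by auto

text \<open>The member \<open>Z\<close> serves only \<open>n = 0\<close>, where a supremum over no
  chains would also be \<open>0\<close>. For \<open>n = k + 1\<close> some chain has more than
  \<open>k\<close> steps and is cut down to exactly \<open>n\<close>.\<close>

lemma clen_chain:
  assumes "enat n \<le> clen F Y V" "Z \<in> F" "Y \<subseteq> Z" "Z \<subseteq> V"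
  obtains N where "chain_in F Y V n N"
proof (cases n)
  case 0
  have "chain_in F Y V 0 (\<lambda>_. Z)" using assms by (auto simp: chain_in_def)
  then show ?thesis using 0 that by blast
next
  case (Suc k)
  have "enat k < clen F Y V"
    using assms(1) Suc by (metis enat_ord_simps(2) lessI less_le_trans)
  then obtain m N where "chain_in F Y V m N" "enat k < enat m"
    unfolding clen_def less_Sup_iff by blast
  then show ?thesis using chain_in_truncate[of F Y V m N n] Suc that by simp
qed

lemma chain_in_mono: "chain_in F Y V n N \<Longrightarrow> Y' \<subseteq> Y \<Longrightarrow> V \<subseteq> V' \<Longrightarrow> chain_in F Y' V' n N"
  unfolding chain_in_def by (meson order_trans)

lemma clen_mono: "Y' \<subseteq> Y \<Longrightarrow> V \<subseteq> V' \<Longrightarrow> clen F Y V \<le> clen F Y' V'"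
  by (meson clen_least clen_upper chain_in_mono)

lemma clen_le_mono: "clen F Y W \<le> B \<Longrightarrow> V \<subseteq> W \<Longrightarrow> clen F Y V \<le> B"
  using clen_mono[of Y Y V W F] by (meson order_refl order_trans)

lemma clen_same: "clen F V V = 0"
proof -
  have "n = 0" if "chain_in F V V n N" for n N
  proof (rule ccontr)
    assume "n \<noteq> 0"
    then have "N 0 = V" "N (Suc 0) = V" "N 0 \<subset> N (Suc 0)"
      using that unfolding chain_in_def by (auto simp: Suc_leI subset_antisym)
    then show False by blast
  qed
  then have "clen F V V \<le> 0"
    by (intro clen_least) (simp add: zero_enat_def)
  then show ?thesis by simp
qed

lemma clen_le_transfer:
  assumes "\<And>N. N \<in> F \<Longrightarrow> Y \<subseteq> N \<Longrightarrow> N \<subseteq> V \<Longrightarrow> f N \<in> F' \<and> Y' \<subseteq> f N \<and> f N \<subseteq> V'"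
    and "\<And>N N'. N \<in> F \<Longrightarrow> N' \<in> F \<Longrightarrow> Y \<subseteq> N \<Longrightarrow> N \<subset> N' \<Longrightarrow> N' \<subseteq> V \<Longrightarrow> f N \<subset> f N'"
  shows "clen F Y V \<le> clen F' Y' V'"
proof (rule clen_least)
  fix n N assume c: "chain_in F Y V n N"
  have "chain_in F' Y' V' n (\<lambda>i. f (N i))"
  proof (rule chain_inI)
    fix i assume "i < n"
    then show "f (N i) \<subset> f (N (Suc i))"
      using assms(2) chain_inD[OF c, of i] chain_inD[OF c, of "Suc i"] by simp
  qed (use assms(1) chain_inD[OF c] in simp_all)
  then show "enat n \<le> clen F' Y' V'" by (rule clen_upper)
qed

lemma clen_snoc:
  assumes "Z \<in> F" "Y \<subseteq> Z" "Z \<subset> V" "V \<in> F"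
  shows "clen F Y Z + 1 \<le> clen F Y V"
proof (cases "clen F Y Z")
  case (enat n)
  then obtain N where N: "chain_in F Y Z n N"
    using clen_chain[of n F Y Z Z] assms by auto
  have "chain_in F Y V (Suc n) (\<lambda>i. if i \<le> n then N i else V)"
  proof (rule chain_inI)
    fix i assume "i < Suc n"
    then show "(if i \<le> n then N i else V) \<subset> (if Suc i \<le> n then N (Suc i) else V)"
      using chain_inD(4)[OF N, of i] chain_inD(3)[OF N, of i] assms by (cases "i = n") auto
  next
    fix i assume "i \<le> Suc n"
    then show "(if i \<le> n then N i else V) \<subseteq> V"
      using chain_inD(3)[OF N, of i] assms(3) by auto
  qed (use chain_inD(1,2)[OF N] assms in auto)
  then have "enat (Suc n) \<le> clen F Y V" by (rule clen_upper)
  then show ?thesis using enat by (simp add: one_enat_def)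
next
  case infinity
  then show ?thesis using clen_mono[of Y Y Z V F] assms by auto
qed

text \<open>A chain from \<open>V\<close> to \<open>W\<close> is climbed with
  \<open>clen_snoc\<close>, each strict step adding one to the length already found above
  \<open>Y\<close>. This holds for any family of sets; the reverse inequality uses submodules and is
  \<open>tlen_add\<close>.\<close>

lemma clen_superadd:
  assumes "V \<in> F" "Y \<subseteq> V" "V \<subseteq> W"
  shows "clen F Y V + clen F V W \<le> clen F Y W"
proof (cases "clen F V W")
  case (enat m)
  show ?thesis
  proof -
    obtain N where N: "chain_in F V W m N"
      using clen_chain[of m F V W V] assms enat by auto
    have "clen F Y V + enat i \<le> clen F Y (N i)" if "i \<le> m" for i
      using that
    proof (induction i)
      case 0
      have "V \<subseteq> N 0" using N by (simp add: chain_in_def)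
      then show ?case by (simp add: clen_mono zero_enat_def[symmetric])
    next
      case (Suc i)
      have "clen F Y (N i) + 1 \<le> clen F Y (N (Suc i))"
        by (rule clen_snoc) (use chain_inD[OF N, of i] chain_inD(1)[OF N, of "Suc i"] Suc.prems assms in auto)
      moreover have "clen F Y V + enat (Suc i) = (clen F Y V + enat i) + 1"
        by (simp add: one_enat_def add.assoc)
      ultimately show ?case using Suc by (metis Suc_leD add_right_mono order_trans)
    qed
    from this[of m] have "clen F Y V + enat m \<le> clen F Y (N m)" by simp
    also have "\<dots> \<le> clen F Y W" by (rule clen_mono) (use N in \<open>auto simp: chain_in_def\<close>)
    finally show ?thesis using enat by simp
  qed
next
  case infinity
  then show ?thesis using clen_mono[of Y V W W F] assms by auto
qed

text \<open>The two maps have to be strict only jointly: each strict step of a chain raises at least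
  one of the two lengths. Made for the pair consisting of intersection with, and sum with, a fixed
  submodule.\<close>

lemma clen_le_add_transfer:
  assumes "\<And>N. N \<in> F \<Longrightarrow> Y \<subseteq> N \<Longrightarrow> N \<subseteq> W \<Longrightarrow> p N \<in> F \<and> A \<subseteq> p N \<and> p N \<subseteq> B"
    and "\<And>N. N \<in> F \<Longrightarrow> Y \<subseteq> N \<Longrightarrow> N \<subseteq> W \<Longrightarrow> q N \<in> F \<and> C \<subseteq> q N \<and> q N \<subseteq> D"
    and "\<And>N N'. N \<in> F \<Longrightarrow> N' \<in> F \<Longrightarrow> Y \<subseteq> N \<Longrightarrow> N \<subset> N' \<Longrightarrow> N' \<subseteq> W \<Longrightarrow>
           p N \<subseteq> p N' \<and> q N \<subseteq> q N' \<and> (p N \<noteq> p N' \<or> q N \<noteq> q N')"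
  shows "clen F Y W \<le> clen F A B + clen F C D"
proof (rule clen_least)
  fix n N assume c: "chain_in F Y W n N"
  have "enat i \<le> clen F A (p (N i)) + clen F C (q (N i))" if "i \<le> n" for i
    using that
  proof (induction i)
    case 0 then show ?case by (simp add: zero_enat_def[symmetric])
  next
    case (Suc i)
    have 1: "N i \<in> F" "N (Suc i) \<in> F" "Y \<subseteq> N i" "N i \<subset> N (Suc i)" "N (Suc i) \<subseteq> W" "Y \<subseteq> N (Suc i)" "N i \<subseteq> W"
      using c Suc.prems by (auto simp: chain_in_def)
    have p: "p (N i) \<in> F" "p (N (Suc i)) \<in> F" "A \<subseteq> p (N i)" "q (N i) \<in> F" "q (N (Suc i)) \<in> F" "C \<subseteq> q (N i)"
      using assms(1,2) 1 by auto
    have m: "p (N i) \<subseteq> p (N (Suc i))" "q (N i) \<subseteq> q (N (Suc i))"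
       "p (N i) \<noteq> p (N (Suc i)) \<or> q (N i) \<noteq> q (N (Suc i))"
      using assms(3)[of "N i" "N (Suc i)"] 1 by auto
    have a: "clen F A (p (N i)) \<le> clen F A (p (N (Suc i)))" "clen F C (q (N i)) \<le> clen F C (q (N (Suc i)))"
      using m by (auto intro: clen_mono)
    have IH: "enat i \<le> clen F A (p (N i)) + clen F C (q (N i))" using Suc by simp
    have e: "enat (Suc i) = enat i + 1" by (simp add: one_enat_def)
    from m(3) show ?case
    proof
      assume "p (N i) \<noteq> p (N (Suc i))"
      then have "clen F A (p (N i)) + 1 \<le> clen F A (p (N (Suc i)))"
        using clen_snoc p m by blast
      then have "clen F A (p (N i)) + 1 + clen F C (q (N i)) \<le> clen F A (p (N (Suc i))) + clen F C (q (N (Suc i)))"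
        using a by (intro add_mono)
      with add_right_mono[OF IH, of 1] e show ?thesis
        unfolding e by (metis (no_types, lifting) add.assoc add.commute order_trans)
    next
      assume "q (N i) \<noteq> q (N (Suc i))"
      then have "clen F C (q (N i)) + 1 \<le> clen F C (q (N (Suc i)))"
        using clen_snoc p m by blast
      then have "clen F A (p (N i)) + (clen F C (q (N i)) + 1) \<le> clen F A (p (N (Suc i))) + clen F C (q (N (Suc i)))"
        using a by (intro add_mono)
      with add_right_mono[OF IH, of 1] e show ?thesis
        unfolding e by (metis (no_types, lifting) add.assoc add.commute order_trans)
    qed
  qed
  from this[of n] have "enat n \<le> clen F A (p (N n)) + clen F C (q (N n))" by simp
  also have "\<dots> \<le> clen F A B + clen F C D"
    using c assms(1,2)[of "N n"] by (intro add_mono clen_mono) (auto simp: chain_in_def)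
  finally show "enat n \<le> clen F A B + clen F C D" .
qed

text \<open>\<open>Z\<close> is the last but one member of a longest chain. By
  \<open>clen_superadd\<close> there is no room for more than \<open>l\<close> steps below it and
  one above it, so both lengths are exact.\<close>

lemma clen_last_step:
  assumes "clen F Y V = enat (Suc l)" "Y \<in> F" "V \<in> F" "Y \<subseteq> V"
  obtains Z where "Z \<in> F" "Y \<subseteq> Z" "Z \<subset> V" "clen F Y Z = enat l" "clen F Z V = 1"
proof -
  obtain N where N: "chain_in F Y V (Suc l) N"
    using clen_chain[of "Suc l" F Y V V] assms by auto
  define Z where "Z = N l"
  have Z: "Z \<in> F" "Y \<subseteq> Z" "Z \<subset> V" 
    using chain_inD[OF N, of l] chain_inD(3)[OF N, of "Suc l"] unfolding Z_def by auto
  have "enat l \<le> clen F Y Z"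
  proof (rule clen_upper)
    have "N i \<subseteq> N l" if "i \<le> l" for i
    proof -
      have "i \<le> k \<longrightarrow> k \<le> l \<longrightarrow> N i \<subseteq> N k" for k
      proof (induction k)
        case (Suc k)
        have "k < Suc l \<longrightarrow> N k \<subset> N (Suc k)" using N by (simp add: chain_in_def)
        then show ?case using Suc by (auto simp: le_Suc_eq)
      qed auto
      then show ?thesis using that by blast
    qed
    then show "chain_in F Y Z l N" using N unfolding chain_in_def Z_def by auto
  qed
  moreover have "1 \<le> clen F Z V"
    using clen_snoc[of Z F Z V] Z assms by (simp add: clen_same)
  moreover have "clen F Y Z + clen F Z V \<le> enat (Suc l)"
    using clen_superadd[of Z F Y V] Z assms by auto
  ultimately have "clen F Y Z = enat l" "clen F Z V = 1"
    by (cases "clen F Y Z"; cases "clen F Z V"; simp add: one_enat_def)+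
  then show ?thesis using that Z by blast
qed

section \<open>Modules restricted along an endomorphism\<close>

context cring
begin

definition endo :: "('a \<Rightarrow> 'a) \<Rightarrow> bool" where
  "endo \<psi> \<longleftrightarrow> \<psi> \<in> ring_hom R R"

definition psub :: "('a \<Rightarrow> 'a) \<Rightarrow> 'a set \<Rightarrow> bool" where
  "psub \<psi> U \<longleftrightarrow> U \<subseteq> carrier R \<and> \<zero> \<in> U \<and> (\<forall>x\<in>U. \<forall>y\<in>U. x \<oplus> y \<in> U) \<and> (\<forall>a\<in>carrier R. \<forall>x\<in>U. \<psi> a \<otimes> x \<in> U)"

text \<open>\<open>psub \<psi>\<close> describes the submodules of \<open>R\<close> as a module over itself through \<open>\<psi>\<close>. For \<open>T = {\<one>}\<close> the
  saturation condition in \<open>tsub\<close> is void and the length of a chain of \<open>tsub\<close> sets is the module length; when \<open>T\<close>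
  consists of all elements not killed by \<open>\<psi>\<close>, it is the dimension after passing to the field of fractions.\<close>
definition tsub :: "'a set \<Rightarrow> ('a \<Rightarrow> 'a) \<Rightarrow> 'a set \<Rightarrow> bool" where
  "tsub T \<psi> U \<longleftrightarrow> psub \<psi> U \<and> (\<forall>t\<in>T. \<forall>x\<in>carrier R. \<psi> t \<otimes> x \<in> U \<longrightarrow> x \<in> U)"

text \<open>The coefficient set \<open>C\<close> is kept variable: all of \<open>R\<close> adjoins a
  cyclic submodule, an ideal such as \<open>m\<close> produces the products in Nakayama's lemma, and
  a \<chi>-submodule produces a submodule for the composite
  \<open>\<psi> \<circ> \<chi>\<close>.\<close>

definition ext :: "'a set \<Rightarrow> ('a \<Rightarrow> 'a) \<Rightarrow> 'a set \<Rightarrow> 'a \<Rightarrow> 'a set" where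
  "ext C \<psi> Y e = {y \<oplus> \<psi> a \<otimes> e | y a. y \<in> Y \<and> a \<in> C}"

definition sat :: "'a set \<Rightarrow> ('a \<Rightarrow> 'a) \<Rightarrow> 'a set \<Rightarrow> 'a set" where
  "sat T \<psi> U = {x \<in> carrier R. \<exists>t\<in>T. \<psi> t \<otimes> x \<in> U}"

definition psum :: "'a set \<Rightarrow> 'a set \<Rightarrow> 'a set" where
  "psum A B = {x \<oplus> y | x y. x \<in> A \<and> y \<in> B}"

definition mset :: "'a set \<Rightarrow> bool" where
  "mset T \<longleftrightarrow> T \<subseteq> carrier R \<and> \<one> \<in> T \<and> (\<forall>s\<in>T. \<forall>t\<in>T. s \<otimes> t \<in> T)"

text \<open>Once \<open>T\<close> is inverted, every element outside \<open>P\<close> becomes a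
  unit, so the localization is local with maximal ideal coming from \<open>P\<close>. Instances:
  \<open>({\<one>}, m)\<close> in a local ring, and the nonzero elements with
  \<open>{\<zero>}\<close> in a domain.\<close>

definition prime_pair :: "'a set \<Rightarrow> 'a set \<Rightarrow> bool" where
  "prime_pair T P \<longleftrightarrow> mset T \<and> psub id P \<and> T \<inter> P = {} \<and> (\<forall>a\<in>carrier R - P. \<exists>b\<in>carrier R. a \<otimes> b \<in> T)"

abbreviation tlen :: "'a set \<Rightarrow> ('a \<Rightarrow> 'a) \<Rightarrow> 'a set \<Rightarrow> 'a set \<Rightarrow> enat" where
  "tlen T \<psi> \<equiv> clen (Collect (tsub T \<psi>))"

lemma endo_simps [simp]:
  assumes "endo \<psi>"
  shows "x \<in> carrier R \<Longrightarrow> \<psi> x \<in> carrier R"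
    "x \<in> carrier R \<Longrightarrow> y \<in> carrier R \<Longrightarrow> \<psi> (x \<otimes> y) = \<psi> x \<otimes> \<psi> y"
    "x \<in> carrier R \<Longrightarrow> y \<in> carrier R \<Longrightarrow> \<psi> (x \<oplus> y) = \<psi> x \<oplus> \<psi> y"
    "\<psi> \<one> = \<one>"
    "\<psi> \<zero> = \<zero>"
  using assms ring_hom_zero[OF _ ring_axioms ring_axioms] unfolding endo_def
  by (auto simp: ring_hom_closed ring_hom_mult ring_hom_add ring_hom_one)

lemma endo_uminus [simp]:
  assumes "endo \<psi>" "x \<in> carrier R" shows "\<psi> (\<ominus> x) = \<ominus> \<psi> x"
proof -
  have "\<psi> (\<ominus> x) \<oplus> \<psi> x = \<zero>"
    using assms by (metis a_inv_closed endo_simps(3,5) l_neg)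
  then show ?thesis using assms by (simp add: minus_equality)
qed

lemma endo_id [simp]: "endo id"
  unfolding endo_def by (simp add: id_ring_hom)

lemma endo_comp [simp]: "endo \<psi> \<Longrightarrow> endo \<chi> \<Longrightarrow> endo (\<psi> \<circ> \<chi>)"
  unfolding endo_def by (rule ring_hom_trans)

lemma endo_funpow [simp]: "endo \<psi> \<Longrightarrow> endo (\<psi> ^^ n)"
  by (induction n) auto

lemma psubD:
  assumes "psub \<psi> U"
  shows "x \<in> U \<Longrightarrow> x \<in> carrier R" "\<zero> \<in> U" "x \<in> U \<Longrightarrow> y \<in> U \<Longrightarrow> x \<oplus> y \<in> U"
    "a \<in> carrier R \<Longrightarrow> x \<in> U \<Longrightarrow> \<psi> a \<otimes> x \<in> U" "U \<subseteq> carrier R"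
  using assms unfolding psub_def by auto

lemma psub_idD: "psub id U \<Longrightarrow> a \<in> carrier R \<Longrightarrow> x \<in> U \<Longrightarrow> a \<otimes> x \<in> U"
  "psub id U \<Longrightarrow> a \<in> carrier R \<Longrightarrow> x \<in> U \<Longrightarrow> x \<otimes> a \<in> U"
  unfolding psub_def by (auto simp: m_comm[of x a] subsetD)

lemma psub_uminus:
  assumes "endo \<psi>" "psub \<psi> U" "x \<in> U" shows "\<ominus> x \<in> U"
proof -
  have "\<psi> (\<ominus> \<one>) \<otimes> x \<in> U" using assms by (intro psubD(4)) auto
  then show ?thesis using assms psubD(1)[OF assms(2,3)] by (simp add: l_minus)
qed

lemma psub_cancel:
  assumes "endo \<psi>" "psub \<psi> U" "x \<oplus> y \<in> U" "y \<in> U" "x \<in> carrier R" shows "x \<in> U"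
proof -
  have "(x \<oplus> y) \<oplus> \<ominus> y \<in> U" using assms psub_uminus psubD by blast
  moreover have "(x \<oplus> y) \<oplus> \<ominus> y = x" using assms psubD(1)[OF assms(2,4)] by (simp add: a_assoc r_neg)
  ultimately show ?thesis by simp
qed

lemma psub_diffD:
  assumes "endo \<psi>" "psub \<psi> U" "x \<in> U" "y \<in> U" shows "x \<ominus> y \<in> U"
  using assms psub_uminus psubD by (simp add: minus_eq)

lemma psub_carrier [simp]: "endo \<psi> \<Longrightarrow> psub \<psi> (carrier R)"
  unfolding psub_def by auto

lemma psub_zero [simp]: "endo \<psi> \<Longrightarrow> psub \<psi> {\<zero>}"
  unfolding psub_def by auto

lemma psub_Int: "psub \<psi> U \<Longrightarrow> psub \<psi> V \<Longrightarrow> psub \<psi> (U \<inter> V)"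
  unfolding psub_def by auto

lemma psub_comp: "endo \<psi> \<Longrightarrow> endo \<chi> \<Longrightarrow> psub \<psi> U \<Longrightarrow> psub (\<psi> \<circ> \<chi>) U"
  unfolding psub_def by auto

lemma psub_of_id: "endo \<psi> \<Longrightarrow> psub id U \<Longrightarrow> psub \<psi> U"
  using psub_comp[of id \<psi>] by simp

lemma tsubD: "tsub T \<psi> U \<Longrightarrow> psub \<psi> U"
  "tsub T \<psi> U \<Longrightarrow> t \<in> T \<Longrightarrow> x \<in> carrier R \<Longrightarrow> \<psi> t \<otimes> x \<in> U \<Longrightarrow> x \<in> U"
  unfolding tsub_def by auto

lemma tsub_Int: "tsub T \<psi> U \<Longrightarrow> tsub T \<psi> V \<Longrightarrow> tsub T \<psi> (U \<inter> V)"
  unfolding tsub_def using psub_Int by auto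

lemma tsub_carrier [simp]: "endo \<psi> \<Longrightarrow> tsub T \<psi> (carrier R)"
  unfolding tsub_def by auto

lemma tsub_one: "endo \<psi> \<Longrightarrow> tsub {\<one>} \<psi> U \<longleftrightarrow> psub \<psi> U"
  unfolding tsub_def psub_def by auto

lemma msetD: "mset T \<Longrightarrow> t \<in> T \<Longrightarrow> t \<in> carrier R" "mset T \<Longrightarrow> \<one> \<in> T"
  "mset T \<Longrightarrow> s \<in> T \<Longrightarrow> t \<in> T \<Longrightarrow> s \<otimes> t \<in> T"
  unfolding mset_def by auto

lemma mset_one [simp]: "mset {\<one>}"
  unfolding mset_def by auto

lemma in_extI: "y \<in> Y \<Longrightarrow> a \<in> C \<Longrightarrow> y \<oplus> \<psi> a \<otimes> e \<in> ext C \<psi> Y e"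
  unfolding ext_def by blast

lemma in_extE:
  assumes "x \<in> ext C \<psi> Y e"
  obtains y a where "y \<in> Y" "a \<in> C" "x = y \<oplus> \<psi> a \<otimes> e"
  using assms unfolding ext_def by blast

text \<open>Scaling \<open>\<psi> a \<otimes> e\<close> by \<open>\<psi> (\<chi> b)\<close> replaces
  the coefficient \<open>a\<close> by \<open>\<chi> b \<otimes> a\<close>, so coefficients that are
  stable only under \<chi> suffice.\<close>

lemma ext_psub:
  assumes "endo \<psi>" "endo \<chi>" "psub (\<psi> \<circ> \<chi>) Y" "psub \<chi> C" "e \<in> carrier R"
  shows "psub (\<psi> \<circ> \<chi>) (ext C \<psi> Y e)"
  unfolding psub_def
proof (intro conjI ballI)
  note c = psubD(1)[OF assms(3)] psubD(1)[OF assms(4)]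
  show "ext C \<psi> Y e \<subseteq> carrier R" using assms c by (auto simp: ext_def)
  have "\<zero> \<oplus> \<psi> \<zero> \<otimes> e \<in> ext C \<psi> Y e" using assms by (intro in_extI) (auto simp: psubD)
  then show "\<zero> \<in> ext C \<psi> Y e" using assms by simp
next
  note c = psubD(1)[OF assms(3)] psubD(1)[OF assms(4)]
  fix x x' assume "x \<in> ext C \<psi> Y e" "x' \<in> ext C \<psi> Y e"
  then obtain y a y' a' where *: "y \<in> Y" "a \<in> C" "x = y \<oplus> \<psi> a \<otimes> e" "y' \<in> Y" "a' \<in> C" "x' = y' \<oplus> \<psi> a' \<otimes> e"
    by (auto elim!: in_extE)
  have "(y \<oplus> y') \<oplus> \<psi> (a \<oplus> a') \<otimes> e \<in> ext C \<psi> Y e" using * assms psubD by (intro in_extI) auto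
  moreover have "(y \<oplus> y') \<oplus> \<psi> (a \<oplus> a') \<otimes> e = x \<oplus> x'"
    using * assms c by (simp add: l_distr a_ac)
  ultimately show "x \<oplus> x' \<in> ext C \<psi> Y e" by simp
next
  note c = psubD(1)[OF assms(3)] psubD(1)[OF assms(4)]
  fix b x assume b: "b \<in> carrier R" and "x \<in> ext C \<psi> Y e"
  then obtain y a where *: "y \<in> Y" "a \<in> C" "x = y \<oplus> \<psi> a \<otimes> e" by (auto elim!: in_extE)
  have "(\<psi> \<circ> \<chi>) b \<otimes> y \<oplus> \<psi> (\<chi> b \<otimes> a) \<otimes> e \<in> ext C \<psi> Y e"
    using * b psubD(4)[OF assms(3) b] psubD(4)[OF assms(4) b] by (intro in_extI) auto
  moreover have "(\<psi> \<circ> \<chi>) b \<otimes> y \<oplus> \<psi> (\<chi> b \<otimes> a) \<otimes> e = (\<psi> \<circ> \<chi>) b \<otimes> x"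
    using * assms c b by (simp add: r_distr m_ac)
  ultimately show "(\<psi> \<circ> \<chi>) b \<otimes> x \<in> ext C \<psi> Y e" by simp
qed

lemma ext_psub1: "endo \<psi> \<Longrightarrow> psub \<psi> Y \<Longrightarrow> psub id C \<Longrightarrow> e \<in> carrier R \<Longrightarrow> psub \<psi> (ext C \<psi> Y e)"
  using ext_psub[of \<psi> id Y C e] by simp

lemma ext_ge:
  assumes "endo \<psi>" "Y \<subseteq> carrier R" "\<zero> \<in> C" "e \<in> carrier R" shows "Y \<subseteq> ext C \<psi> Y e"
proof
  fix y assume "y \<in> Y"
  then have "y \<oplus> \<psi> \<zero> \<otimes> e \<in> ext C \<psi> Y e" using assms by (intro in_extI) auto
  then show "y \<in> ext C \<psi> Y e" using assms \<open>y \<in> Y\<close> by (auto simp: subsetD)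
qed

lemma ext_mem:
  assumes "endo \<psi>" "\<zero> \<in> Y" "a \<in> C" "a \<in> carrier R" "e \<in> carrier R" shows "\<psi> a \<otimes> e \<in> ext C \<psi> Y e"
  using in_extI[of \<zero> Y a C \<psi> e] assms by simp

lemma ext_self:
  assumes "endo \<psi>" "\<zero> \<in> Y" "\<one> \<in> C" "e \<in> carrier R" shows "e \<in> ext C \<psi> Y e"
  using ext_mem[of \<psi> Y \<one> C e] assms by simp

lemma ext_least: "psub \<psi> U \<Longrightarrow> Y \<subseteq> U \<Longrightarrow> e \<in> U \<Longrightarrow> C \<subseteq> carrier R \<Longrightarrow> ext C \<psi> Y e \<subseteq> U"
  unfolding psub_def ext_def by blast

lemma ext_mono: "Y \<subseteq> Y' \<Longrightarrow> C \<subseteq> C' \<Longrightarrow> ext C \<psi> Y e \<subseteq> ext C' \<psi> Y' e"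
  unfolding ext_def by blast

lemma sat_tsub:
  assumes "mset T" "endo \<psi>" "psub \<psi> U" shows "tsub T \<psi> (sat T \<psi> U)"
  unfolding tsub_def psub_def
proof (intro conjI ballI impI)
  show "sat T \<psi> U \<subseteq> carrier R" by (auto simp: sat_def)
  show "\<zero> \<in> sat T \<psi> U" using assms psubD(2)[OF assms(3)] by (auto simp: sat_def mset_def intro!: bexI[of _ \<one>])
next
  fix x y assume "x \<in> sat T \<psi> U" "y \<in> sat T \<psi> U"
  then obtain s t where *: "x \<in> carrier R" "y \<in> carrier R" "s \<in> T" "t \<in> T" "\<psi> s \<otimes> x \<in> U" "\<psi> t \<otimes> y \<in> U"
    by (auto simp: sat_def)
  have c: "s \<in> carrier R" "t \<in> carrier R" using * assms(1) msetD by auto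
  have "\<psi> t \<otimes> (\<psi> s \<otimes> x) \<oplus> \<psi> s \<otimes> (\<psi> t \<otimes> y) \<in> U" using * c assms psubD by metis
  moreover have "\<psi> t \<otimes> (\<psi> s \<otimes> x) \<oplus> \<psi> s \<otimes> (\<psi> t \<otimes> y) = \<psi> (s \<otimes> t) \<otimes> (x \<oplus> y)"
    using * c assms by (simp add: r_distr m_ac)
  ultimately show "x \<oplus> y \<in> sat T \<psi> U" using * assms(1) msetD(3) unfolding sat_def by force
next
  fix a x assume a: "a \<in> carrier R" and "x \<in> sat T \<psi> U"
  then obtain s where *: "x \<in> carrier R" "s \<in> T" "\<psi> s \<otimes> x \<in> U" by (auto simp: sat_def)
  have c: "s \<in> carrier R" using * assms(1) msetD by auto
  have "\<psi> s \<otimes> (\<psi> a \<otimes> x) = \<psi> a \<otimes> (\<psi> s \<otimes> x)" using * c a assms by (simp add: m_ac)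
  also have "\<dots> \<in> U" using * a assms psubD by blast
  finally show "\<psi> a \<otimes> x \<in> sat T \<psi> U" using * a assms unfolding sat_def by auto
next
  fix t x assume t: "t \<in> T" and x: "x \<in> carrier R" and "\<psi> t \<otimes> x \<in> sat T \<psi> U"
  then obtain s where *: "s \<in> T" "\<psi> s \<otimes> (\<psi> t \<otimes> x) \<in> U" by (auto simp: sat_def)
  have c: "s \<in> carrier R" "t \<in> carrier R" using * t assms(1) msetD by auto
  have "\<psi> (s \<otimes> t) \<otimes> x \<in> U" using * c x assms by (simp add: m_assoc)
  then show "x \<in> sat T \<psi> U" using * t x assms(1) msetD(3) unfolding sat_def by force
qed

lemma sat_ge:
  assumes "mset T" "endo \<psi>" "U \<subseteq> carrier R" shows "U \<subseteq> sat T \<psi> U"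
proof
  fix x assume "x \<in> U"
  then have "x \<in> carrier R" "\<psi> \<one> \<otimes> x \<in> U" using assms by (auto simp: subsetD)
  then show "x \<in> sat T \<psi> U" using assms msetD(2) unfolding sat_def by blast
qed

lemma sat_least: "tsub T \<psi> V \<Longrightarrow> U \<subseteq> V \<Longrightarrow> sat T \<psi> U \<subseteq> V"
  unfolding sat_def using tsubD(2) by blast

lemma sat_mono: "U \<subseteq> V \<Longrightarrow> sat T \<psi> U \<subseteq> sat T \<psi> V"
  unfolding sat_def by blast

lemma sat_one: "endo \<psi> \<Longrightarrow> U \<subseteq> carrier R \<Longrightarrow> sat {\<one>} \<psi> U = U"
  unfolding sat_def by auto

section \<open>Sums of submodules and additivity of chain length\<close>

lemma psum_psub:
  assumes "endo \<psi>" "psub \<psi> A" "psub \<psi> B" shows "psub \<psi> (psum A B)"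
  unfolding psub_def
proof (intro conjI ballI)
  show "psum A B \<subseteq> carrier R" using psubD(1)[OF assms(2)] psubD(1)[OF assms(3)] by (auto simp: psum_def)
  have "\<zero> \<oplus> \<zero> \<in> psum A B" using psubD(2)[OF assms(2)] psubD(2)[OF assms(3)] unfolding psum_def by blast
  then show "\<zero> \<in> psum A B" by simp
next
  fix x x' assume "x \<in> psum A B" "x' \<in> psum A B"
  then obtain y z y' z' where *: "y \<in> A" "z \<in> B" "x = y \<oplus> z" "y' \<in> A" "z' \<in> B" "x' = y' \<oplus> z'"
    by (auto simp: psum_def)
  have "(y \<oplus> y') \<oplus> (z \<oplus> z') \<in> psum A B" using * assms psubD(3) unfolding psum_def by blast
  moreover have "(y \<oplus> y') \<oplus> (z \<oplus> z') = x \<oplus> x'"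
    using * assms psubD(1)[OF assms(2)] psubD(1)[OF assms(3)] by (simp add: a_ac)
  ultimately show "x \<oplus> x' \<in> psum A B" by simp
next
  fix b x assume b: "b \<in> carrier R" and "x \<in> psum A B"
  then obtain y z where *: "y \<in> A" "z \<in> B" "x = y \<oplus> z" by (auto simp: psum_def)
  have "\<psi> b \<otimes> y \<oplus> \<psi> b \<otimes> z \<in> psum A B" using * b assms psubD(4) unfolding psum_def by blast
  moreover have "\<psi> b \<otimes> y \<oplus> \<psi> b \<otimes> z = \<psi> b \<otimes> x"
    using * b assms psubD(1)[OF assms(2)] psubD(1)[OF assms(3)] by (simp add: r_distr)
  ultimately show "\<psi> b \<otimes> x \<in> psum A B" by simp
qed

lemma psum_ge:
  assumes "\<zero> \<in> A" "\<zero> \<in> B" "A \<subseteq> carrier R" "B \<subseteq> carrier R"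
  shows "A \<subseteq> psum A B" "B \<subseteq> psum A B"
proof -
  have "x \<oplus> \<zero> \<in> psum A B" if "x \<in> A" for x using that assms(2) unfolding psum_def by blast
  then show "A \<subseteq> psum A B" using assms(3) by (auto simp: subsetD)
  have "\<zero> \<oplus> x \<in> psum A B" if "x \<in> B" for x using that assms(1) unfolding psum_def by blast
  then show "B \<subseteq> psum A B" using assms(4) by (auto simp: subsetD)
qed

lemma psum_least: "psub \<psi> U \<Longrightarrow> A \<subseteq> U \<Longrightarrow> B \<subseteq> U \<Longrightarrow> psum A B \<subseteq> U"
  unfolding psum_def psub_def by blast

lemma psum_mono: "A \<subseteq> A' \<Longrightarrow> psum A B \<subseteq> psum A' B"
  unfolding psum_def by blast

text \<open>The nontrivial direction splits a chain into the traces \<open>N \<inter> V\<close> and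
  the saturated sums of \<open>N\<close> with \<open>V\<close>. If neither changed from
  \<open>N\<close> to \<open>N'\<close>, then for x in \<open>N'\<close> some multiple
  \<open>\<psi> t \<otimes> x\<close> is \<open>n \<oplus> v\<close> with v in
  \<open>N' \<inter> V = N \<inter> V\<close>; this multiple lies in \<open>N\<close>, and
  saturation gives x in \<open>N\<close>.\<close>

lemma tlen_add:
  assumes "mset T" "endo \<psi>" "tsub T \<psi> V" "tsub T \<psi> W" "Y \<subseteq> V" "V \<subseteq> W"
  shows "tlen T \<psi> Y W = tlen T \<psi> Y V + tlen T \<psi> V W"
proof (rule antisym)
  show "tlen T \<psi> Y V + tlen T \<psi> V W \<le> tlen T \<psi> Y W"
    using assms by (intro clen_superadd) auto
  define q where "q N = sat T \<psi> (psum N V)" for N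
  note V = psubD[OF tsubD(1)[OF assms(3)]]
  have q: "tsub T \<psi> (q N) \<and> V \<subseteq> q N \<and> q N \<subseteq> W" if "tsub T \<psi> N" "N \<subseteq> W" for N
  proof -
    have p: "psub \<psi> (psum N V)" using that assms tsubD(1) by (intro psum_psub) auto
    have "tsub T \<psi> (q N)" unfolding q_def using assms p by (intro sat_tsub)
    moreover have "V \<subseteq> psum N V" using psum_ge(2)[of N V] psubD(2,5)[OF tsubD(1)[OF that(1)]] V(2,5) by blast
    moreover have "psum N V \<subseteq> q N" unfolding q_def using assms p psubD by (intro sat_ge) auto
    moreover have "q N \<subseteq> W" unfolding q_def
      using assms that tsubD(1) by (intro sat_least psum_least) auto
    ultimately show ?thesis by blast
  qed
  show "tlen T \<psi> Y W \<le> tlen T \<psi> Y V + tlen T \<psi> V W"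
  proof (rule clen_le_add_transfer[where p = "\<lambda>N. N \<inter> V" and q = q])
    fix N assume "N \<in> Collect (tsub T \<psi>)" "Y \<subseteq> N" "N \<subseteq> W"
    then show "N \<inter> V \<in> Collect (tsub T \<psi>) \<and> Y \<subseteq> N \<inter> V \<and> N \<inter> V \<subseteq> V"
      using assms tsub_Int by auto
  next
    fix N assume "N \<in> Collect (tsub T \<psi>)" "Y \<subseteq> N" "N \<subseteq> W"
    then show "q N \<in> Collect (tsub T \<psi>) \<and> V \<subseteq> q N \<and> q N \<subseteq> W" using q by auto
  next
    fix N N' assume *: "N \<in> Collect (tsub T \<psi>)" "N' \<in> Collect (tsub T \<psi>)" "Y \<subseteq> N" "N \<subset> N'" "N' \<subseteq> W"
    have "False" if e: "N \<inter> V = N' \<inter> V" "q N = q N'"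
    proof -
      obtain x where x: "x \<in> N'" "x \<notin> N" using * by blast
      have N': "psub \<psi> N'" "psub \<psi> N" using * tsubD by auto
      have xc: "x \<in> carrier R" using x N' psubD by blast
      have "x \<in> psum N' V" using psum_ge(1)[of N' V] V(2,5) psubD[OF N'(1)] x by blast
      then have "x \<in> q N'" unfolding q_def
        using sat_ge[OF assms(1,2), of "psum N' V"] psum_psub[OF assms(2) N'(1) tsubD(1)[OF assms(3)]] psubD by blast
      then have "x \<in> q N" by (simp only: e(2))
      then have "x \<in> sat T \<psi> (psum N V)" unfolding q_def .
      then obtain t n v where t: "t \<in> T" "n \<in> N" "v \<in> V" "\<psi> t \<otimes> x = n \<oplus> v"
        unfolding sat_def psum_def mem_Collect_eq by (elim conjE bexE exE) simp
      have c: "n \<in> carrier R" "v \<in> carrier R" "t \<in> carrier R" 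
        using t psubD(1)[OF N'(2)] V(1) msetD(1)[OF assms(1)] by auto
      have "\<psi> t \<otimes> x \<in> N'" using psubD(4)[OF N'(1) c(3)] x by blast
      then have "v \<oplus> n \<in> N'" using t c by (simp add: a_comm)
      then have "v \<in> N'" using psub_cancel[OF assms(2) N'(1), of v n] t c * by auto
      then have "v \<in> N" using e t by blast
      then have "\<psi> t \<otimes> x \<in> N" using t psubD(3)[OF N'(2)] by auto
      then show False using x * t xc tsubD(2)[of T \<psi> N t x] by auto
    qed
    then show "N \<inter> V \<subseteq> N' \<inter> V \<and> q N \<subseteq> q N' \<and> (N \<inter> V \<noteq> N' \<inter> V \<or> q N \<noteq> q N')"
      using * unfolding q_def by (auto intro!: sat_mono psum_mono)
  qed
qed

text \<open>Pulling back along the map a \<mapsto> \<open>\<psi> a \<otimes> e\<close> turns a chain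
  above \<open>N\<close> into a chain of \<chi>-submodules above \<open>C\<close>. Strict steps stay
  strict because every element of \<open>W\<close> is, up to a denominator in \<open>T\<close>, an
  element of \<open>N\<close> plus some \<open>\<psi> a \<otimes> e\<close>.\<close>

lemma cyclic_upper:
  assumes "mset T" "endo \<psi>" "endo \<chi>" "psub (\<psi> \<circ> \<chi>) N" "e \<in> carrier R" "C \<subseteq> carrier R"
    and "\<And>a. a \<in> C \<Longrightarrow> \<psi> a \<otimes> e \<in> N"
    and "W \<subseteq> sat T (\<psi> \<circ> \<chi>) (ext (carrier R) \<psi> N e)"
  shows "tlen T (\<psi> \<circ> \<chi>) N W \<le> tlen T \<chi> C (carrier R)"
proof (rule clen_le_transfer[where f = "\<lambda>M. {a \<in> carrier R. \<psi> a \<otimes> e \<in> M}"])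
  fix M assume *: "M \<in> Collect (tsub T (\<psi> \<circ> \<chi>))" "N \<subseteq> M" "M \<subseteq> W"
  have M: "psub (\<psi> \<circ> \<chi>) M" using * tsubD by auto
  have "tsub T \<chi> {a \<in> carrier R. \<psi> a \<otimes> e \<in> M}"
    unfolding tsub_def psub_def
  proof (intro conjI ballI impI)
    fix x y assume "x \<in> {a \<in> carrier R. \<psi> a \<otimes> e \<in> M}" "y \<in> {a \<in> carrier R. \<psi> a \<otimes> e \<in> M}"
    then show "x \<oplus> y \<in> {a \<in> carrier R. \<psi> a \<otimes> e \<in> M}" using assms psubD(3)[OF M] by (auto simp: l_distr)
  next
    fix a x assume "a \<in> carrier R" "x \<in> {a \<in> carrier R. \<psi> a \<otimes> e \<in> M}"
    then show "\<chi> a \<otimes> x \<in> {a \<in> carrier R. \<psi> a \<otimes> e \<in> M}" using assms psubD(4)[OF M, of a] by (auto simp: m_assoc)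
  next
    fix t x assume "t \<in> T" "x \<in> carrier R" "\<chi> t \<otimes> x \<in> {a \<in> carrier R. \<psi> a \<otimes> e \<in> M}"
    moreover from this have "\<psi> (\<chi> t) \<otimes> (\<psi> x \<otimes> e) \<in> M" 
      using assms msetD(1)[OF assms(1)] by (auto simp: m_assoc[symmetric])
    ultimately show "x \<in> {a \<in> carrier R. \<psi> a \<otimes> e \<in> M}" 
      using * assms msetD(1)[OF assms(1)] tsubD(2)[of T "\<psi> \<circ> \<chi>" M t "\<psi> x \<otimes> e"] by auto
  qed (use assms psubD[OF M] in auto)
  moreover have "C \<subseteq> {a \<in> carrier R. \<psi> a \<otimes> e \<in> M}" using assms * by auto
  ultimately show "{a \<in> carrier R. \<psi> a \<otimes> e \<in> M} \<in> Collect (tsub T \<chi>) \<and>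
         C \<subseteq> {a \<in> carrier R. \<psi> a \<otimes> e \<in> M} \<and> {a \<in> carrier R. \<psi> a \<otimes> e \<in> M} \<subseteq> carrier R" by auto
next
  fix M M' assume *: "M \<in> Collect (tsub T (\<psi> \<circ> \<chi>))" "M' \<in> Collect (tsub T (\<psi> \<circ> \<chi>))" "N \<subseteq> M" "M \<subset> M'" "M' \<subseteq> W"
  then obtain x where x: "x \<in> M'" "x \<notin> M" by blast
  have M: "psub (\<psi> \<circ> \<chi>) M" "psub (\<psi> \<circ> \<chi>) M'" using * tsubD by auto
  have "x \<in> sat T (\<psi> \<circ> \<chi>) (ext (carrier R) \<psi> N e)" using x * assms by blast
  then obtain t n a where t: "x \<in> carrier R" "t \<in> T" "n \<in> N" "a \<in> carrier R" "(\<psi> \<circ> \<chi>) t \<otimes> x = n \<oplus> \<psi> a \<otimes> e"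
    unfolding sat_def by (auto elim!: in_extE)
  have n: "n \<in> carrier R" using t assms psubD by blast
  have tc: "t \<in> carrier R" using t assms(1) msetD by blast
  have nM: "n \<in> M" "n \<in> M'" using t * by auto
  have "(\<psi> \<circ> \<chi>) t \<otimes> x \<in> M'" using psubD(4)[OF M(2) tc] x by auto
  then have "\<psi> a \<otimes> e \<oplus> n \<in> M'" using t n assms by (simp add: a_comm)
  then have "\<psi> a \<otimes> e \<in> M'"
    using psub_cancel[of "\<psi> \<circ> \<chi>" M' "\<psi> a \<otimes> e" n] M nM assms t by auto
  moreover have "\<psi> a \<otimes> e \<notin> M"
  proof
    assume "\<psi> a \<otimes> e \<in> M"
    then have "(\<psi> \<circ> \<chi>) t \<otimes> x \<in> M" using t nM psubD(3)[OF M(1)] by simp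
    then show False using tsubD(2)[of T "\<psi> \<circ> \<chi>" M t x] * t x by auto
  qed
  ultimately show "{a \<in> carrier R. \<psi> a \<otimes> e \<in> M} \<subset> {a \<in> carrier R. \<psi> a \<otimes> e \<in> M'}"
    using t * by blast
qed

end

context cring
begin

lemma psub_lin:
  assumes "endo \<psi>" "psub \<psi> N" "a \<in> carrier R" "b \<in> carrier R" "e \<in> carrier R" "n \<in> N"
    "\<psi> a \<otimes> e = n \<oplus> \<psi> b \<otimes> e"
  shows "\<psi> (a \<ominus> b) \<otimes> e \<in> N"
proof -
  have n: "n \<in> carrier R" using assms psubD by blast
  have "\<psi> (a \<ominus> b) \<otimes> e = \<psi> a \<otimes> e \<oplus> \<ominus> (\<psi> b \<otimes> e)"
    using assms n by (simp add: minus_eq l_distr l_minus)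
  also have "\<dots> = n" using assms n by (simp add: a_assoc r_neg)
  finally show ?thesis using assms by simp
qed

text \<open>The counterpart of \<open>cyclic_upper\<close>: a \<chi>-submodule \<open>U\<close>
  above \<open>P\<close> is sent to the saturation of \<open>ext U \<psi> N e\<close>. The
  annihilator of \<open>e\<close> modulo \<open>N\<close> lies in \<open>P\<close>, hence in
  \<open>U\<close>, so membership in \<open>U\<close> can be read off from the image and no two
  steps are identified.\<close>

lemma cyclic_lower:
  assumes "mset T" "endo \<psi>" "endo \<chi>" "psub \<psi> N" "e \<in> carrier R" "psub \<psi> W" "e \<in> W" "N \<subseteq> W"
    and "tsub T (\<psi> \<circ> \<chi>) W"
    and "\<And>a. a \<in> carrier R \<Longrightarrow> \<psi> a \<otimes> e \<in> N \<Longrightarrow> a \<in> P"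
  shows "tlen T \<chi> P (carrier R) \<le> tlen T (\<psi> \<circ> \<chi>) N W"
proof (rule clen_le_transfer[where f = "\<lambda>U. sat T (\<psi> \<circ> \<chi>) (ext U \<psi> N e)"])
  note Npc = psub_comp[OF assms(2,3,4)]
  have ex: "psub (\<psi> \<circ> \<chi>) (ext U \<psi> N e)" if "tsub T \<chi> U" for U
    using that assms Npc tsubD(1) by (intro ext_psub) auto
  show "sat T (\<psi> \<circ> \<chi>) (ext M \<psi> N e) \<in> Collect (tsub T (\<psi> \<circ> \<chi>)) \<and> N \<subseteq> sat T (\<psi> \<circ> \<chi>) (ext M \<psi> N e) \<and>
         sat T (\<psi> \<circ> \<chi>) (ext M \<psi> N e) \<subseteq> W"
    if M: "M \<in> Collect (tsub T \<chi>)" "P \<subseteq> M" "M \<subseteq> carrier R" for M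
  proof -
    have "tsub T (\<psi> \<circ> \<chi>) (sat T (\<psi> \<circ> \<chi>) (ext M \<psi> N e))"
      using ex M assms by (intro sat_tsub) auto
    moreover have "N \<subseteq> ext M \<psi> N e"
      using assms psubD(5)[OF assms(4)] psubD(2)[OF tsubD(1)[of T \<chi> M]] M by (intro ext_ge) auto
    moreover have "ext M \<psi> N e \<subseteq> sat T (\<psi> \<circ> \<chi>) (ext M \<psi> N e)"
      using assms psubD(5)[OF ex, of M] M by (intro sat_ge) auto
    moreover have "sat T (\<psi> \<circ> \<chi>) (ext M \<psi> N e) \<subseteq> W"
      using assms M by (intro sat_least ext_least) auto
    ultimately show ?thesis by auto
  qed
  fix M M' assume M: "M \<in> Collect (tsub T \<chi>)" "M' \<in> Collect (tsub T \<chi>)" "P \<subseteq> M" "M \<subset> M'" "M' \<subseteq> carrier R"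
  then obtain u where u: "u \<in> M'" "u \<notin> M" "u \<in> carrier R" by blast
  have pM: "psub \<chi> M" "psub \<chi> M'" using M tsubD(1) by auto
  have "\<psi> u \<otimes> e \<in> ext M' \<psi> N e" using assms psubD(2)[OF assms(4)] u by (intro ext_mem) auto
  then have 1: "\<psi> u \<otimes> e \<in> sat T (\<psi> \<circ> \<chi>) (ext M' \<psi> N e)"
    using sat_ge[OF assms(1), of "\<psi> \<circ> \<chi>" "ext M' \<psi> N e"] assms psubD(5)[OF ex, of M'] M by auto
  have 2: "\<psi> u \<otimes> e \<notin> sat T (\<psi> \<circ> \<chi>) (ext M \<psi> N e)"
  proof
    assume "\<psi> u \<otimes> e \<in> sat T (\<psi> \<circ> \<chi>) (ext M \<psi> N e)"
    then obtain t where t: "t \<in> T" "(\<psi> \<circ> \<chi>) t \<otimes> (\<psi> u \<otimes> e) \<in> ext M \<psi> N e"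
      unfolding sat_def by auto
    have tc: "t \<in> carrier R" using t assms(1) msetD by auto
    obtain n b where n: "n \<in> N" "b \<in> M" "(\<psi> \<circ> \<chi>) t \<otimes> (\<psi> u \<otimes> e) = n \<oplus> \<psi> b \<otimes> e"
      using t(2) by (rule in_extE)
    have b: "b \<in> carrier R" using psubD(1)[OF pM(1)] n by auto
    have "\<psi> (\<chi> t \<otimes> u) \<otimes> e = n \<oplus> \<psi> b \<otimes> e" using n tc u assms by (simp add: m_assoc)
    then have "\<psi> (\<chi> t \<otimes> u \<ominus> b) \<otimes> e \<in> N" using psub_lin[OF assms(2,4)] tc u b n assms by simp
    then have "\<chi> t \<otimes> u \<ominus> b \<in> M" using assms(10)[of "\<chi> t \<otimes> u \<ominus> b"] M(3) tc u b assms(3) by auto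
    then have "(\<chi> t \<otimes> u \<ominus> b) \<oplus> b \<in> M" using n psubD(3)[OF pM(1)] by blast
    moreover have "(\<chi> t \<otimes> u \<ominus> b) \<oplus> b = \<chi> t \<otimes> u" using tc u b assms(3) by (simp add: minus_eq a_assoc l_neg)
    ultimately show False using tsubD(2)[of T \<chi> M t u] M t u by auto
  qed
  have "ext M \<psi> N e \<subseteq> ext M' \<psi> N e" using M by (intro ext_mono) auto
  then have "sat T (\<psi> \<circ> \<chi>) (ext M \<psi> N e) \<subseteq> sat T (\<psi> \<circ> \<chi>) (ext M' \<psi> N e)"
    by (rule sat_mono)
  then show "sat T (\<psi> \<circ> \<chi>) (ext M \<psi> N e) \<subset> sat T (\<psi> \<circ> \<chi>) (ext M' \<psi> N e)"
    using 1 2 by blast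
qed

section \<open>Simple quotients and change of scalars\<close>

lemma prime_pairD:
  assumes "prime_pair T P"
  shows "mset T" "psub id P" "t \<in> T \<Longrightarrow> t \<notin> P" "a \<in> carrier R \<Longrightarrow> a \<notin> P \<Longrightarrow> \<exists>b\<in>carrier R. a \<otimes> b \<in> T"
  using assms unfolding prime_pair_def by auto

text \<open>An element outside \<open>P\<close> divides an element of \<open>T\<close>, and division
  by \<open>T\<close> is built into \<open>tsub\<close>; hence it acts injectively modulo
  \<open>N\<close>.\<close>

lemma prime_pair_mem:
  assumes "prime_pair T P" "endo \<psi>" "tsub T \<psi> N" "a \<in> carrier R" "a \<notin> P" "x \<in> carrier R" "\<psi> a \<otimes> x \<in> N"
  shows "x \<in> N"
proof -
  obtain b where b: "b \<in> carrier R" "a \<otimes> b \<in> T" using prime_pairD(4)[OF assms(1)] assms by blast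
  have "\<psi> b \<otimes> (\<psi> a \<otimes> x) \<in> N" using psubD(4)[OF tsubD(1)[OF assms(3)]] b assms by blast
  then have "\<psi> (a \<otimes> b) \<otimes> x \<in> N" using b assms by (simp add: m_ac)
  then show ?thesis using tsubD(2)[OF assms(3)] b assms by blast
qed

text \<open>Adjacent members of the lattice have a cyclic quotient with annihilator \<open>P\<close>; when \<open>T = {\<one>}\<close>
  and \<open>P\<close> is the maximal ideal this is Nakayama's lemma, when \<open>T\<close> is the complement of \<open>P\<close> it is immediate.\<close>
lemma simple_step:
  assumes pp: "prime_pair T P" and "endo \<psi>" "tsub T \<psi> N" "tsub T \<psi> W" "N \<subset> W" "tlen T \<psi> N W = 1"
  obtains e where "e \<in> W" "e \<notin> N" "W = sat T \<psi> (ext (carrier R) \<psi> N e)"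
    "{a \<in> carrier R. \<psi> a \<otimes> e \<in> N} = P"
proof -
  obtain e where e: "e \<in> W" "e \<notin> N" using assms by blast
  note p = tsubD(1)[OF assms(3)] tsubD(1)[OF assms(4)]
  note mT = prime_pairD(1)[OF pp]
  have ec: "e \<in> carrier R" using e p psubD by blast
  have dich: "M = N \<or> M = W" if "tsub T \<psi> M" "N \<subseteq> M" "M \<subseteq> W" for M
  proof (rule ccontr)
    assume c: "\<not> ?thesis"
    have "tlen T \<psi> N N + 1 \<le> tlen T \<psi> N M"
      by (rule clen_snoc) (use c that assms in auto)
    then have "1 + 1 \<le> tlen T \<psi> N M + 1" unfolding clen_same by (metis add_0 add_right_mono)
    also have "\<dots> \<le> tlen T \<psi> N W"
      by (rule clen_snoc) (use c that assms in auto)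
    finally show False using assms by (simp add: one_enat_def)
  qed
  have ext: "psub \<psi> (ext C \<psi> N e)" "N \<subseteq> sat T \<psi> (ext C \<psi> N e)" "sat T \<psi> (ext C \<psi> N e) \<subseteq> W"
      "tsub T \<psi> (sat T \<psi> (ext C \<psi> N e))" "ext C \<psi> N e \<subseteq> sat T \<psi> (ext C \<psi> N e)" if "psub id C" for C
  proof -
    show 1: "psub \<psi> (ext C \<psi> N e)" using that assms ec p by (intro ext_psub1) auto
    then show 2: "ext C \<psi> N e \<subseteq> sat T \<psi> (ext C \<psi> N e)" using assms mT psubD by (intro sat_ge) auto
    have "N \<subseteq> ext C \<psi> N e" using assms psubD(5)[OF p(1)] ec psubD(2)[OF that] by (intro ext_ge)
    then show "N \<subseteq> sat T \<psi> (ext C \<psi> N e)" using 2 by blast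
    show "sat T \<psi> (ext C \<psi> N e) \<subseteq> W" using assms e p psubD(5)[OF that]
      by (intro sat_least ext_least) auto
    show "tsub T \<psi> (sat T \<psi> (ext C \<psi> N e))" using 1 assms mT by (intro sat_tsub) auto
  qed
  have eW: "e \<in> sat T \<psi> (ext (carrier R) \<psi> N e)"
    using ext(5)[of "carrier R"] ext_self[of \<psi> N "carrier R" e] psubD(2)[OF p(1)] ec assms by auto
  have "W = sat T \<psi> (ext (carrier R) \<psi> N e)"
    using dich[of "sat T \<psi> (ext (carrier R) \<psi> N e)"] ext[of "carrier R"] eW e by auto
  moreover have "{a \<in> carrier R. \<psi> a \<otimes> e \<in> N} = P"
  proof
    show "{a \<in> carrier R. \<psi> a \<otimes> e \<in> N} \<subseteq> P"
      using prime_pair_mem[OF pp assms(2,3)] e ec by blast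
    note P = prime_pairD(2)[OF pp]
    \<comment> \<open>Otherwise \<open>\<psi> (t \<ominus> b) \<otimes> e\<close> lies in
      \<open>N\<close> for some t in \<open>T\<close> and b in \<open>P\<close>. As
      \<open>t \<ominus> b\<close> is outside \<open>P\<close>, this would put \<open>e\<close> into
      \<open>N\<close>. The dichotomy then leaves only \<open>N\<close> for this saturation.\<close>
    have "e \<notin> sat T \<psi> (ext P \<psi> N e)"
    proof
      assume "e \<in> sat T \<psi> (ext P \<psi> N e)"
      then obtain t where t: "t \<in> T" "\<psi> t \<otimes> e \<in> ext P \<psi> N e" unfolding sat_def by auto
      have tc: "t \<in> carrier R" using t mT msetD by auto
      obtain n b where n: "n \<in> N" "b \<in> P" "\<psi> t \<otimes> e = n \<oplus> \<psi> b \<otimes> e"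
        using t(2) by (rule in_extE)
      have b: "b \<in> carrier R" using n psubD(1)[OF P] by auto
      have "\<psi> (t \<ominus> b) \<otimes> e \<in> N" using psub_lin[OF assms(2) p(1)] tc b ec n by blast
      moreover have "t \<ominus> b \<notin> P"
      proof
        assume "t \<ominus> b \<in> P"
        then have "t \<in> P" using psub_cancel[of id P t "\<ominus> b"] psub_uminus[of id P b] P n tc b
          by (simp add: minus_eq)
        then show False using t prime_pairD(3)[OF pp] by blast
      qed
      ultimately show False using prime_pair_mem[OF pp assms(2,3), of "t \<ominus> b" e] tc b ec e by auto
    qed
    then have "sat T \<psi> (ext P \<psi> N e) = N"
      using dich[of "sat T \<psi> (ext P \<psi> N e)"] ext[OF P] e by auto
    then have "ext P \<psi> N e \<subseteq> N" using ext(5)[OF P] by auto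
    then show "P \<subseteq> {a \<in> carrier R. \<psi> a \<otimes> e \<in> N}"
      using ext_mem[of \<psi> N _ P e] assms psubD(2)[OF p(1)] psubD(1)[OF P] ec by auto
  qed
  ultimately show ?thesis using that e by blast
qed

text \<open>The quotient is a cyclic image of R/P, so \<open>cyclic_upper\<close> bounds it by
  chains of saturated ideals above \<open>P\<close>. Such an ideal, once larger than
  \<open>P\<close>, contains an element outside \<open>P\<close>, and dividing by that element gives
  all of \<open>R\<close>.\<close>

lemma simple_step_le:
  assumes pp: "prime_pair T P" and "endo \<psi>" "tsub T \<psi> N" "e \<in> carrier R"
    and "\<And>a. a \<in> P \<Longrightarrow> \<psi> a \<otimes> e \<in> N"
  shows "tlen T \<psi> N (sat T \<psi> (ext (carrier R) \<psi> N e)) \<le> 1"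
proof -
  note p = tsubD(1)[OF assms(3)] and mT = prime_pairD(1)[OF pp] and P = prime_pairD(2)[OF pp]
  have "tlen T (\<psi> \<circ> id) N (sat T \<psi> (ext (carrier R) \<psi> N e)) \<le> tlen T id P (carrier R)"
    using assms p mT psubD(5)[OF P] by (intro cyclic_upper) auto
  also have "\<dots> \<le> 1"
  proof (rule clen_least)
    fix n N assume c: "chain_in (Collect (tsub T id)) P (carrier R) n N"
    have "n < 2"
    proof (rule ccontr)
      assume "\<not> n < 2"
      then have n: "N 0 \<subset> N 1" "N 1 \<subset> N 2" "tsub T id (N 1)" "P \<subseteq> N 0" "tsub T id (N 2)"
        using chain_inD[OF c, of 0] chain_inD[OF c, of 1] chain_inD[OF c, of 2] by (auto simp: numeral_2_eq_2)
      then obtain a where a: "a \<in> N 1" "a \<notin> P" by blast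
      have ac: "a \<in> carrier R" using psubD(1)[OF tsubD(1)[OF n(3)]] a by blast
      have "x \<in> N 1" if "x \<in> carrier R" for x
        using prime_pair_mem[OF pp, of id "N 1" a x] n(3) ac a that psub_idD(2)[OF tsubD(1)[OF n(3)] that a(1)] by simp
      then show False using n(2) psubD(5)[OF tsubD(1)[OF n(5)]] by blast
    qed
    then show "enat n \<le> 1" by (simp add: one_enat_def)
  qed
  finally show ?thesis by simp
qed

lemma tsub_comp:
  assumes "endo \<psi>" "endo \<chi>" "tsub T \<psi> U" "\<chi> ` T \<subseteq> T"
  shows "tsub T (\<psi> \<circ> \<chi>) U"
  using assms psub_comp[OF assms(1,2)] unfolding tsub_def by auto

text \<open>Induction along a composition series: every simple factor is cyclic with annihilator
  \<open>P\<close>, and through \<open>\<psi> \<circ> \<chi>\<close> it has the length of R/P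
  through \<chi>. The condition that each \<open>t\<close> divides some \<open>\<chi> t'\<close>
  allows denominators from \<psi>(T) to be exchanged for denominators from \<psi>(\<chi>(T)). It is
  trivial for \<open>T = {\<one>}\<close> and expresses integrality when \<open>T\<close> consists
  of the nonzero elements.\<close>

lemma tlen_scale:
  assumes pp: "prime_pair T P" and "endo \<psi>" "endo \<chi>" "\<chi> ` T \<subseteq> T"
    and "\<And>t. t \<in> T \<Longrightarrow> \<exists>t'\<in>T. \<exists>r\<in>carrier R. \<chi> t' = r \<otimes> t"
    and "tsub T \<psi> N" "tsub T \<psi> W" "N \<subseteq> W" "tlen T \<psi> N W = enat l"
  shows "tlen T (\<psi> \<circ> \<chi>) N W = enat l * tlen T \<chi> P (carrier R)"
  using assms(7,8,9)
proof (induction l arbitrary: W)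
  case 0
  have "N = W"
  proof (rule ccontr)
    assume "N \<noteq> W"
    then have "tlen T \<psi> N N + 1 \<le> tlen T \<psi> N W" using 0 assms by (intro clen_snoc) auto
    then show False using 0 by (simp add: clen_same zero_enat_def one_enat_def)
  qed
  then show ?case by (simp add: clen_same zero_enat_def[symmetric])
next
  case (Suc l)
  obtain Z where Z: "tsub T \<psi> Z" "N \<subseteq> Z" "Z \<subset> W" "tlen T \<psi> N Z = enat l" "tlen T \<psi> Z W = 1"
    by (rule clen_last_step[of "Collect (tsub T \<psi>)" N W l]) (use Suc assms in auto)
  have IH: "tlen T (\<psi> \<circ> \<chi>) N Z = enat l * tlen T \<chi> P (carrier R)" using Suc.IH[OF Z(1,2,4)] by (simp add: o_def)
  obtain e where e: "e \<in> W" "e \<notin> Z" "W = sat T \<psi> (ext (carrier R) \<psi> Z e)"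
    "{a \<in> carrier R. \<psi> a \<otimes> e \<in> Z} = P"
    by (rule simple_step[OF pp assms(2) Z(1) Suc.prems(1) Z(3,5)])
  note mT = prime_pairD(1)[OF pp]
  have pZ: "psub \<psi> Z" "psub \<psi> W" using Z Suc.prems tsubD(1) by auto
  have ec: "e \<in> carrier R" using e psubD(1)[OF pZ(2)] by auto
  have exZ: "psub \<psi> (ext (carrier R) \<psi> Z e)" using assms pZ ec by (intro ext_psub1) auto
  have tc: "tsub T (\<psi> \<circ> \<chi>) Z" "tsub T (\<psi> \<circ> \<chi>) W"
    using tsub_comp assms Z Suc.prems by auto
  have "tlen T (\<psi> \<circ> \<chi>) Z W = tlen T \<chi> P (carrier R)"
  proof (rule antisym)
    show "tlen T (\<psi> \<circ> \<chi>) Z W \<le> tlen T \<chi> P (carrier R)"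
    proof (rule cyclic_upper[OF mT assms(2,3) tsubD(1)[OF tc(1)] ec])
      show "P \<subseteq> carrier R" using psubD(5)[OF prime_pairD(2)[OF pp]] .
      show "W \<subseteq> sat T (\<psi> \<circ> \<chi>) (ext (carrier R) \<psi> Z e)"
      proof
        fix x assume "x \<in> W"
        then obtain t where t: "t \<in> T" "\<psi> t \<otimes> x \<in> ext (carrier R) \<psi> Z e" "x \<in> carrier R" using e(3) unfolding sat_def by auto
        obtain t' r where t': "t' \<in> T" "r \<in> carrier R" "\<chi> t' = r \<otimes> t" using assms(5)[OF t(1)] by blast
        have c: "t \<in> carrier R" using t mT msetD by auto
        have "\<psi> r \<otimes> (\<psi> t \<otimes> x) \<in> ext (carrier R) \<psi> Z e" using psubD(4)[OF exZ] t t' by blast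
        then have "(\<psi> \<circ> \<chi>) t' \<otimes> x \<in> ext (carrier R) \<psi> Z e" using t t' c assms by (simp add: m_assoc)
        then show "x \<in> sat T (\<psi> \<circ> \<chi>) (ext (carrier R) \<psi> Z e)" using t t' unfolding sat_def by (auto intro!: bexI[of _ t'])
      qed
    qed (use e(4) in auto)
    show "tlen T \<chi> P (carrier R) \<le> tlen T (\<psi> \<circ> \<chi>) Z W"
      using e Z mT assms pZ ec tc by (intro cyclic_lower) auto
  qed
  moreover have "tlen T (\<psi> \<circ> \<chi>) N W = tlen T (\<psi> \<circ> \<chi>) N Z + tlen T (\<psi> \<circ> \<chi>) Z W"
    using mT assms tc Z by (intro tlen_add) auto
  ultimately show ?case using IH
    by (simp add: o_def mult_eSuc add.commute flip: eSuc_enat)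
qed

end

section \<open>Generators, Nakayama and torsion\<close>

context cring
begin

primrec span :: "'a set \<Rightarrow> ('a \<Rightarrow> 'a) \<Rightarrow> 'a set \<Rightarrow> 'a list \<Rightarrow> 'a set" where
  "span C \<psi> Y [] = Y"
| "span C \<psi> Y (e # es) = ext C \<psi> (span C \<psi> Y es) e"

lemma span_append: "span C \<psi> Y (xs @ ys) = span C \<psi> (span C \<psi> Y ys) xs"
  by (induction xs) auto

lemma span_psub:
  assumes "endo \<psi>" "endo \<chi>" "psub (\<psi> \<circ> \<chi>) Y" "psub \<chi> C" "set es \<subseteq> carrier R"
  shows "psub (\<psi> \<circ> \<chi>) (span C \<psi> Y es)"
  using assms(5) by (induction es) (use assms ext_psub in auto)

lemma span_psub1:
  "endo \<psi> \<Longrightarrow> psub \<psi> Y \<Longrightarrow> psub id C \<Longrightarrow> set es \<subseteq> carrier R \<Longrightarrow> psub \<psi> (span C \<psi> Y es)"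
  using span_psub[of \<psi> id Y C es] by simp

lemma span_carrier:
  assumes "endo \<psi>" "Y \<subseteq> carrier R" "C \<subseteq> carrier R" "set es \<subseteq> carrier R"
  shows "span C \<psi> Y es \<subseteq> carrier R"
  using assms(4) by (induction es) (use assms(1,2,3) in \<open>auto simp: subset_iff elim!: in_extE\<close>)

lemma span_ge:
  assumes "endo \<psi>" "Y \<subseteq> carrier R" "\<zero> \<in> C" "C \<subseteq> carrier R" "set es \<subseteq> carrier R"
  shows "Y \<subseteq> span C \<psi> Y es"
  using assms(5)
proof (induction es)
  case (Cons e es)
  then have "span C \<psi> Y es \<subseteq> ext C \<psi> (span C \<psi> Y es) e"
    using assms span_carrier by (intro ext_ge) auto
  then show ?case using Cons by auto
qed auto

lemma span_mono: "Y \<subseteq> Y' \<Longrightarrow> C \<subseteq> C' \<Longrightarrow> span C \<psi> Y es \<subseteq> span C' \<psi> Y' es"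
  by (induction es) (auto dest: ext_mono[THEN subsetD, rotated 2])

lemma span_least:
  assumes "psub \<psi> U" "Y \<subseteq> U" "C \<subseteq> carrier R" "set es \<subseteq> U" shows "span C \<psi> Y es \<subseteq> U"
  using assms(4)
proof (induction es)
  case (Cons e es)
  then show ?case using ext_least[OF assms(1), of "span C \<psi> Y es" e C] assms(3) by auto
qed (use assms in auto)

lemma span_set:
  assumes "endo \<psi>" "Y \<subseteq> carrier R" "\<zero> \<in> Y" "\<zero> \<in> C" "\<one> \<in> C" "C \<subseteq> carrier R" "set es \<subseteq> carrier R"
  shows "set es \<subseteq> span C \<psi> Y es"
  using assms(7)
proof (induction es)
  case (Cons e es)
  then have "span C \<psi> Y es \<subseteq> ext C \<psi> (span C \<psi> Y es) e"
    using assms span_carrier by (intro ext_ge) auto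
  moreover have "e \<in> ext C \<psi> (span C \<psi> Y es) e"
    using assms Cons span_ge[of \<psi> Y C es] by (intro ext_self) auto
  ultimately show ?case using Cons by auto
qed auto

text \<open>Since \<open>P\<close> kills the generators modulo \<open>Y\<close>, each of them adds
  at most one simple factor. With \<open>P = {\<zero>}\<close> this bounds a rank by the number of
  generators, with \<open>P = m\<close> a dimension over the residue field.\<close>

lemma tlen_span_le_length:
  assumes pp: "prime_pair T P" and "endo \<psi>" "psub \<psi> Y" "set es \<subseteq> carrier R"
    and "\<And>a e. a \<in> P \<Longrightarrow> e \<in> set es \<Longrightarrow> \<psi> a \<otimes> e \<in> Y"
  shows "tlen T \<psi> (sat T \<psi> Y) (sat T \<psi> (span (carrier R) \<psi> Y es)) \<le> enat (length es)"
  using assms(4,5)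
proof (induction es)
  case Nil
  then show ?case by (simp add: clen_same)
next
  case (Cons e es)
  define S where "S = span (carrier R) \<psi> Y es"
  define S' where "S' = sat T \<psi> S"
  note mT = prime_pairD(1)[OF pp]
  have S: "psub \<psi> S" unfolding S_def using assms Cons by (intro span_psub1) auto
  have YS: "Y \<subseteq> S" unfolding S_def using assms Cons psubD(5)[OF assms(3)] by (intro span_ge) auto
  have SS: "S \<subseteq> S'" unfolding S'_def using psubD(5)[OF S] mT assms by (intro sat_ge)
  have S': "tsub T \<psi> S'" unfolding S'_def using S mT assms by (intro sat_tsub)
  have exS: "psub \<psi> (ext (carrier R) \<psi> S e)" using assms S Cons by (intro ext_psub1) auto
  have exg: "S \<subseteq> ext (carrier R) \<psi> S e" using assms psubD(5)[OF S] Cons by (intro ext_ge) auto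
  have W: "tsub T \<psi> (sat T \<psi> (ext (carrier R) \<psi> S e))" using exS mT assms by (intro sat_tsub)
  have 1: "tlen T \<psi> (sat T \<psi> Y) S' \<le> enat (length es)"
    unfolding S'_def S_def using Cons by auto
  have "\<psi> a \<otimes> e \<in> S'" if "a \<in> P" for a using Cons.prems that YS SS by auto
  then have "tlen T \<psi> S' (sat T \<psi> (ext (carrier R) \<psi> S' e)) \<le> 1"
    using pp assms S' Cons by (intro simple_step_le) auto
  moreover have "tlen T \<psi> S' (sat T \<psi> (ext (carrier R) \<psi> S e)) \<le> tlen T \<psi> S' (sat T \<psi> (ext (carrier R) \<psi> S' e))"
    using SS by (intro clen_mono sat_mono ext_mono) auto
  ultimately have 2: "tlen T \<psi> S' (sat T \<psi> (ext (carrier R) \<psi> S e)) \<le> 1" by auto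
  have "tlen T \<psi> (sat T \<psi> Y) (sat T \<psi> (ext (carrier R) \<psi> S e)) = tlen T \<psi> (sat T \<psi> Y) S' + tlen T \<psi> S' (sat T \<psi> (ext (carrier R) \<psi> S e))"
  proof (rule tlen_add[OF mT assms(2) S' W])
    show "sat T \<psi> Y \<subseteq> S'" unfolding S'_def using YS by (rule sat_mono)
    show "S' \<subseteq> sat T \<psi> (ext (carrier R) \<psi> S e)" unfolding S'_def using exg by (rule sat_mono)
  qed
  also have "\<dots> \<le> enat (length es) + 1" using 1 2 by (rule add_mono)
  finally show ?case unfolding S_def by (simp add: one_enat_def)
qed

text \<open>Each generator contributes a cyclic quotient that is an image of R/C, measured through
  \<chi>. This count with weights drives the submultiplicativity of \<open>mu\<close> and the growth
  estimate in the Cohen-Macaulay case.\<close>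

lemma tlen_span_le:
  assumes "endo \<psi>" "endo \<chi>" "psub (\<psi> \<circ> \<chi>) Y" "psub \<chi> C" "set es \<subseteq> carrier R"
    and "\<And>a e. a \<in> C \<Longrightarrow> e \<in> set es \<Longrightarrow> \<psi> a \<otimes> e \<in> Y"
  shows "tlen {\<one>} (\<psi> \<circ> \<chi>) Y (span (carrier R) \<psi> Y es) \<le> enat (length es) * tlen {\<one>} \<chi> C (carrier R)"
  using assms(5,6)
proof (induction es)
  case Nil
  then show ?case by (simp add: clen_same zero_enat_def[symmetric])
next
  case (Cons e es)
  define S where "S = span (carrier R) \<psi> Y es"
  have S: "psub (\<psi> \<circ> \<chi>) S" unfolding S_def using assms Cons by (intro span_psub) auto
  have YS: "Y \<subseteq> S" unfolding S_def using assms Cons psubD(5)[OF assms(3)] by (intro span_ge) auto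
  have exS: "psub (\<psi> \<circ> \<chi>) (ext (carrier R) \<psi> S e)" using assms S Cons by (intro ext_psub) auto
  have exg: "S \<subseteq> ext (carrier R) \<psi> S e" using assms psubD(5)[OF S] Cons by (intro ext_ge) auto
  have 1: "tlen {\<one>} (\<psi> \<circ> \<chi>) Y S \<le> enat (length es) * tlen {\<one>} \<chi> C (carrier R)"
    unfolding S_def using Cons.IH Cons.prems by (simp add: o_def)
  have 2: "tlen {\<one>} (\<psi> \<circ> \<chi>) S (ext (carrier R) \<psi> S e) \<le> tlen {\<one>} \<chi> C (carrier R)"
  proof (rule cyclic_upper)
    show "ext (carrier R) \<psi> S e \<subseteq> sat {\<one>} (\<psi> \<circ> \<chi>) (ext (carrier R) \<psi> S e)"
      using psubD(5)[OF exS] assms by (intro sat_ge) auto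
  qed (use S assms Cons.prems psubD(5)[OF assms(4)] YS in auto)
  have "tlen {\<one>} (\<psi> \<circ> \<chi>) Y (ext (carrier R) \<psi> S e) = tlen {\<one>} (\<psi> \<circ> \<chi>) Y S + tlen {\<one>} (\<psi> \<circ> \<chi>) S (ext (carrier R) \<psi> S e)"
    using assms S exS YS exg by (intro tlen_add) (auto simp: tsub_one)
  also have "\<dots> \<le> enat (length es) * tlen {\<one>} \<chi> C (carrier R) + tlen {\<one>} \<chi> C (carrier R)" using 1 2 by (rule add_mono)
  finally show ?case unfolding S_def by (simp add: mult_eSuc add.commute o_def flip: eSuc_enat)
qed

lemma ext_comp_span:
  assumes "endo \<psi>" "endo \<chi>" "psub (\<psi> \<circ> \<chi>) S" "set fs \<subseteq> carrier R" "e \<in> carrier R"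
    and "a \<in> span (carrier R) \<chi> {\<zero>} fs" "y \<in> S"
  shows "y \<oplus> \<psi> a \<otimes> e \<in> span (carrier R) (\<psi> \<circ> \<chi>) S (map (\<lambda>f. \<psi> f \<otimes> e) fs)"
  using assms(4,6)
proof (induction fs arbitrary: a)
  case Nil
  then show ?case using assms psubD(1)[OF assms(3)] by auto
next
  case (Cons f fs)
  then obtain b c where b: "b \<in> span (carrier R) \<chi> {\<zero>} fs" "c \<in> carrier R" "a = b \<oplus> \<chi> c \<otimes> f"
    by (auto elim!: in_extE)
  have bc: "b \<in> carrier R" "y \<in> carrier R"
    using b Cons assms psubD(1)[OF assms(3)] span_carrier[of \<chi> "{\<zero>}" "carrier R" fs] by auto
  have "(y \<oplus> \<psi> b \<otimes> e) \<oplus> (\<psi> \<circ> \<chi>) c \<otimes> (\<psi> f \<otimes> e) \<in> span (carrier R) (\<psi> \<circ> \<chi>) S (map (\<lambda>f. \<psi> f \<otimes> e) (f # fs))"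
    unfolding list.map span.simps
    by (intro in_extI b(2)) (use Cons.IH[OF _ b(1)] Cons.prems in \<open>simp add: o_def\<close>)
  moreover have "(y \<oplus> \<psi> b \<otimes> e) \<oplus> (\<psi> \<circ> \<chi>) c \<otimes> (\<psi> f \<otimes> e) = y \<oplus> \<psi> a \<otimes> e"
    using b bc Cons assms by (simp add: l_distr a_assoc m_assoc)
  ultimately show ?case by (simp add: o_def)
qed

text \<open>As in a tower of extensions, \<open>gs\<close> collects the products
  \<open>\<psi> f \<otimes> e\<close> of generators of the two stages.\<close>

lemma span_comp_gens:
  assumes "endo \<psi>" "endo \<chi>" "psub (\<psi> \<circ> \<chi>) Y" "set fs \<subseteq> carrier R" "carrier R \<subseteq> span (carrier R) \<chi> {\<zero>} fs"
    and "set es \<subseteq> carrier R"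
  obtains gs where "set gs \<subseteq> carrier R" "span (carrier R) \<psi> Y es \<subseteq> span (carrier R) (\<psi> \<circ> \<chi>) Y gs"
proof -
  have "\<exists>gs. set gs \<subseteq> carrier R \<and> span (carrier R) \<psi> Y es \<subseteq> span (carrier R) (\<psi> \<circ> \<chi>) Y gs"
    using assms(6)
  proof (induction es)
    case Nil
    then show ?case by (intro exI[of _ "[]"]) auto
  next
    case (Cons e es)
    then obtain gs where gs: "set gs \<subseteq> carrier R" "span (carrier R) \<psi> Y es \<subseteq> span (carrier R) (\<psi> \<circ> \<chi>) Y gs"
      using Cons.IH Cons.prems unfolding o_def by auto
    define S where "S = span (carrier R) (\<psi> \<circ> \<chi>) Y gs"
    have S: "psub (\<psi> \<circ> \<chi>) S" unfolding S_def using assms gs by (intro span_psub1) auto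
    let ?gs = "map (\<lambda>f. \<psi> f \<otimes> e) fs @ gs"
    have "ext (carrier R) \<psi> (span (carrier R) \<psi> Y es) e \<subseteq> span (carrier R) (\<psi> \<circ> \<chi>) S (map (\<lambda>f. \<psi> f \<otimes> e) fs)"
    proof
      fix x assume "x \<in> ext (carrier R) \<psi> (span (carrier R) \<psi> Y es) e"
      then obtain y a where "y \<in> span (carrier R) \<psi> Y es" "a \<in> carrier R" "x = y \<oplus> \<psi> a \<otimes> e" by (rule in_extE)
      then show "x \<in> span (carrier R) (\<psi> \<circ> \<chi>) S (map (\<lambda>f. \<psi> f \<otimes> e) fs)"
        using ext_comp_span[OF assms(1,2) S assms(4), of e a y] Cons.prems gs(2) assms(5) unfolding S_def by auto
    qed
    then show ?case using gs Cons.prems assms unfolding S_def o_def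
      by (intro exI[of _ ?gs]) (auto simp: span_append)
  qed
  then show ?thesis using that by blast
qed

text \<open>One relation \<open>e = s \<oplus> \<psi> a \<otimes> e\<close> with \<open>s\<close>
  spanned by the remaining generators is solved for \<open>e\<close>, because
  \<open>\<one> \<ominus> a\<close> lies outside \<open>m\<close> and is a unit. Then
  \<open>e\<close> is redundant and the list gets shorter.\<close>

lemma nakayama:
  assumes pp: "prime_pair {\<one>} m" and "endo \<psi>" "psub \<psi> Q" "set es \<subseteq> carrier R" "set es \<subseteq> span m \<psi> Q es"
  shows "set es \<subseteq> Q"
  using assms(4,5)
proof (induction es)
  case (Cons e es)
  define S where "S = span m \<psi> Q es"
  note P = prime_pairD(2)[OF pp]
  have S: "psub \<psi> S" unfolding S_def using assms P Cons by (intro span_psub1) auto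
  obtain s a where s: "s \<in> S" "a \<in> m" "e = s \<oplus> \<psi> a \<otimes> e" using Cons.prems unfolding S_def by (auto elim!: in_extE)
  have c: "a \<in> carrier R" "e \<in> carrier R" using psubD(1)[OF P] s Cons by auto
  have "\<psi> (\<one> \<ominus> a) \<otimes> e \<in> S" using psub_lin[OF assms(2) S, of \<one> a e s] s c assms by simp
  moreover have "\<one> \<ominus> a \<notin> m"
  proof
    assume "\<one> \<ominus> a \<in> m"
    then have "\<one> \<in> m" using psub_cancel[of id m \<one> "\<ominus> a"] psub_uminus[of id m a] P s c by (simp add: minus_eq)
    then show False using prime_pairD(3)[OF pp] by blast
  qed
  ultimately have eS: "e \<in> S"
    using prime_pair_mem[OF pp assms(2), of S "\<one> \<ominus> a" e] S c assms by (simp add: tsub_one)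
  have "ext m \<psi> S e \<subseteq> S" using S eS psubD(5)[OF P] by (intro ext_least) auto
  then have "set es \<subseteq> Q" using Cons unfolding S_def by auto
  then have "S \<subseteq> Q" unfolding S_def using assms psubD(5)[OF P] by (intro span_least) auto
  then show ?case using eS \<open>set es \<subseteq> Q\<close> by auto
qed auto

end

section \<open>Torsion over the image of an endomorphism of a domain\<close>

context domain
begin

lemma prime_pair_kernel:
  assumes "endo \<psi>"
  shows "prime_pair {t \<in> carrier R. \<psi> t \<noteq> \<zero>} {t \<in> carrier R. \<psi> t = \<zero>}"
  unfolding prime_pair_def mset_def psub_def
  using assms by (auto simp: integral_iff intro!: bexI[of _ \<one>])

text \<open>Multiplication by \<open>x\<close> embeds \<open>R\<close> into \<open>xR\<close>, so \<open>xR\<close> has full rank over \<open>\<psi> R\<close> and its saturation contains \<open>\<one>\<close>.\<close>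
lemma integral_torsion:
  assumes "endo \<psi>" "set es \<subseteq> carrier R" "carrier R \<subseteq> span (carrier R) \<psi> {\<zero>} es"
    and x: "x \<in> carrier R" "x \<noteq> \<zero>"
  obtains t r where "t \<in> carrier R" "r \<in> carrier R" "\<psi> t \<noteq> \<zero>" "\<psi> t = x \<otimes> r"
proof -
  define T where "T = {t \<in> carrier R. \<psi> t \<noteq> \<zero>}"
  define P where "P = {t \<in> carrier R. \<psi> t = \<zero>}"
  have pp: "prime_pair T P" unfolding T_def P_def by (rule prime_pair_kernel) fact
  note mT = prime_pairD(1)[OF pp]
  define mul where "mul M = {x \<otimes> a | a. a \<in> M}" for M
  have mulp: "psub \<psi> (mul M)" if "psub \<psi> M" for M
    unfolding psub_def
  proof (intro conjI ballI)
    show "mul M \<subseteq> carrier R" using psubD(1)[OF that] x by (auto simp: mul_def)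
    have "x \<otimes> \<zero> \<in> mul M" using psubD(2)[OF that] unfolding mul_def by blast
    then show "\<zero> \<in> mul M" using x by simp
  next
    fix u v assume "u \<in> mul M" "v \<in> mul M"
    then obtain a b where *: "a \<in> M" "b \<in> M" "u = x \<otimes> a" "v = x \<otimes> b" unfolding mul_def by auto
    have "x \<otimes> (a \<oplus> b) \<in> mul M" using * psubD(3)[OF that] unfolding mul_def by blast
    then show "u \<oplus> v \<in> mul M" using * x psubD(1)[OF that] by (simp add: r_distr)
  next
    fix c u assume c: "c \<in> carrier R" and "u \<in> mul M"
    then obtain a where *: "a \<in> M" "u = x \<otimes> a" unfolding mul_def by auto
    have "x \<otimes> (\<psi> c \<otimes> a) \<in> mul M" using * c psubD(4)[OF that] unfolding mul_def by blast
    then show "\<psi> c \<otimes> u \<in> mul M" using * x c assms(1) psubD(1)[OF that] by (simp add: m_ac)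
  qed
  define S where "S = sat T \<psi> (mul (carrier R))"
  have S: "tsub T \<psi> S" unfolding S_def using mT assms(1) mulp by (intro sat_tsub) auto
  have ge: "tlen T \<psi> {\<zero>} (carrier R) \<le> tlen T \<psi> {\<zero>} S"
  proof (rule clen_le_transfer[where f = "\<lambda>M. sat T \<psi> (mul M)"])
    fix M assume "M \<in> Collect (tsub T \<psi>)" "{\<zero>} \<subseteq> M" "M \<subseteq> carrier R"
    then have M: "psub \<psi> M" "M \<subseteq> carrier R" using tsubD by auto
    have "tsub T \<psi> (sat T \<psi> (mul M))" using mT assms(1) mulp M by (intro sat_tsub) auto
    moreover have "sat T \<psi> (mul M) \<subseteq> S" unfolding S_def using M by (intro sat_mono) (auto simp: mul_def)
    ultimately show "sat T \<psi> (mul M) \<in> Collect (tsub T \<psi>) \<and> {\<zero>} \<subseteq> sat T \<psi> (mul M) \<and> sat T \<psi> (mul M) \<subseteq> S"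
      using psubD(2)[OF tsubD(1)] by auto
  next
    fix M M' assume *: "M \<in> Collect (tsub T \<psi>)" "M' \<in> Collect (tsub T \<psi>)" "{\<zero>} \<subseteq> M" "M \<subset> M'" "M' \<subseteq> carrier R"
    obtain a where a: "a \<in> M'" "a \<notin> M" "a \<in> carrier R" using * by blast
    have p: "psub \<psi> M" "psub \<psi> M'" using * tsubD by auto
    have "x \<otimes> a \<in> mul M'" using a unfolding mul_def by blast
    then have 1: "x \<otimes> a \<in> sat T \<psi> (mul M')"
      using sat_ge[OF mT assms(1) psubD(5)[OF mulp[OF p(2)]]] by blast
    have 2: "x \<otimes> a \<notin> sat T \<psi> (mul M)"
    proof
      assume "x \<otimes> a \<in> sat T \<psi> (mul M)"
      then obtain t b where t: "t \<in> T" "b \<in> M" "\<psi> t \<otimes> (x \<otimes> a) = x \<otimes> b" unfolding sat_def mul_def by auto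
      have c: "t \<in> carrier R" "b \<in> carrier R" using t msetD(1)[OF mT] psubD(1)[OF p(1)] by auto
      have "x \<otimes> (\<psi> t \<otimes> a) = x \<otimes> b" using t c a x assms(1) by (simp add: m_ac)
      then have "\<psi> t \<otimes> a = b" using m_lcancel[of x "\<psi> t \<otimes> a" b] c a x assms(1) by simp
      then show False using tsubD(2)[of T \<psi> M t a] * t a by auto
    qed
    have "sat T \<psi> (mul M) \<subseteq> sat T \<psi> (mul M')" using * by (intro sat_mono) (auto simp: mul_def)
    then show "sat T \<psi> (mul M) \<subset> sat T \<psi> (mul M')" using 1 2 by blast
  qed
  have z: "sat T \<psi> {\<zero>} = {\<zero>}"
    unfolding sat_def T_def using assms(1) by (auto simp: integral_iff intro!: bexI[of _ \<one>])
  have "tlen T \<psi> (sat T \<psi> {\<zero>}) (sat T \<psi> (span (carrier R) \<psi> {\<zero>} es)) \<le> enat (length es)"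
    using pp assms by (intro tlen_span_le_length[of T P]) (auto simp: P_def)
  moreover have "carrier R \<subseteq> sat T \<psi> (span (carrier R) \<psi> {\<zero>} es)"
    using assms(3) sat_ge[OF mT assms(1), of "span (carrier R) \<psi> {\<zero>} es"] span_carrier[of \<psi> "{\<zero>}" "carrier R" es] assms by auto
  \<comment> \<open>Only a finite length can be cancelled from the additivity formula. With
    \<open>ge\<close>, this leaves length \<open>0\<close> between \<open>S\<close> and
    \<open>R\<close>.\<close>
  ultimately have fin: "tlen T \<psi> {\<zero>} (carrier R) \<le> enat (length es)"
    unfolding z by (meson clen_mono order_refl order_trans)
  have S0: "{\<zero>} \<subseteq> S" "S \<subseteq> carrier R" using psubD(2,5)[OF tsubD(1)[OF S]] by auto
  have "tlen T \<psi> {\<zero>} (carrier R) = tlen T \<psi> {\<zero>} S + tlen T \<psi> S (carrier R)"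
    using mT S assms(1) S0 by (intro tlen_add) auto
  then have "tlen T \<psi> S (carrier R) = 0"
    using ge fin by (cases "tlen T \<psi> {\<zero>} (carrier R)"; cases "tlen T \<psi> {\<zero>} S"; cases "tlen T \<psi> S (carrier R)") (auto simp: zero_enat_def)
  then have "\<not> S \<subset> carrier R" using clen_snoc[of S "Collect (tsub T \<psi>)" S "carrier R"] S assms(1)
    by (auto simp: clen_same)
  then have "\<one> \<in> S" using S0 by blast
  then obtain t where "t \<in> T" "\<psi> t \<otimes> \<one> \<in> mul (carrier R)" unfolding S_def sat_def by auto
  then show ?thesis using that assms(1) unfolding T_def mul_def by auto
qed

end

section \<open>Primes, nonzerodivisors and grade\<close>

context cring
begin

lemma psub_id_iff_ideal: "psub id I \<longleftrightarrow> ideal I R"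
proof
  assume I: "psub id I"
  show "ideal I R"
  proof (rule idealI[OF ring_axioms])
    show "subgroup I (add_monoid R)"
    proof
      show "I \<subseteq> carrier (add_monoid R)" using psubD(5)[OF I] by simp
      show "\<one>\<^bsub>add_monoid R\<^esub> \<in> I" using psubD(2)[OF I] by simp
      show "x \<otimes>\<^bsub>add_monoid R\<^esub> y \<in> I" if "x \<in> I" "y \<in> I" for x y using psubD(3)[OF I that] by simp
      show "inv\<^bsub>add_monoid R\<^esub> x \<in> I" if "x \<in> I" for x using psub_uminus[OF endo_id I that] by (simp add: a_inv_def)
    qed
  qed (use psub_idD[OF I] in auto)
next
  assume "ideal I R"
  then interpret ideal I R .
  show "psub id I" unfolding psub_def using a_subset additive_subgroup.zero_closed I_l_closed by auto
qed

section \<open>Adjoining elements to an ideal\<close>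

definition adj :: "'a set \<Rightarrow> 'a \<Rightarrow> 'a set" where
  "adj K a = ext (carrier R) id K a"

lemma adj_psub [simp]: "psub id K \<Longrightarrow> a \<in> carrier R \<Longrightarrow> psub id (adj K a)"
  unfolding adj_def by (intro ext_psub1) auto

lemma adj_ge: "psub id K \<Longrightarrow> a \<in> carrier R \<Longrightarrow> K \<subseteq> adj K a"
  unfolding adj_def using psubD(5) by (intro ext_ge) auto

lemma adj_self: "psub id K \<Longrightarrow> a \<in> carrier R \<Longrightarrow> a \<in> adj K a"
  unfolding adj_def using psubD(2) by (intro ext_self) auto

lemma adj_least: "psub id U \<Longrightarrow> K \<subseteq> U \<Longrightarrow> a \<in> U \<Longrightarrow> adj K a \<subseteq> U"
  unfolding adj_def by (intro ext_least) auto

lemma in_adjE: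
  assumes "x \<in> adj K a"
  obtains k r where "k \<in> K" "r \<in> carrier R" "x = k \<oplus> r \<otimes> a"
  using assms unfolding adj_def by (auto elim!: in_extE)

lemma in_adjI: "k \<in> K \<Longrightarrow> r \<in> carrier R \<Longrightarrow> k \<oplus> r \<otimes> a \<in> adj K a"
  unfolding adj_def ext_def by auto

lemma in_adjI': 
  assumes "psub id K" "k \<in> K" "r \<in> carrier R" "a \<in> carrier R" "x \<in> carrier R" "x \<ominus> r \<otimes> a \<in> K"
  shows "x \<in> adj K a"
proof -
  have "(x \<ominus> r \<otimes> a) \<oplus> r \<otimes> a \<in> adj K a" using assms by (intro in_adjI)
  then show ?thesis using assms by (simp add: minus_eq a_assoc l_neg)
qed

lemma adj_commute:
  assumes "psub id K" "a \<in> carrier R" "b \<in> carrier R" shows "adj (adj K a) b = adj (adj K b) a"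
proof -
  have "adj (adj K a) b \<subseteq> adj (adj K b) a" if "a \<in> carrier R" "b \<in> carrier R" for a b
  proof (rule adj_least)
    show "adj K a \<subseteq> adj (adj K b) a"
      unfolding adj_def[of _ a] using adj_ge[OF assms(1) that(2)] by (intro ext_mono) auto
    show "b \<in> adj (adj K b) a" using adj_self[OF assms(1) that(2)] adj_ge[of "adj K b" a] assms that by auto
  qed (use assms that in auto)
  then show ?thesis using assms by blast
qed

primrec adjs :: "'a set \<Rightarrow> 'a list \<Rightarrow> 'a set" where
  "adjs K [] = K"
| "adjs K (y # ys) = adjs (adj K y) ys"

lemma adjs_append: "adjs K (xs @ ys) = adjs (adjs K xs) ys"
  by (induction xs arbitrary: K) auto

lemma adjs_psub [simp]: "psub id K \<Longrightarrow> set ys \<subseteq> carrier R \<Longrightarrow> psub id (adjs K ys)"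
  by (induction ys arbitrary: K) auto

lemma adjs_ge: "psub id K \<Longrightarrow> set ys \<subseteq> carrier R \<Longrightarrow> K \<union> set ys \<subseteq> adjs K ys"
proof (induction ys arbitrary: K)
  case (Cons y ys)
  then have y: "y \<in> carrier R" "set ys \<subseteq> carrier R" by auto
  have "adj K y \<union> set ys \<subseteq> adjs (adj K y) ys"
    by (rule Cons.IH[OF adj_psub[OF Cons.prems(1) y(1)] y(2)])
  then show ?case using adj_ge[OF Cons.prems(1) y(1)] adj_self[OF Cons.prems(1) y(1)] by auto
qed auto

lemma adjs_least: "psub id U \<Longrightarrow> K \<subseteq> U \<Longrightarrow> set ys \<subseteq> U \<Longrightarrow> adjs K ys \<subseteq> U"
proof (induction ys arbitrary: K)
  case (Cons y ys)
  have "adj K y \<subseteq> U" by (rule adj_least[OF Cons.prems(1,2)]) (use Cons.prems(3) in auto)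
  then have "adjs (adj K y) ys \<subseteq> U" by (rule Cons.IH[OF Cons.prems(1)]) (use Cons.prems(3) in auto)
  then show ?case by simp
qed auto

lemma adjs_cong_set:
  assumes "psub id K" "set xs \<subseteq> carrier R" "set xs = set ys" shows "adjs K xs = adjs K ys"
  using assms adjs_ge[of K xs] adjs_ge[of K ys] by (intro antisym adjs_least) auto

lemma genideal_set_eq_adjs: "set xs \<subseteq> carrier R \<Longrightarrow> Idl (set xs) = adjs {\<zero>} xs"
proof (rule antisym)
  assume x: "set xs \<subseteq> carrier R"
  show "Idl (set xs) \<subseteq> adjs {\<zero>} xs"
    using adjs_ge[of "{\<zero>}" xs] x by (intro genideal_minimal) (auto simp flip: psub_id_iff_ideal)
  have "psub id (Idl (set xs))" using genideal_ideal[OF x] by (simp add: psub_id_iff_ideal)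
  then show "adjs {\<zero>} xs \<subseteq> Idl (set xs)" using genideal_self[OF x] psubD(2)
    by (intro adjs_least) auto
qed

section \<open>Prime ideals, nonzerodivisors and prime avoidance\<close>

definition primeI :: "'a set \<Rightarrow> bool" where
  "primeI P \<longleftrightarrow> psub id P \<and> P \<noteq> carrier R \<and> (\<forall>a\<in>carrier R. \<forall>b\<in>carrier R. a \<otimes> b \<in> P \<longrightarrow> a \<in> P \<or> b \<in> P)"

lemma primeI_iff: "primeI P \<longleftrightarrow> primeideal P R"
proof
  assume "primeI P" then show "primeideal P R"
    unfolding primeI_def by (intro primeidealI is_cring) (auto simp: psub_id_iff_ideal)
next
  assume "primeideal P R"
  then interpret primeideal P R .
  show "primeI P" unfolding primeI_def psub_id_iff_ideal
    using I_notcarr I_prime is_ideal by auto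
qed

definition colon :: "'a set \<Rightarrow> 'a \<Rightarrow> 'a set" where
  "colon K u = {a \<in> carrier R. a \<otimes> u \<in> K}"

lemma colon_psub [simp]: "psub id K \<Longrightarrow> u \<in> carrier R \<Longrightarrow> psub id (colon K u)"
  unfolding psub_def colon_def by (auto simp: l_distr m_assoc)

text \<open>Every element qualifies when \<open>K\<close> is the whole ring, so properness has to be
  supplied separately wherever it matters.\<close>

definition nzd :: "'a set \<Rightarrow> 'a \<Rightarrow> bool" where
  "nzd K a \<longleftrightarrow> (\<forall>u\<in>carrier R. a \<otimes> u \<in> K \<longrightarrow> u \<in> K)"

lemma nzdD: "nzd K a \<Longrightarrow> u \<in> carrier R \<Longrightarrow> a \<otimes> u \<in> K \<Longrightarrow> u \<in> K"
  unfolding nzd_def by auto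

text \<open>Take an element of \<open>J\<close> outside \<open>P\<close> and multiply it by an
  element of each \<open>Q\<close> outside \<open>P\<close>; primeness keeps the product outside
  \<open>P\<close>.\<close>

lemma prime_avoid_prod:
  assumes "finite Qs" "\<And>Q. Q \<in> Qs \<Longrightarrow> psub id Q \<and> \<not> Q \<subseteq> P" "primeI P" "psub id J" "\<not> J \<subseteq> P"
  shows "\<exists>z\<in>J. z \<notin> P \<and> (\<forall>Q\<in>Qs. z \<in> Q)"
  using assms(1,2)
proof (induction Qs)
  case empty
  then show ?case using assms by auto
next
  case (insert Q Qs)
  then obtain z where z: "z \<in> J" "z \<notin> P" "\<forall>Q\<in>Qs. z \<in> Q" by auto
  obtain q where q: "q \<in> Q" "q \<notin> P" using insert by blast
  have Q': "psub id Q'" if "Q' \<in> insert Q Qs" for Q'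
    by (rule insert.prems[THEN conjunct1]) fact
  then have Q: "psub id Q" by blast
  have c: "z \<in> carrier R" "q \<in> carrier R" using z q psubD(1)[OF assms(4)] psubD(1)[OF Q] by auto
  have "z \<otimes> q \<notin> P" using z q c assms(3) unfolding primeI_def by blast
  moreover have "z \<otimes> q \<in> J" "z \<otimes> q \<in> Q" using psub_idD(2)[OF assms(4) c(2) z(1)] psub_idD(1)[OF Q c(1) q(1)] by auto
  moreover have "z \<otimes> q \<in> Q'" if "Q' \<in> Qs" for Q'
    using psub_idD(2)[OF Q', of Q' q z] that z c by auto
  ultimately show ?case by blast
qed

text \<open>Prime avoidance for a coset instead of an ideal, needed to alter a generator without
  changing the ideal it generates together with \<open>J\<close>. A minimal prime \<open>P\<close>
  of the set is put aside. If the element found for the other primes falls into \<open>P\<close>, it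
  is corrected by some z of \<open>J\<close> that lies in all the others but not in
  \<open>P\<close>; such a z exists because no other prime is contained in a minimal one.\<close>

lemma davis:
  assumes "finite Ps" "\<And>P. P \<in> Ps \<Longrightarrow> primeI P" "psub id J" "y \<in> carrier R"
    and "\<And>P. P \<in> Ps \<Longrightarrow> \<not> (y \<in> P \<and> J \<subseteq> P)"
  shows "\<exists>b\<in>J. \<forall>P\<in>Ps. y \<oplus> b \<notin> P"
  using assms(1,2,5)
proof (induction Ps rule: finite_psubset_induct)
  case (psubset Ps)
  show ?case
  proof (cases "Ps = {}")
    case True
    then show ?thesis using psubD(2)[OF assms(3)] by blast
  next
    case False
    obtain P where P: "P \<in> Ps" "\<forall>Q\<in>Ps. Q \<subseteq> P \<longrightarrow> P = Q"
      using finite_has_minimal[OF psubset(1) False] by blast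
    have "\<exists>b\<in>J. \<forall>Q\<in>Ps - {P}. y \<oplus> b \<notin> Q" using P psubset.prems by (intro psubset.IH) auto
    then obtain b where b: "b \<in> J" "\<forall>Q\<in>Ps - {P}. y \<oplus> b \<notin> Q" by blast
    have bc: "b \<in> carrier R" using psubD(1)[OF assms(3)] b by auto
    have pP: "psub id P" using psubset.prems P unfolding primeI_def by auto
    show ?thesis
    proof (cases "y \<oplus> b \<in> P")
      case False then show ?thesis using b by blast
    next
      case True
      have "\<not> J \<subseteq> P"
      proof
        assume "J \<subseteq> P"
        then have "y \<in> P" using psub_cancel[OF endo_id pP True] b assms(4) by blast
        then show False using psubset.prems(2)[OF P(1)] \<open>J \<subseteq> P\<close> by blast
      qed
      then obtain z where z: "z \<in> J" "z \<notin> P" "\<forall>Q\<in>Ps-{P}. z \<in> Q"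
        using prime_avoid_prod[of "Ps-{P}" P J] psubset.prems(1) psubset.hyps P assms(3)
        unfolding primeI_def by auto
      have zc: "z \<in> carrier R" using psubD(1)[OF assms(3)] z by auto
      have "y \<oplus> (b \<oplus> z) \<notin> Q" if "Q \<in> Ps" for Q
      proof
        assume "y \<oplus> (b \<oplus> z) \<in> Q"
        then have Q: "(y \<oplus> b) \<oplus> z \<in> Q" "z \<oplus> (y \<oplus> b) \<in> Q" using assms(4) bc zc by (auto simp: a_ac)
        have pQ: "psub id Q" using psubset.prems that unfolding primeI_def by auto
        show False
        proof (cases "Q = P")
          case True
          then show False using psub_cancel[OF endo_id pQ Q(2)] \<open>y \<oplus> b \<in> P\<close> zc z by auto
        next
          case False
          then show False using psub_cancel[OF endo_id pQ Q(1)] b z that assms(4) bc by auto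
        qed
      qed
      then show ?thesis using psubD(3)[OF assms(3) b(1) z(1)] by blast
    qed
  qed
qed

text \<open>The half of the permutability of regular sequences that holds in every commutative ring.
  In a relation \<open>x \<otimes> u = i \<oplus> v \<otimes> y\<close>, cancelling \<open>y\<close>
  modulo \<open>adj K x\<close> shows that \<open>v\<close> is a multiple of \<open>x\<close> modulo
  \<open>K\<close>, after which \<open>x\<close> cancels modulo \<open>K\<close>. The other half
  rests on Nakayama's lemma, see \<open>nzd_swap_local\<close>.\<close>

lemma nzd_swap:
  assumes "psub id K" "x \<in> carrier R" "y \<in> carrier R" "nzd K x" "nzd (adj K x) y"
  shows "nzd (adj K y) x"
  unfolding nzd_def
proof (intro ballI impI)
  fix u assume u: "u \<in> carrier R" "x \<otimes> u \<in> adj K y"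
  then obtain i v where i: "i \<in> K" "v \<in> carrier R" "x \<otimes> u = i \<oplus> v \<otimes> y" by (auto elim: in_adjE)
  have ic: "i \<in> carrier R" using psubD(1)[OF assms(1) i(1)] .
  have "y \<otimes> v = (\<ominus> i) \<oplus> u \<otimes> x"
    using i ic u assms(2,3) by (simp add: m_comm[of u x] m_comm[of y v] a_assoc[symmetric] l_neg)
  also have "\<dots> \<in> adj K x" using psub_uminus[OF endo_id assms(1) i(1)] u by (intro in_adjI)
  finally have "v \<in> adj K x" using nzdD[OF assms(5)] i by blast
  then obtain j w where j: "j \<in> K" "w \<in> carrier R" "v = j \<oplus> w \<otimes> x" by (auto elim: in_adjE)
  have jc: "j \<in> carrier R" using psubD(1)[OF assms(1) j(1)] .
  have "x \<otimes> (u \<ominus> w \<otimes> y) = x \<otimes> u \<ominus> x \<otimes> (w \<otimes> y)"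
    using u j assms by (simp add: minus_eq r_distr r_minus)
  also have "x \<otimes> u = i \<oplus> j \<otimes> y \<oplus> x \<otimes> (w \<otimes> y)"
    unfolding i(3) j(3) using j(2) ic jc assms by (simp add: l_distr r_distr a_assoc m_ac)
  also have "(i \<oplus> j \<otimes> y \<oplus> x \<otimes> (w \<otimes> y)) \<ominus> x \<otimes> (w \<otimes> y) = i \<oplus> j \<otimes> y"
    using i j ic jc assms by (simp add: minus_eq a_assoc r_neg)
  also have "\<dots> \<in> K" using psubD(3)[OF assms(1) i(1)] psub_idD(2)[OF assms(1) assms(3) j(1)] by blast
  finally have "u \<ominus> w \<otimes> y \<in> K" using nzdD[OF assms(4)] u j assms by simp
  then show "u \<in> adj K y" using in_adjI'[OF assms(1) i(1) j(2) assms(3) u(1)] by blast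
qed

text \<open>Weakly regular sequences: properness is not demanded. For sequences inside the maximal
  ideal it is automatic, which is the content of \<open>regular_seq_iff_reg\<close>.\<close>

primrec reg :: "'a set \<Rightarrow> 'a list \<Rightarrow> bool" where
  "reg K [] \<longleftrightarrow> True"
| "reg K (y # ys) \<longleftrightarrow> nzd K y \<and> reg (adj K y) ys"

text \<open>Existence of a regular sequence of length n in \<open>J\<close>, peeled off one element
  at a time, since exchange arguments replace the first element and keep only existence of the
  rest.\<close>

primrec has_grade :: "'a set \<Rightarrow> nat \<Rightarrow> 'a set \<Rightarrow> bool" where
  "has_grade J 0 K \<longleftrightarrow> True"
| "has_grade J (Suc n) K \<longleftrightarrow> (\<exists>a\<in>J. nzd K a \<and> has_grade J n (adj K a))"

lemma has_grade_iff: "has_grade J n K \<longleftrightarrow> (\<exists>zs. length zs = n \<and> set zs \<subseteq> J \<and> reg K zs)"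
proof (induction n arbitrary: K)
  case (Suc n)
  show ?case
  proof
    assume "has_grade J (Suc n) K"
    then obtain a zs where "a \<in> J" "nzd K a" "length zs = n" "set zs \<subseteq> J" "reg (adj K a) zs" using Suc by auto
    then show "\<exists>zs. length zs = Suc n \<and> set zs \<subseteq> J \<and> reg K zs" by (intro exI[of _ "a # zs"]) auto
  next
    assume "\<exists>zs. length zs = Suc n \<and> set zs \<subseteq> J \<and> reg K zs"
    then obtain a zs where "length zs = n" "a \<in> J" "set zs \<subseteq> J" "nzd K a" "reg (adj K a) zs"
      by (auto simp: length_Suc_conv)
    then show "has_grade J (Suc n) K" using Suc by auto
  qed
qed auto

lemma reg_append: "reg K (xs @ ys) \<longleftrightarrow> reg K xs \<and> reg (adjs K xs) ys"
  by (induction xs arbitrary: K) auto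

lemma reg_iff_nth: "reg K xs \<longleftrightarrow> (\<forall>i<length xs. nzd (adjs K (take i xs)) (xs ! i))"
  by (induction xs arbitrary: K) (auto simp: All_less_Suc2)

end

section \<open>Associated primes and exchange of regular elements\<close>

context noetherian_domain
begin

lemma ideal_fg:
  assumes "psub id I" obtains es where "set es \<subseteq> I" "I = adjs {\<zero>} es"
proof -
  obtain A where A: "A \<subseteq> carrier R" "finite A" "I = Idl A"
    using finetely_gen assms psub_id_iff_ideal by blast
  obtain es where "set es = A" using finite_list[OF A(2)] by blast
  then show ?thesis using that[of es] A genideal_set_eq_adjs[of es] genideal_self[OF A(1)] by auto
qed

lemma ideal_family_maximal:
  assumes "F \<noteq> {}" "\<And>I. I \<in> F \<Longrightarrow> psub id I"
  shows "\<exists>M\<in>F. \<forall>U\<in>F. M \<subseteq> U \<longrightarrow> U = M"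
proof (rule subset_Zorn_nonempty[OF assms(1)])
  fix C assume C: "C \<noteq> {}" "subset.chain F C"
  then have "subset.chain {I. ideal I R} C" "C \<subseteq> F"
    using assms(2) unfolding subset.chain_def psub_id_iff_ideal by auto
  then show "\<Union>C \<in> F" using ideal_chain_is_trivial[of C] C by auto
qed

text \<open>Only the maximal annihilators \<open>colon K u\<close> with u outside \<open>K\<close>
  are collected; they are prime and already contain every zero divisor modulo \<open>K\<close>. For
  finiteness, let \<open>w P\<close> be an element with annihilator P modulo \<open>K\<close>, and
  take finitely many primes whose elements \<open>w\<close> generate a maximal ideal of this kind.
  For a further prime P, \<open>w P\<close> would lie in that ideal. But the primes are pairwise
  incomparable, so some z outside P lies in all of the chosen ones; it kills their elements modulo
  \<open>K\<close> and does not kill \<open>w P\<close>.\<close>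

lemma associated_primes:
  assumes K: "psub id K"
  obtains Ps where "finite Ps" "\<And>P. P \<in> Ps \<Longrightarrow> primeI P \<and> (\<exists>u\<in>carrier R - K. P = colon K u)"
    "\<And>z. z \<in> carrier R \<Longrightarrow> \<forall>P\<in>Ps. z \<notin> P \<Longrightarrow> nzd K z"
proof -
  define F where "F = colon K ` (carrier R - K)"
  define Ms where "Ms = {P \<in> F. \<forall>U\<in>F. P \<subseteq> U \<longrightarrow> U = P}"
  have Fp: "psub id P" if "P \<in> F" for P using that K unfolding F_def by auto
  have prime: "primeI P" if P: "P \<in> Ms" for P
  proof -
    obtain u where u: "u \<in> carrier R" "u \<notin> K" "P = colon K u" using P unfolding Ms_def F_def by auto
    have "\<one> \<notin> P" using u by (auto simp: colon_def)
    moreover have "a \<in> P" if ab: "a \<in> carrier R" "b \<in> carrier R" "a \<otimes> b \<in> P" "b \<notin> P" for a b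
    proof -
      have bu: "b \<otimes> u \<in> carrier R - K" using ab u by (auto simp: colon_def)
      have "P \<subseteq> colon K (b \<otimes> u)"
      proof
        fix x assume "x \<in> P"
        then have x: "x \<in> carrier R" "b \<otimes> (x \<otimes> u) \<in> K"
          using u psub_idD(1)[OF K ab(2)] by (auto simp: colon_def)
        then show "x \<in> colon K (b \<otimes> u)" using u ab m_lcomm[of b x u] by (auto simp: colon_def)
      qed
      then have "colon K (b \<otimes> u) = P" using P bu unfolding Ms_def F_def by blast
      then show ?thesis using ab u by (auto simp: colon_def m_assoc)
    qed
    ultimately show ?thesis unfolding primeI_def using Fp P unfolding Ms_def by blast
  qed
  have cover: "nzd K z" if z: "z \<in> carrier R" "\<forall>P\<in>Ms. z \<notin> P" for z
    unfolding nzd_def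
  proof (intro ballI impI, rule ccontr)
    fix v assume v: "v \<in> carrier R" "z \<otimes> v \<in> K" "v \<notin> K"
    have "\<exists>M\<in>{P \<in> F. colon K v \<subseteq> P}. \<forall>U\<in>{P \<in> F. colon K v \<subseteq> P}. M \<subseteq> U \<longrightarrow> U = M"
      by (rule ideal_family_maximal) (use v Fp in \<open>auto simp: F_def\<close>)
    then obtain M where M: "M \<in> F" "colon K v \<subseteq> M" "\<forall>U\<in>F. colon K v \<subseteq> U \<longrightarrow> M \<subseteq> U \<longrightarrow> U = M" by auto
    then have "M \<in> Ms" unfolding Ms_def by auto
    moreover have "z \<in> M" using M z v by (auto simp: colon_def)
    ultimately show False using z by blast
  qed
  define w where "w P = (SOME u. u \<in> carrier R - K \<and> P = colon K u)" for P
  have w: "w P \<in> carrier R - K \<and> P = colon K (w P)" if "P \<in> F" for P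
  proof -
    have "\<exists>u. u \<in> carrier R - K \<and> P = colon K u" using that unfolding F_def by blast
    then show ?thesis unfolding w_def by (rule someI_ex)
  qed
  have wc: "set (map w Qs) \<subseteq> carrier R" if "set Qs \<subseteq> Ms" for Qs
  proof -
    have "w P \<in> carrier R" if "P \<in> Ms" for P using that w[of P] unfolding Ms_def by blast
    then show ?thesis using that by auto
  qed
  define G where "G = (\<lambda>Qs. adjs {\<zero>} (map w Qs)) ` {Qs. set Qs \<subseteq> Ms}"
  have "\<exists>M\<in>G. \<forall>U\<in>G. M \<subseteq> U \<longrightarrow> U = M"
  proof (rule ideal_family_maximal)
    show "G \<noteq> {}" unfolding G_def by (auto intro!: exI[of _ "[]"])
    show "psub id I" if "I \<in> G" for I
      using that adjs_psub[OF psub_zero[OF endo_id] wc] unfolding G_def by auto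
  qed
  then obtain M where M: "M \<in> G" "\<And>U. U \<in> G \<Longrightarrow> M \<subseteq> U \<Longrightarrow> U = M" by blast
  obtain Ps where Ps: "set Ps \<subseteq> Ms" "M = adjs {\<zero>} (map w Ps)" using M(1) unfolding G_def by auto
  have "Ms \<subseteq> set Ps"
  proof
    fix P assume P: "P \<in> Ms"
    then have PF: "P \<in> F" unfolding Ms_def by auto
    have "adjs {\<zero>} (map w (P # Ps)) = adjs {\<zero>} (map w Ps)"
    proof (rule M(2)[unfolded Ps(2)])
      have PPs: "set (P # Ps) \<subseteq> Ms" using P Ps by auto
      then show "adjs {\<zero>} (map w (P # Ps)) \<in> G" unfolding G_def by blast
      show "adjs {\<zero>} (map w Ps) \<subseteq> adjs {\<zero>} (map w (P # Ps))"
        using adjs_ge[OF psub_zero[OF endo_id] wc[OF PPs]] adjs_psub[OF psub_zero[OF endo_id] wc[OF PPs]]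
        by (intro adjs_least) auto
    qed
    moreover have "w P \<in> adjs {\<zero>} (map w (P # Ps))"
      using adjs_ge[of "{\<zero>}" "map w (P # Ps)"] wc[of "P # Ps"] P Ps by auto
    ultimately have wP: "w P \<in> adjs {\<zero>} (map w Ps)" by simp
    show "P \<in> set Ps"
    proof (rule ccontr)
      assume n: "P \<notin> set Ps"
      have "\<exists>z\<in>carrier R. z \<notin> P \<and> (\<forall>Q\<in>set Ps. z \<in> Q)"
      proof (rule prime_avoid_prod)
        show "psub id Q \<and> \<not> Q \<subseteq> P" if "Q \<in> set Ps" for Q
          using that n Ps(1) PF Fp unfolding Ms_def by blast
        show "\<not> carrier R \<subseteq> P" using prime[OF P] psubD(5) unfolding primeI_def by blast
      qed (use prime[OF P] in auto)
      then obtain z where z: "z \<in> carrier R" "z \<notin> P" "\<forall>Q\<in>set Ps. z \<in> Q" by blast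
      have "adjs {\<zero>} (map w Ps) \<subseteq> colon K z"
      proof (rule adjs_least)
        have "w Q \<in> colon K z" if "Q \<in> set Ps" for Q
        proof -
          have "Q \<in> F" using that Ps(1) unfolding Ms_def by auto
          note wQ = w[OF this]
          have "z \<in> colon K (w Q)" using wQ z that by blast
          then show ?thesis using wQ z(1) unfolding colon_def by (auto simp: m_comm)
        qed
        then show "set (map w Ps) \<subseteq> colon K z" by auto
      qed (use K z psubD(2)[OF colon_psub[OF K z(1)]] in auto)
      then have "w P \<in> colon K z" using wP by blast
      then have "z \<in> colon K (w P)" using z unfolding colon_def by (auto simp: m_comm)
      then show False using w[OF PF] z by blast
    qed
  qed
  then have "finite Ms" using finite_subset by blast
  moreover have "primeI P \<and> (\<exists>u\<in>carrier R - K. P = colon K u)" if "P \<in> Ms" for P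
    using prime[OF that] that unfolding Ms_def F_def by auto
  ultimately show ?thesis using that cover by blast
qed

text \<open>A prime \<open>colon K u\<close> containing \<open>J\<close> would contain the
  nonzerodivisor z of that \<open>K\<close>, forcing u into \<open>K\<close>. So
  \<open>davis\<close>, applied to the coset of \<open>\<zero>\<close>, avoids the primes of all
  members of \<open>Ks\<close> simultaneously.\<close>

lemma common_nzd:
  assumes "finite Ks" "\<And>K. K \<in> Ks \<Longrightarrow> psub id K" "psub id J" "\<And>K. K \<in> Ks \<Longrightarrow> \<exists>z\<in>J. nzd K z"
  shows "\<exists>z\<in>J. \<forall>K\<in>Ks. nzd K z"
proof -
  have "\<exists>Ps. finite Ps \<and> (\<forall>P\<in>Ps. primeI P \<and> (\<exists>u\<in>carrier R - K. P = colon K u)) \<and> (\<forall>z\<in>carrier R. (\<forall>P\<in>Ps. z \<notin> P) \<longrightarrow> nzd K z)"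
    if "K \<in> Ks" for K using associated_primes[OF assms(2)[OF that]] by metis
  then obtain A where A: "\<And>K. K \<in> Ks \<Longrightarrow> finite (A K)"
    "\<And>K P. K \<in> Ks \<Longrightarrow> P \<in> A K \<Longrightarrow> primeI P \<and> (\<exists>u\<in>carrier R - K. P = colon K u)"
    "\<And>K z. K \<in> Ks \<Longrightarrow> z \<in> carrier R \<Longrightarrow> (\<forall>P\<in>A K. z \<notin> P) \<Longrightarrow> nzd K z"
    by metis
  have "\<exists>b\<in>J. \<forall>P\<in>(\<Union>K\<in>Ks. A K). \<zero> \<oplus> b \<notin> P"
  proof (rule davis)
    fix P assume "P \<in> (\<Union>K\<in>Ks. A K)"
    then obtain K u where K: "K \<in> Ks" "u \<in> carrier R" "u \<notin> K" "P = colon K u" using A(2) by blast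
    obtain z where "z \<in> J" "nzd K z" using assms(4) K by blast
    then have "z \<notin> P" using K nzdD unfolding colon_def by blast
    then show "\<not> (\<zero> \<in> P \<and> J \<subseteq> P)" using \<open>z \<in> J\<close> by blast
  qed (use A assms in auto)
  then obtain b where "b \<in> J" "\<forall>P\<in>(\<Union>K\<in>Ks. A K). b \<notin> P" using psubD(1)[OF assms(3)] by auto
  moreover from this have "b \<in> carrier R" using psubD(1)[OF assms(3)] by simp
  ultimately have "\<forall>K\<in>Ks. nzd K b" using A(3)[of _ b] by simp
  then show ?thesis using \<open>b \<in> J\<close> by blast
qed

text \<open>If no single prime of the finite list contained \<open>J\<close>, then
  \<open>davis\<close> would produce a nonzerodivisor in \<open>J\<close>. So \<open>J\<close> is
  contained in some \<open>colon K u\<close>.\<close>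

lemma no_nzd_annihilated:
  assumes "psub id K" "psub id J" "\<And>z. z \<in> J \<Longrightarrow> \<not> nzd K z"
  obtains u where "u \<in> carrier R" "u \<notin> K" "\<And>j. j \<in> J \<Longrightarrow> j \<otimes> u \<in> K"
proof -
  obtain Ps where Ps: "finite Ps" "\<And>P. P \<in> Ps \<Longrightarrow> primeI P \<and> (\<exists>u\<in>carrier R - K. P = colon K u)"
    "\<And>z. z \<in> carrier R \<Longrightarrow> \<forall>P\<in>Ps. z \<notin> P \<Longrightarrow> nzd K z" using associated_primes[OF assms(1)] by metis
  have "\<exists>P\<in>Ps. J \<subseteq> P"
  proof (rule ccontr)
    assume "\<not> ?thesis"
    then have "\<exists>b\<in>J. \<forall>P\<in>Ps. \<zero> \<oplus> b \<notin> P" using Ps assms(2) by (intro davis) auto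
    then obtain b where "b \<in> J" "\<forall>P\<in>Ps. b \<notin> P" using psubD(1)[OF assms(2)] by auto
    moreover from this have "b \<in> carrier R" using psubD(1)[OF assms(2)] by simp
    ultimately show False using Ps(3)[of b] assms(3)[of b] by simp
  qed
  then show ?thesis using that Ps(2) unfolding colon_def by blast
qed

text \<open>The socle of \<open>R/(K + xR)\<close> and of \<open>R/(K + aR)\<close> determine each other: if \<open>J u \<subseteq> K + aR\<close> and
  \<open>x u = i + v a\<close>, then \<open>J v \<subseteq> K + xR\<close>.\<close>
lemma grade_exchange_base:
  assumes K: "psub id K" and J: "psub id J" and x: "x \<in> J" "nzd K x" and z: "z \<in> J" "nzd (adj K x) z"
    and a: "a \<in> J" "nzd K a"
  shows "\<exists>z\<in>J. nzd (adj K a) z"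
proof (rule ccontr)
  assume none: "\<not> ?thesis"
  have c: "x \<in> carrier R" "z \<in> carrier R" "a \<in> carrier R" using x z a psubD(1)[OF J] by auto
  have Ka: "psub id (adj K a)" "psub id (adj K x)" using K c by auto
  obtain u where u: "u \<in> carrier R" "u \<notin> adj K a" "\<And>j. j \<in> J \<Longrightarrow> j \<otimes> u \<in> adj K a"
    using no_nzd_annihilated[OF Ka(1) J] none by blast
  obtain i v where i: "i \<in> K" "v \<in> carrier R" "x \<otimes> u = i \<oplus> v \<otimes> a" using u(3)[OF x(1)] by (auto elim: in_adjE)
  have ic: "i \<in> carrier R" using psubD(1)[OF K i(1)] .
  obtain j w where j: "j \<in> K" "w \<in> carrier R" "z \<otimes> u = j \<oplus> w \<otimes> a" using u(3)[OF z(1)] by (auto elim: in_adjE)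
  have jc: "j \<in> carrier R" using psubD(1)[OF K j(1)] .
  \<comment> \<open>The product of x, z and u is expanded once through \<open>x \<otimes> u\<close>
    and once through \<open>z \<otimes> u\<close>. Comparing the two puts
    \<open>a \<otimes> (z \<otimes> v \<ominus> w \<otimes> x)\<close> into
    \<open>K\<close>.\<close>
  have e: "z \<otimes> i \<oplus> a \<otimes> (z \<otimes> v) = x \<otimes> j \<oplus> a \<otimes> (w \<otimes> x)"
  proof -
    have "z \<otimes> i \<oplus> a \<otimes> (z \<otimes> v) = z \<otimes> (x \<otimes> u)" using i ic c by (simp add: r_distr m_ac)
    also have "\<dots> = x \<otimes> (z \<otimes> u)" using u c by (simp add: m_lcomm)
    also have "\<dots> = x \<otimes> j \<oplus> a \<otimes> (w \<otimes> x)" using j jc c by (simp add: r_distr m_ac)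
    finally show ?thesis .
  qed
  have "a \<otimes> (z \<otimes> v \<ominus> w \<otimes> x) = a \<otimes> (z \<otimes> v) \<ominus> a \<otimes> (w \<otimes> x)"
    using c i j by (simp add: minus_eq r_distr r_minus)
  also have "\<dots> = x \<otimes> j \<ominus> z \<otimes> i"
  proof -
    have "a \<otimes> (z \<otimes> v) = (\<ominus> (z \<otimes> i)) \<oplus> (z \<otimes> i \<oplus> a \<otimes> (z \<otimes> v))"
      using c i ic by (simp add: a_assoc[symmetric] l_neg)
    also have "\<dots> = (\<ominus> (z \<otimes> i)) \<oplus> (x \<otimes> j \<oplus> a \<otimes> (w \<otimes> x))" using e by simp
    finally show ?thesis using c i ic j jc by (simp add: minus_eq a_ac r_neg)
  qed
  also have "\<dots> \<in> K" using psub_diffD[OF endo_id K] psub_idD(1)[OF K] c i j by blast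
  finally have "z \<otimes> v \<ominus> w \<otimes> x \<in> K" using nzdD[OF a(2)] c i j by simp
  then have "z \<otimes> v \<in> adj K x" using in_adjI'[OF K i(1) j(2) c(1)] c i by simp
  then have "v \<in> adj K x" using nzdD[OF z(2)] i by blast
  then obtain k r where k: "k \<in> K" "r \<in> carrier R" "v = k \<oplus> r \<otimes> x" by (auto elim: in_adjE)
  have kc: "k \<in> carrier R" using psubD(1)[OF K k(1)] .
  have "x \<otimes> (u \<ominus> r \<otimes> a) = x \<otimes> u \<ominus> x \<otimes> (r \<otimes> a)"
    using u k c by (simp add: minus_eq r_distr r_minus)
  also have "x \<otimes> u = i \<oplus> k \<otimes> a \<oplus> x \<otimes> (r \<otimes> a)"
    unfolding i(3) k(3) using k(2) ic kc c by (simp add: l_distr r_distr a_assoc m_ac)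
  also have "(i \<oplus> k \<otimes> a \<oplus> x \<otimes> (r \<otimes> a)) \<ominus> x \<otimes> (r \<otimes> a) = i \<oplus> k \<otimes> a" using i k ic kc c by (simp add: minus_eq a_assoc r_neg)
  also have "\<dots> \<in> K" using psubD(3)[OF K i(1)] psub_idD(2)[OF K c(3) k(1)] by blast
  finally have "u \<ominus> r \<otimes> a \<in> K" using nzdD[OF x(2)] u k c by simp
  then show False using u in_adjI'[OF K i(1) k(2) c(3) u(1)] by blast
qed

text \<open>The given sequence starts with x, the desired one continues a. An element z of
  \<open>J\<close> that is a nonzerodivisor modulo \<open>K\<close>, \<open>adj K x\<close> and
  \<open>adj K a\<close> mediates: the induction hypothesis trades x for z above
  \<open>adj K x\<close> and then z for a above \<open>adj K z\<close>, while
  \<open>nzd_swap\<close> and \<open>adj_commute\<close> reorder the pairs.\<close>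

lemma grade_exchange:
  assumes J: "psub id J"
  shows "psub id K \<Longrightarrow> has_grade J (Suc n) K \<Longrightarrow> a \<in> J \<Longrightarrow> nzd K a \<Longrightarrow> has_grade J n (adj K a)"
proof (induction n arbitrary: K a)
  case (Suc n)
  have K: "psub id K" by (rule Suc.prems(1))
  note a = Suc.prems(3,4)
  obtain x where x: "x \<in> J" "nzd K x" "has_grade J (Suc n) (adj K x)" using Suc.prems by auto
  have c: "x \<in> carrier R" "a \<in> carrier R" using x a psubD(1)[OF J] by auto
  obtain z0 where "z0 \<in> J" "nzd (adj K x) z0" using x by auto
  then have "\<exists>z\<in>J. nzd (adj K a) z" using grade_exchange_base[OF K J] x a by blast
  then have "\<exists>z\<in>J. \<forall>L\<in>{K, adj K x, adj K a}. nzd L z"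
    using K c x J \<open>z0 \<in> J\<close> \<open>nzd (adj K x) z0\<close> by (intro common_nzd) auto
  then obtain z where z: "z \<in> J" "nzd K z" "nzd (adj K x) z" "nzd (adj K a) z" by auto
  have zc: "z \<in> carrier R" using z psubD(1)[OF J] by auto
  have "has_grade J n (adj (adj K x) z)" by (rule Suc.IH[OF adj_psub[OF K c(1)] x(3) z(1,3)])
  then have "has_grade J n (adj (adj K z) x)" using adj_commute[OF K c(1) zc] by simp
  moreover have "nzd (adj K z) x" using nzd_swap[OF K c(1) zc x(2) z(3)] .
  ultimately have "has_grade J (Suc n) (adj K z)" using x by auto
  moreover have "nzd (adj K z) a" using nzd_swap[OF K c(2) zc a(2) z(4)] .
  ultimately have "has_grade J n (adj (adj K z) a)" using Suc.IH[OF adj_psub[OF K zc]] a by blast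
  then show ?case using adj_commute[OF K c(2) zc] z by auto
qed auto

text \<open>By \<open>davis\<close> the generator \<open>y\<close> can be replaced by a nonzerodivisor \<open>y + b\<close>, with \<open>b\<close> in the span of
  the others; \<open>grade_exchange\<close> then lowers the grade by exactly one.\<close>
lemma grade_le_generators:
  assumes J: "psub id J" "J \<noteq> carrier R"
  shows "psub id K \<Longrightarrow> set ys \<subseteq> carrier R \<Longrightarrow> J = adjs K ys \<Longrightarrow> has_grade J n K \<Longrightarrow>
     n \<le> length ys \<and> (n = length ys \<longrightarrow> (\<exists>zs. length zs = n \<and> set zs \<subseteq> J \<and> reg K zs \<and> adjs K zs = J))"
proof (induction ys arbitrary: K n)
  case Nil
  have "n = 0"
  proof (cases n)
    \<comment> \<open>Without generators \<open>J = K\<close>, and a nonzerodivisor modulo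
      \<open>K\<close> that lies in \<open>K\<close> forces \<open>\<one> \<in> K\<close>.\<close>
    case (Suc k)
    then obtain a where a: "a \<in> J" "nzd K a" using Nil by auto
    then have "\<one> \<in> K" using nzdD[OF a(2), of \<one>] Nil psubD(1)[OF J(1)] by simp
    then have "carrier R \<subseteq> J" using psub_idD(2)[OF J(1), of _ \<one>] Nil by auto
    then show ?thesis using J psubD(5) by blast
  qed simp
  then show ?case using Nil by auto
next
  case (Cons y ys)
  have K: "psub id K" by (rule Cons.prems(1))
  show ?case
  proof (cases n)
    case (Suc k)
    have c: "y \<in> carrier R" "set ys \<subseteq> carrier R" using Cons by auto
    obtain x where x: "x \<in> J" "nzd K x" using Cons Suc by auto
    obtain Ps where Ps: "finite Ps" "\<And>P. P \<in> Ps \<Longrightarrow> primeI P \<and> (\<exists>u\<in>carrier R - K. P = colon K u)"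
       "\<And>z. z \<in> carrier R \<Longrightarrow> \<forall>P\<in>Ps. z \<notin> P \<Longrightarrow> nzd K z" using associated_primes[OF K] by metis
    have J': "psub id (adjs K ys)" using K c by simp
    \<comment> \<open>A prime of \<open>Ps\<close> containing \<open>y\<close> and
      \<open>adjs K ys\<close> would contain \<open>J\<close>, hence the nonzerodivisor
      \<open>x\<close>.\<close>
    have "\<exists>b\<in>adjs K ys. \<forall>P\<in>Ps. y \<oplus> b \<notin> P"
    proof (rule davis[OF Ps(1) _ J' c(1)])
      fix P assume P: "P \<in> Ps"
      show "\<not> (y \<in> P \<and> adjs K ys \<subseteq> P)"
      proof
        assume yP: "y \<in> P \<and> adjs K ys \<subseteq> P"
        have "J \<subseteq> P" unfolding Cons.prems(3)
          using yP Ps(2)[OF P] K c adjs_ge[OF K c(2)] unfolding primeI_def by (intro adjs_least) auto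
        then show False using x Ps(2)[OF P] nzdD unfolding colon_def by blast
      qed
    qed (use Ps in auto)
    then obtain b where b: "b \<in> adjs K ys" "\<forall>P\<in>Ps. y \<oplus> b \<notin> P" by blast
    have bc: "b \<in> carrier R" using b psubD(1)[OF J'] by auto
    define a where "a = y \<oplus> b"
    have ac: "a \<in> carrier R" using c bc unfolding a_def by auto
    have na: "nzd K a" using Ps(3)[of a] ac b unfolding a_def by blast
    have ysJ: "K \<subseteq> J" "y \<in> J" "set ys \<subseteq> J" using adjs_ge[OF K Cons.prems(2)] Cons.prems(3) by auto
    have "adjs K ys \<subseteq> J" using ysJ J by (intro adjs_least) auto
    then have aJ: "a \<in> J" unfolding a_def using ysJ b psubD(3)[OF J(1)] by blast
    have "has_grade J k (adj K a)" using grade_exchange[OF J(1) K _ aJ na] Cons.prems Suc by blast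
    \<comment> \<open>Nothing is lost on replacing \<open>y\<close> by \<open>a\<close>, since
      \<open>y\<close> is \<open>a\<close> minus an element of \<open>adjs K ys\<close>.\<close>
    moreover have eq: "J = adjs (adj K a) ys"
    proof
      show "adjs (adj K a) ys \<subseteq> J" using ysJ aJ J by (intro adjs_least adj_least) auto
      have p: "psub id (adjs (adj K a) ys)" using K ac c by simp
      have g: "adj K a \<subseteq> adjs (adj K a) ys" "set ys \<subseteq> adjs (adj K a) ys"
        using adjs_ge[of "adj K a" ys] K ac c by auto
      have "K \<subseteq> adjs (adj K a) ys" "a \<in> adjs (adj K a) ys" using g adj_ge[OF K ac] adj_self[OF K ac] by auto
      moreover from this have "b \<in> adjs (adj K a) ys" using b g adjs_least[OF p, of K ys] by blast
      ultimately have "y \<in> adjs (adj K a) ys"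
        using psub_cancel[OF endo_id p, of y b] c unfolding a_def by blast
      then show "J \<subseteq> adjs (adj K a) ys" unfolding Cons.prems(3)
        using g \<open>K \<subseteq> adjs (adj K a) ys\<close> p by (intro adjs_least) auto
    qed
    ultimately have IH: "k \<le> length ys \<and> (k = length ys \<longrightarrow> (\<exists>zs. length zs = k \<and> set zs \<subseteq> J \<and> reg (adj K a) zs \<and> adjs (adj K a) zs = J))"
      using Cons.IH[OF adj_psub[OF K ac] c(2)] by blast
    then show ?thesis
    proof (intro conjI impI)
      assume "n = length (y # ys)"
      then obtain zs where "length zs = k" "set zs \<subseteq> J" "reg (adj K a) zs" "adjs (adj K a) zs = J" using IH Suc by auto
      then show "\<exists>zs. length zs = n \<and> set zs \<subseteq> J \<and> reg K zs \<and> adjs K zs = J"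
        using aJ na Suc by (intro exI[of _ "a # zs"]) auto
    qed (use Suc in auto)
  qed auto
qed

end

section \<open>Powers of regular sequences and primary ideals\<close>

context cring
begin

lemma span_coeff_mem:
  assumes "endo \<psi>" "psub \<psi> Y" "psub id C" "set es \<subseteq> carrier R" "e \<in> set es" "a \<in> C"
  shows "\<psi> a \<otimes> e \<in> span C \<psi> Y es"
  using assms(4,5)
proof (induction es)
  case (Cons f es)
  define S where "S = span C \<psi> Y es"
  have S: "psub \<psi> S" unfolding S_def using assms(1,2,3) Cons.prems by (intro span_psub1) auto
  have f: "f \<in> carrier R" using Cons.prems by auto
  show ?case
  proof (cases "e = f")
    case True
    then show ?thesis using ext_mem[of \<psi> S a C f] assms psubD(2)[OF S] psubD(1)[OF assms(3)] f unfolding S_def by auto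
  next
    case False
    then have "\<psi> a \<otimes> e \<in> S" using Cons unfolding S_def by auto
    then show ?thesis using ext_ge[of \<psi> S C f] assms psubD(5)[OF S] psubD(2)[OF assms(3)] f unfolding S_def by auto
  qed
qed auto

lemma nzd_pow: "psub id L \<Longrightarrow> x \<in> carrier R \<Longrightarrow> nzd L x \<Longrightarrow> nzd L (x [^] (n::nat))"
proof (induction n)
  case (Suc n)
  have n: "nzd L (x [^] n)" by (rule Suc.IH[OF Suc.prems])
  show ?case unfolding nzd_def
  proof (intro ballI impI)
    fix u assume u: "u \<in> carrier R" "x [^] Suc n \<otimes> u \<in> L"
    then have "x [^] n \<otimes> (x \<otimes> u) \<in> L" using Suc.prems(2) by (simp add: m_assoc)
    then have "x \<otimes> u \<in> L" using nzdD[OF n] u Suc.prems(2) by simp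
    then show "u \<in> L" using nzdD[OF Suc.prems(3)] u by blast
  qed
qed (auto simp: nzd_def)

text \<open>Consecutive terms of the filtration by \<open>adj L (x [^] n)\<close> have a quotient
  generated by \<open>x [^] n\<close> whose annihilator is \<open>adj L x\<close>, because
  \<open>x [^] n\<close> is a nonzerodivisor modulo \<open>L\<close>. Hence all n steps have the
  same length.\<close>

lemma tlen_adj_pow:
  assumes "endo \<psi>" "psub id L" "x \<in> carrier R" "nzd L x"
  shows "tlen {\<one>} \<psi> (adj L (x [^] (n::nat))) (carrier R) = enat n * tlen {\<one>} \<psi> (adj L x) (carrier R)"
proof (induction n)
  case 0
  have "carrier R \<subseteq> adj L \<one>"
    using psub_idD(2)[OF adj_psub[OF assms(2), of \<one>], of _ \<one>] adj_self[OF assms(2), of \<one>] by auto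
  then have "adj L \<one> = carrier R" using psubD(5)[OF adj_psub[OF assms(2), of \<one>]] by auto
  then show ?case by (simp add: clen_same zero_enat_def[symmetric])
next
  case (Suc n)
  define e where "e = x [^] n"
  define N where "N = adj L (x [^] Suc n)"
  define W where "W = adj L e"
  have c: "e \<in> carrier R" "x [^] Suc n \<in> carrier R" "x [^] Suc n = e \<otimes> x" using assms(3) unfolding e_def by auto
  have p: "psub id N" "psub id W" unfolding N_def W_def using assms c by auto
  have eW: "e \<in> W" unfolding W_def using adj_self assms c by auto
  have LN: "L \<subseteq> N" "e \<otimes> x \<in> N" unfolding N_def using adj_ge adj_self assms c by auto
  have NW: "N \<subseteq> W" unfolding N_def
  proof (rule adj_least[OF p(2)])
    show "L \<subseteq> W" unfolding W_def using adj_ge assms c by auto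
    show "x [^] Suc n \<in> W" using psub_idD(2)[OF p(2) assms(3) eW] c by simp
  qed
  have ts: "tsub {\<one>} \<psi> N" "tsub {\<one>} \<psi> W" using p psub_of_id assms(1) by (auto simp: tsub_one)
  have ne: "nzd L e" unfolding e_def using nzd_pow assms by blast
  have "tlen {\<one>} (id \<circ> \<psi>) N W = tlen {\<one>} \<psi> (adj L x) (carrier R)"
  proof (rule antisym)
    show "tlen {\<one>} (id \<circ> \<psi>) N W \<le> tlen {\<one>} \<psi> (adj L x) (carrier R)"
    proof (rule cyclic_upper[OF mset_one endo_id assms(1) psub_comp[OF endo_id assms(1) p(1)] c(1)])
      show "adj L x \<subseteq> carrier R" using psubD(5) assms by (intro psubD(5)[of id]) auto
      show "id a \<otimes> e \<in> N" if "a \<in> adj L x" for a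
      proof -
        have "adj L x \<subseteq> colon N e"
          using LN psub_idD(2)[OF p(1) c(1)] p c assms psubD(1)[OF assms(2)]
          by (intro adj_least colon_psub) (auto simp: colon_def m_comm)
        then show ?thesis using that by (auto simp: colon_def)
      qed
      have "W \<subseteq> ext (carrier R) id N e" unfolding W_def adj_def using LN by (intro ext_mono) auto
      also have "\<dots> \<subseteq> sat {\<one>} (id \<circ> \<psi>) (ext (carrier R) id N e)"
        using assms(1) psubD(5)[OF ext_psub1[OF endo_id p(1) _ c(1), of "carrier R"]] by (intro sat_ge) auto
      finally show "W \<subseteq> sat {\<one>} (id \<circ> \<psi>) (ext (carrier R) id N e)" .
    qed
    show "tlen {\<one>} \<psi> (adj L x) (carrier R) \<le> tlen {\<one>} (id \<circ> \<psi>) N W"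
    proof (rule cyclic_lower[OF mset_one endo_id assms(1) p(1) c(1) p(2) eW NW])
      show "tsub {\<one>} (id \<circ> \<psi>) W" using ts by simp
      fix a assume a: "a \<in> carrier R" "id a \<otimes> e \<in> N"
      then obtain l r where l: "l \<in> L" "r \<in> carrier R" "a \<otimes> e = l \<oplus> r \<otimes> (e \<otimes> x)"
        unfolding N_def c(3) by (auto elim: in_adjE)
      have lc: "l \<in> carrier R" using psubD(1)[OF assms(2) l(1)] .
      have "e \<otimes> (a \<ominus> r \<otimes> x) = a \<otimes> e \<ominus> r \<otimes> (e \<otimes> x)"
        using a l assms c by (simp add: minus_eq r_distr r_minus m_ac)
      also have "\<dots> = l" unfolding l(3) using lc l(2) c(1) assms(3) by (simp add: minus_eq a_assoc r_neg)
      finally have "a \<ominus> r \<otimes> x \<in> L" using nzdD[OF ne] l a assms(3) by simp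
      then show "a \<in> adj L x" using in_adjI'[OF assms(2) l(1,2) assms(3) a(1)] by blast
    qed
  qed
  then have 1: "tlen {\<one>} \<psi> N W = tlen {\<one>} \<psi> (adj L x) (carrier R)" by (simp only: id_o)
  have "tlen {\<one>} \<psi> N (carrier R) = tlen {\<one>} \<psi> N W + tlen {\<one>} \<psi> W (carrier R)"
    using ts assms(1) NW psubD(5)[OF p(2)] by (intro tlen_add) auto
  then show ?case using Suc 1 unfolding N_def W_def e_def
    by (simp add: mult_eSuc flip: eSuc_enat)
qed

text \<open>Instead of expanding binomially, the induction carries a monomial
  \<open>u [^] i \<otimes> v [^] j\<close> in front of the remaining power of the sum. When that
  power is used up, \<open>p \<le> i\<close> or \<open>q \<le> j\<close> must hold.\<close>

lemma add_pow_mem: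
  assumes I: "psub id I" and c: "u \<in> carrier R" "v \<in> carrier R"
    and p: "u [^] (p::nat) \<in> I" and q: "v [^] (q::nat) \<in> I"
  shows "(u \<oplus> v) [^] (p + q) \<in> I"
proof -
  have "p + q \<le> i + j + n \<Longrightarrow> u [^] i \<otimes> v [^] j \<otimes> (u \<oplus> v) [^] n \<in> I" for i j n :: nat
  proof (induction n arbitrary: i j)
    case 0
    then consider "p \<le> i" | "q \<le> j" by linarith
    then have "u [^] i \<otimes> v [^] j \<in> I"
    proof cases
      case 1
      then have "u [^] i = u [^] (i - p) \<otimes> u [^] p" using c by (simp add: nat_pow_mult)
      then have "u [^] i \<in> I" using psub_idD(1)[OF I _ p] c by simp
      then show ?thesis using psub_idD(2)[OF I] c by simp
    next
      case 2
      then have "v [^] j = v [^] (j - q) \<otimes> v [^] q" using c by (simp add: nat_pow_mult)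
      then have "v [^] j \<in> I" using psub_idD(1)[OF I _ q] c by simp
      then show ?thesis using psub_idD(1)[OF I] c by simp
    qed
    then show ?case using c by simp
  next
    case (Suc n)
    have "u [^] Suc i \<otimes> v [^] j \<otimes> (u \<oplus> v) [^] n \<in> I" "u [^] i \<otimes> v [^] Suc j \<otimes> (u \<oplus> v) [^] n \<in> I"
      using Suc.IH[of "Suc i" j] Suc.IH[of i "Suc j"] Suc.prems by simp_all
    then have "u [^] Suc i \<otimes> v [^] j \<otimes> (u \<oplus> v) [^] n \<oplus> u [^] i \<otimes> v [^] Suc j \<otimes> (u \<oplus> v) [^] n \<in> I"
      using psubD(3)[OF I] by blast
    moreover have "u [^] Suc i \<otimes> v [^] j \<otimes> (u \<oplus> v) [^] n \<oplus> u [^] i \<otimes> v [^] Suc j \<otimes> (u \<oplus> v) [^] n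
        = u [^] i \<otimes> v [^] j \<otimes> (u \<oplus> v) [^] Suc n"
    proof -
      define A B S where "A = u [^] i" and "B = v [^] j" and "S = (u \<oplus> v) [^] n"
      have "A \<in> carrier R" "B \<in> carrier R" "S \<in> carrier R" using c unfolding A_def B_def S_def by auto
      then have "A \<otimes> u \<otimes> B \<otimes> S \<oplus> A \<otimes> (B \<otimes> v) \<otimes> S = A \<otimes> B \<otimes> (S \<otimes> (u \<oplus> v))"
        using c by (simp add: r_distr m_ac)
      then show ?thesis unfolding A_def B_def S_def by simp
    qed
    ultimately show ?case by simp
  qed
  from this[of 0 0 "p + q"] show ?thesis using c by simp
qed

text \<open>By \<open>add_pow_mem\<close> exponents add up over the generators: each contributes
  \<open>a\<close>, and the empty list contributes the final \<open>1\<close>, as its only element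
  \<open>\<zero>\<close> must be raised to a positive power.\<close>

lemma adjs_pow_mem:
  assumes "set ys \<subseteq> carrier R" "z \<in> adjs {\<zero>} ys"
  shows "z [^] (length ys * a + 1) \<in> adjs {\<zero>} (map (\<lambda>y. y [^] (a::nat)) ys)"
  using assms
proof (induction ys arbitrary: z)
  case (Cons y ys)
  have c: "y \<in> carrier R" "set ys \<subseteq> carrier R" using Cons.prems by auto
  define I where "I = adjs {\<zero>} (map (\<lambda>y. y [^] a) (y # ys))"
  have mc: "set (map (\<lambda>y. y [^] a) (y # ys)) \<subseteq> carrier R" using c by auto
  have I: "psub id I" unfolding I_def using mc by (intro adjs_psub) auto
  have g: "set (map (\<lambda>y. y [^] a) (y # ys)) \<subseteq> I" "{\<zero>} \<subseteq> I" unfolding I_def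
    using adjs_ge[OF psub_zero[OF endo_id] mc] by auto
  have "adjs {\<zero>} (y # ys) = adjs {\<zero>} (ys @ [y])" using c by (intro adjs_cong_set) auto
  then have "z \<in> adj (adjs {\<zero>} ys) y" using Cons.prems by (simp add: adjs_append)
  then obtain k r where k: "k \<in> adjs {\<zero>} ys" "r \<in> carrier R" "z = k \<oplus> r \<otimes> y" by (rule in_adjE)
  have kc: "k \<in> carrier R" using psubD(1)[OF adjs_psub[OF psub_zero[OF endo_id] c(2)] k(1)] .
  have "k [^] (length ys * a + 1) \<in> adjs {\<zero>} (map (\<lambda>y. y [^] a) ys)" using Cons.IH k c by simp
  moreover have "adjs {\<zero>} (map (\<lambda>y. y [^] a) ys) \<subseteq> I" using g by (intro adjs_least I) auto
  ultimately have 1: "k [^] (length ys * a + 1) \<in> I" by blast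
  have "y [^] a \<in> I" using g by auto
  then have 2: "(r \<otimes> y) [^] a \<in> I" using psub_idD(1)[OF I] k c by (simp add: nat_pow_distrib)
  have "z [^] ((length ys * a + 1) + a) \<in> I" unfolding k(3)
    by (rule add_pow_mem[OF I kc _ 1 2]) (use k c in auto)
  then show ?case unfolding I_def by (simp add: algebra_simps)
qed auto

end

section \<open>Permuting regular sequences, primary ideals and prime chains\<close>

context noetherian_domain
begin

text \<open>Let U be \<open>colon K y\<close>. If e lies in U, then e is in \<open>K\<close> plus a
  multiple \<open>r \<otimes> x\<close>, because \<open>y\<close> is regular modulo
  \<open>adj K x\<close>; cancelling \<open>x\<close> puts \<open>r\<close> into U. So U is
  contained in \<open>K\<close> plus x times U, and Nakayama's lemma gives U inside
  \<open>K\<close>.\<close>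

lemma nzd_swap_local:
  assumes pp: "prime_pair {\<one>} m" and K: "psub id K" and x: "x \<in> m" "nzd K x"
    and y: "y \<in> carrier R" "nzd (adj K x) y"
  shows "nzd K y"
proof -
  note m = prime_pairD(2)[OF pp]
  have xc: "x \<in> carrier R" using psubD(1)[OF m x(1)] .
  have U: "psub id (colon K y)" using K y by simp
  obtain es where es: "set es \<subseteq> colon K y" "colon K y = adjs {\<zero>} es" using ideal_fg[OF U] by blast
  have ec: "set es \<subseteq> carrier R" using es psubD(5)[OF U] by auto
  define S where "S = span m id K es"
  have S: "psub id S" unfolding S_def using K m ec by (intro span_psub1) auto
  have KS: "K \<subseteq> S" unfolding S_def using span_ge[of id K m es] psubD(5)[OF K] psubD(2,5)[OF m] ec by auto
  have "e \<in> colon S x" if "e \<in> set es" for e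
    using span_coeff_mem[OF endo_id K m ec that x(1)] that ec xc m_comm[of e x] unfolding S_def colon_def by auto
  then have "set es \<subseteq> colon S x" by blast
  then have sub: "colon K y \<subseteq> colon S x" unfolding es(2)
    using psubD(2)[OF colon_psub[OF S xc]] S xc by (intro adjs_least colon_psub) auto
  have "set es \<subseteq> span m id K es"
  proof
    fix e assume e: "e \<in> set es"
    have "e \<in> carrier R" "e \<otimes> y \<in> K" using e es(1) unfolding colon_def by auto
    then have e': "e \<in> carrier R" "y \<otimes> e \<in> K" using y(1) m_comm[of e y] by auto
    then have "e \<in> adj K x" using nzdD[OF y(2)] adj_ge[OF K xc] by auto
    then obtain i r where i: "i \<in> K" "r \<in> carrier R" "e = i \<oplus> r \<otimes> x" by (rule in_adjE)
    have ic: "i \<in> carrier R" using psubD(1)[OF K i(1)] .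
    have "x \<otimes> (y \<otimes> r) \<oplus> y \<otimes> i = y \<otimes> e" unfolding i(3) using i(2) ic y xc by (simp add: r_distr m_ac a_comm)
    then have "x \<otimes> (y \<otimes> r) \<in> K"
      using psub_cancel[OF endo_id K, of "x \<otimes> (y \<otimes> r)" "y \<otimes> i"] e' psub_idD(1)[OF K y(1) i(1)] i y xc by simp
    then have "y \<otimes> r \<in> K" using nzdD[OF x(2)] i y by simp
    then have "r \<in> colon K y" using i y by (simp add: colon_def m_comm)
    then have "r \<otimes> x \<in> S" using sub unfolding colon_def by blast
    then show "e \<in> span m id K es" using i KS psubD(3)[OF S] unfolding S_def by auto
  qed
  then have "set es \<subseteq> K" using nakayama[OF pp endo_id K ec] by blast
  then have "colon K y \<subseteq> K" unfolding es(2) using K psubD(2) by (intro adjs_least) auto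
  then show ?thesis using y unfolding nzd_def colon_def by (auto simp: m_comm)
qed

lemma reg_rotate:
  assumes pp: "prime_pair {\<one>} m" and x: "x \<in> m"
  shows "psub id K \<Longrightarrow> set ys \<subseteq> carrier R \<Longrightarrow> reg K (x # ys) \<Longrightarrow> reg K (ys @ [x])"
proof (induction ys arbitrary: K)
  case (Cons y ys)
  have xc: "x \<in> carrier R" using psubD(1)[OF prime_pairD(2)[OF pp] x] .
  have K: "psub id K" by (rule Cons.prems(1))
  have r: "nzd K x" "nzd (adj K x) y" "reg (adj (adj K x) y) ys" "y \<in> carrier R" "set ys \<subseteq> carrier R" using Cons.prems by auto
  have "nzd K y" using nzd_swap_local[OF pp K x r(1,4,2)] .
  moreover have "nzd (adj K y) x" using nzd_swap[OF K xc r(4,1,2)] .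
  moreover have "reg (adj (adj K y) x) ys" using r adj_commute[OF K xc r(4)] by simp
  ultimately show ?case using Cons.IH[OF adj_psub[OF K r(4)] r(5)] by simp
qed auto

text \<open>\<open>tlen_adj_pow\<close> changes only the last element of a sequence. So each element
  is rotated to the end by \<open>reg_rotate\<close>, replaced there by its power, and left at the
  back while the next one is treated.\<close>

lemma reg_powers:
  assumes pp: "prime_pair {\<one>} m" and K: "psub id K" and \<psi>: "endo \<psi>" and zs: "set zs \<subseteq> m" "reg K zs"
  shows "reg K (map (\<lambda>z. z [^] (a::nat)) zs)"
    and "tlen {\<one>} \<psi> (adjs K (map (\<lambda>z. z [^] a) zs)) (carrier R) = enat (a ^ length zs) * tlen {\<one>} \<psi> (adjs K zs) (carrier R)"
proof -
  note m = prime_pairD(2)[OF pp]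
  \<comment> \<open>\<open>xs\<close> holds the elements still to be raised; \<open>ys\<close> is an
    arbitrary regular remainder, which during the induction collects the powers already
    formed.\<close>
  have "set xs \<subseteq> m \<Longrightarrow> set ys \<subseteq> carrier R \<Longrightarrow> reg K (xs @ ys) \<Longrightarrow>
     reg K (ys @ map (\<lambda>z. z [^] a) xs) \<and>
     tlen {\<one>} \<psi> (adjs K (ys @ map (\<lambda>z. z [^] a) xs)) (carrier R) = enat (a ^ length xs) * tlen {\<one>} \<psi> (adjs K (xs @ ys)) (carrier R)" for xs ys
  proof (induction xs arbitrary: ys)
    case Nil
    then show ?case by (simp add: one_enat_def[unfolded One_nat_def, symmetric])
  next
    case (Cons x xs)
    have x: "x \<in> m" "x \<in> carrier R" and xs: "set xs \<subseteq> m" "set xs \<subseteq> carrier R" using Cons.prems psubD(5)[OF m] by auto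
    have ys: "set ys \<subseteq> carrier R" using Cons.prems by simp
    have xy: "set (xs @ ys) \<subseteq> carrier R" using xs ys by simp
    define L where "L = adjs K (xs @ ys)"
    have L: "psub id L" unfolding L_def using K xy by simp
    have "reg K ((xs @ ys) @ [x])" using reg_rotate[OF pp x(1) K xy] Cons.prems by simp
    then have r: "reg K (xs @ ys)" "nzd L x" unfolding L_def by (simp_all only: reg_append reg.simps)
    then have "nzd L (x [^] a)" using nzd_pow L x by blast
    then have r': "reg K (xs @ (ys @ [x [^] a]))" using r unfolding L_def
      by (simp add: reg_append adjs_append)
    have "reg K ((ys @ [x [^] a]) @ map (\<lambda>z. z [^] a) xs) \<and>
      tlen {\<one>} \<psi> (adjs K ((ys @ [x [^] a]) @ map (\<lambda>z. z [^] a) xs)) (carrier R) = enat (a ^ length xs) * tlen {\<one>} \<psi> (adjs K (xs @ (ys @ [x [^] a]))) (carrier R)"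
      by (rule Cons.IH) (use xs ys x r' in auto)
    moreover have "adjs K (xs @ (ys @ [x [^] a])) = adj L (x [^] a)" unfolding L_def by (simp add: adjs_append)
    moreover have "adjs K ((x # xs) @ ys) = adjs K ((xs @ ys) @ [x])" using xy x K by (intro adjs_cong_set) auto
    moreover have "adjs K ((xs @ ys) @ [x]) = adj L x" unfolding L_def by (simp add: adjs_append)
    ultimately show ?case using tlen_adj_pow[OF \<psi> L x(2) r(2), of a] by (simp add: mult.assoc[symmetric] mult.commute)
  qed
  from this[of zs "[]"] show "reg K (map (\<lambda>z. z [^] a) zs)"
    "tlen {\<one>} \<psi> (adjs K (map (\<lambda>z. z [^] a) zs)) (carrier R) = enat (a ^ length zs) * tlen {\<one>} \<psi> (adjs K zs) (carrier R)"
    using zs by auto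
qed

text \<open>The ideals \<open>adj J (a [^] k)\<close> decrease with k and would give arbitrarily
  long chains unless \<open>a [^] k\<close> equals an element of \<open>J\<close> plus
  \<open>r \<otimes> a [^] Suc k\<close> for some k. Then
  \<open>\<one> \<ominus> r \<otimes> a\<close> is a unit and drops out.\<close>

lemma pow_mem_of_finite_length:
  assumes pp: "prime_pair {\<one>} m" and J: "psub id J" and fin: "tlen {\<one>} id J (carrier R) \<noteq> \<infinity>" and a: "a \<in> m"
  obtains n where "a [^] (n::nat) \<in> J"
proof -
  note m = prime_pairD(2)[OF pp]
  have ac: "a \<in> carrier R" using psubD(1)[OF m a] .
  define A where "A k = adj J (a [^] (k::nat))" for k
  have A: "psub id (A k)" "J \<subseteq> A k" "a [^] k \<in> A k" for k
    unfolding A_def using J ac adj_ge adj_self by auto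
  have dec: "A (Suc k) \<subseteq> A k" for k unfolding A_def[of "Suc k"]
    using A[of k] psub_idD(2)[OF A(1) ac A(3)] by (intro adj_least) auto
  have "\<exists>k. a [^] k \<in> A (Suc k)"
  proof (rule ccontr)
    assume "\<not> ?thesis"
    then have st: "A (Suc k) \<subset> A k" for k using dec[of k] A(3)[of k] by blast
    have "enat n \<le> tlen {\<one>} id J (carrier R)" for n
    proof (rule clen_upper, rule chain_inI)
      fix i assume "i < n"
      then have "n - i = Suc (n - Suc i)" by simp
      then show "A (n - i) \<subset> A (n - Suc i)" using st by simp
    qed (use A psubD(5)[OF A(1)] in \<open>auto simp: tsub_one\<close>)
    then show False using fin by (metis enat_ord_simps(1) not_enat_eq not_less_eq_eq order_refl)
  qed
  then obtain k j r where k: "j \<in> J" "r \<in> carrier R" "a [^] k = j \<oplus> r \<otimes> a [^] Suc k" unfolding A_def by (auto elim: in_adjE)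
  have jc: "j \<in> carrier R" using psubD(1)[OF J k(1)] .
  have e: "id \<one> \<otimes> a [^] k = j \<oplus> id (r \<otimes> a) \<otimes> a [^] k"
    using k jc ac by (simp add: m_assoc m_comm[of a])
  have mem: "id (\<one> \<ominus> r \<otimes> a) \<otimes> a [^] k \<in> J"
    by (rule psub_lin[OF endo_id J _ _ _ k(1) e]) (use k(2) ac in auto)
  have nm: "\<one> \<ominus> r \<otimes> a \<notin> m"
  proof
    assume "\<one> \<ominus> r \<otimes> a \<in> m"
    then have "\<one> \<in> m" using psub_cancel[OF endo_id m, of \<one> "\<ominus> (r \<otimes> a)"] psub_uminus[OF endo_id m psub_idD(1)[OF m k(2) a]]
      by (simp add: minus_eq)
    then show False using prime_pairD(3)[OF pp] by blast
  qed
  have "tsub {\<one>} id J" using J by (simp add: tsub_one)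
  from prime_pair_mem[OF pp endo_id this _ nm _ mem] have "a [^] k \<in> J" using k(2) ac by simp
  then show ?thesis using that by blast
qed

text \<open>Noetherian induction: let \<open>K\<close> be maximal among the ideals above
  \<open>I\<close> of infinite colength. A prime \<open>colon K u\<close> contains \<open>I\<close>,
  so it is \<open>m\<close>, and \<open>adj K u\<close> exceeds \<open>K\<close> by a simple factor.
  Its colength is finite by maximality, so that of \<open>K\<close> is finite as well.\<close>

lemma finite_length_of_primary:
  assumes pp: "prime_pair {\<one>} m" and I: "psub id I" and pr: "\<And>P. primeI P \<Longrightarrow> I \<subseteq> P \<Longrightarrow> P = m"
  shows "tlen {\<one>} id I (carrier R) \<noteq> \<infinity>"
proof
  assume inf: "tlen {\<one>} id I (carrier R) = \<infinity>"
  define F where "F = {K. psub id K \<and> I \<subseteq> K \<and> tlen {\<one>} id K (carrier R) = \<infinity>}"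
  have "\<exists>M\<in>F. \<forall>U\<in>F. M \<subseteq> U \<longrightarrow> U = M" by (rule ideal_family_maximal) (use I inf in \<open>auto simp: F_def\<close>)
  then obtain K where K: "K \<in> F" "\<And>U. U \<in> F \<Longrightarrow> K \<subseteq> U \<Longrightarrow> U = K" by blast
  have pK: "psub id K" "I \<subseteq> K" "tlen {\<one>} id K (carrier R) = \<infinity>" using K unfolding F_def by auto
  obtain Ps where Ps: "finite Ps" "\<And>P. P \<in> Ps \<Longrightarrow> primeI P \<and> (\<exists>u\<in>carrier R - K. P = colon K u)"
     "\<And>z. z \<in> carrier R \<Longrightarrow> \<forall>P\<in>Ps. z \<notin> P \<Longrightarrow> nzd K z" using associated_primes[OF pK(1)] by metis
  have "Ps \<noteq> {}"
  proof
    assume "Ps = {}"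
    then have "nzd K \<zero>" using Ps(3) by simp
    then have "\<one> \<in> K" using nzdD[of K \<zero> \<one>] psubD(2)[OF pK(1)] by simp
    then have "carrier R \<subseteq> K" using psub_idD(2)[OF pK(1), of _ \<one>] by auto
    then have "K = carrier R" using psubD(5)[OF pK(1)] by auto
    then show False using pK(3) by (simp add: clen_same)
  qed
  then obtain u where u: "u \<in> carrier R" "u \<notin> K" "primeI (colon K u)" using Ps(2) by blast
  have "K \<subseteq> colon K u" using psub_idD(2)[OF pK(1) u(1)] psubD(1)[OF pK(1)] by (auto simp: colon_def)
  then have cm: "colon K u = m" using pr[OF u(3)] pK by auto
  have tK: "tsub {\<one>} id K" using pK by (simp add: tsub_one)
  have "tlen {\<one>} id K (sat {\<one>} id (ext (carrier R) id K u)) \<le> 1"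
    by (rule simple_step_le[OF pp endo_id tK u(1)]) (use cm in \<open>auto simp: colon_def\<close>)
  then have 1: "tlen {\<one>} id K (adj K u) \<le> 1"
    using sat_one[OF endo_id, of "adj K u"] psubD(5)[OF adj_psub[OF pK(1) u(1)]] unfolding adj_def by simp
  have "adj K u \<notin> F" using K(2)[of "adj K u"] adj_ge[OF pK(1) u(1)] adj_self[OF pK(1) u(1)] u by auto
  then have 2: "tlen {\<one>} id (adj K u) (carrier R) \<noteq> \<infinity>"
    using pK adj_psub[OF pK(1) u(1)] adj_ge[OF pK(1) u(1)] unfolding F_def by auto
  have "tlen {\<one>} id K (carrier R) = tlen {\<one>} id K (adj K u) + tlen {\<one>} id (adj K u) (carrier R)"
    by (rule tlen_add)
       (use adj_psub[OF pK(1) u(1)] adj_ge[OF pK(1) u(1)] psubD(5)[OF adj_psub[OF pK(1) u(1)]] in \<open>auto simp: tsub_one\<close>)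
  then show False using pK(3) 1 2 by (cases "tlen {\<one>} id K (adj K u)"; cases "tlen {\<one>} id (adj K u) (carrier R)") (auto simp: one_enat_def)
qed

lemma prime_disjoint:
  assumes I: "psub id I" and S: "mset S" and d: "S \<inter> I = {}"
  obtains P where "primeI P" "I \<subseteq> P" "S \<inter> P = {}"
proof -
  define F where "F = {K. psub id K \<and> I \<subseteq> K \<and> S \<inter> K = {}}"
  have "\<exists>M\<in>F. \<forall>U\<in>F. M \<subseteq> U \<longrightarrow> U = M" by (rule ideal_family_maximal) (use I d in \<open>auto simp: F_def\<close>)
  then obtain P where P: "P \<in> F" "\<And>U. U \<in> F \<Longrightarrow> P \<subseteq> U \<Longrightarrow> U = P" by blast
  have pP: "psub id P" "I \<subseteq> P" "S \<inter> P = {}" using P unfolding F_def by auto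
  have meet: "\<exists>p\<in>P. \<exists>r\<in>carrier R. p \<oplus> r \<otimes> a \<in> S" if a: "a \<in> carrier R" "a \<notin> P" for a
  proof -
    have "adj P a \<notin> F" using P(2)[of "adj P a"] adj_ge[OF pP(1) a(1)] adj_self[OF pP(1) a(1)] a by auto
    then have "S \<inter> adj P a \<noteq> {}" using pP adj_psub[OF pP(1) a(1)] adj_ge[OF pP(1) a(1)] unfolding F_def by auto
    then show ?thesis by (auto elim!: in_adjE)
  qed
  have "primeI P" unfolding primeI_def
  proof (intro conjI ballI impI)
    show "P \<noteq> carrier R" using pP(3) msetD(2)[OF S] by auto
    fix a b assume ab: "a \<in> carrier R" "b \<in> carrier R" "a \<otimes> b \<in> P"
    show "a \<in> P \<or> b \<in> P"
    proof (rule ccontr)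
      assume "\<not> ?thesis"
      then obtain p r q s where *: "p \<in> P" "r \<in> carrier R" "p \<oplus> r \<otimes> a \<in> S" "q \<in> P" "s \<in> carrier R" "q \<oplus> s \<otimes> b \<in> S"
        using meet ab by meson
      have c: "p \<in> carrier R" "q \<in> carrier R" using * psubD(1)[OF pP(1)] by auto
      have "(p \<oplus> r \<otimes> a) \<otimes> (q \<oplus> s \<otimes> b) = p \<otimes> (q \<oplus> s \<otimes> b) \<oplus> ((r \<otimes> a) \<otimes> q \<oplus> (r \<otimes> s) \<otimes> (a \<otimes> b))"
        using * c ab by (simp add: l_distr r_distr m_ac a_ac)
      also have "\<dots> \<in> P"
        by (intro psubD(3)[OF pP(1)] psub_idD(2)[OF pP(1) _ *(1)] psub_idD(1)[OF pP(1) _ *(4)] psub_idD(1)[OF pP(1) _ ab(3)])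
          (use * c ab in auto)
      finally show False using msetD(3)[OF S *(3,6)] pP(3) by blast
    qed
  qed fact
  then show ?thesis using that pP by blast
qed

text \<open>The products of powers of \<open>x\<close> with elements outside \<open>P\<close> form a
  multiplicative set that misses \<open>I\<close>, as powers of \<open>x\<close> cancel modulo
  \<open>I\<close> and \<open>I \<subseteq> P\<close>. A prime above \<open>I\<close> disjoint from
  it lies in \<open>P\<close> and omits \<open>x\<close>.\<close>

lemma prime_below:
  assumes I: "psub id I" and x: "x \<in> carrier R" "nzd I x" and P: "primeI P" "adj I x \<subseteq> P"
  obtains Q where "primeI Q" "I \<subseteq> Q" "Q \<subset> P"
proof -
  define S where "S = {x [^] (n::nat) \<otimes> s | n s. s \<in> carrier R - P}"
  have pP: "psub id P" "\<one> \<notin> P"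
  proof -
    show "psub id P" using P unfolding primeI_def by auto
    then show "\<one> \<notin> P" using P psub_idD(2)[of P _ \<one>] psubD(5)[of id P] unfolding primeI_def by fastforce
  qed
  have S1: "x [^] (n::nat) \<otimes> s \<in> S" if "s \<in> carrier R" "s \<notin> P" for n s using that unfolding S_def by blast
  have "mset S" unfolding mset_def
  proof (intro conjI ballI)
    show "S \<subseteq> carrier R" using x unfolding S_def by auto
    show "\<one> \<in> S" using S1[of \<one> 0] pP by simp
    fix u v assume "u \<in> S" "v \<in> S"
    then obtain n s k t where *: "u = x [^] (n::nat) \<otimes> s" "v = x [^] (k::nat) \<otimes> t" "s \<in> carrier R" "t \<in> carrier R" "s \<notin> P" "t \<notin> P"
      unfolding S_def by auto
    have "s \<otimes> t \<notin> P" using * P unfolding primeI_def by blast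
    then have "x [^] (n + k) \<otimes> (s \<otimes> t) \<in> S" using S1 * by simp
    then show "u \<otimes> v \<in> S" using * x by (simp add: nat_pow_mult[symmetric] m_ac)
  qed
  moreover have "S \<inter> I = {}"
  proof -
    have "s \<in> P" if "s \<in> carrier R" "x [^] (n::nat) \<otimes> s \<in> I" for n s
      using nzdD[OF nzd_pow[OF I x] that] adj_ge[OF I x(1)] P by auto
    then show ?thesis unfolding S_def by auto
  qed
  ultimately obtain Q where Q: "primeI Q" "I \<subseteq> Q" "S \<inter> Q = {}" using prime_disjoint[OF I] by blast
  have qc: "Q \<subseteq> carrier R" using Q psubD(5) unfolding primeI_def by blast
  have "Q \<subseteq> P"
  proof
    fix s assume "s \<in> Q"
    then show "s \<in> P" using S1[of s 0] Q(3) qc by auto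
  qed
  moreover have "x \<notin> Q" using S1[of \<one> 1] pP Q(3) x by auto
  moreover have "x \<in> P" using adj_self[OF I x(1)] P by auto
  ultimately show ?thesis using that Q by blast
qed

lemma reg_prime_chain:
  "psub id I \<Longrightarrow> set xs \<subseteq> carrier R \<Longrightarrow> reg I xs \<Longrightarrow> primeI P \<Longrightarrow> adjs I xs \<subseteq> P \<Longrightarrow>
    \<exists>Q. Q (length xs) = P \<and> I \<subseteq> Q 0 \<and> (\<forall>i\<le>length xs. primeI (Q i)) \<and> (\<forall>i<length xs. Q i \<subset> Q (Suc i))"
proof (induction xs arbitrary: I)
  case Nil
  then show ?case by (intro exI[of _ "\<lambda>_. P"]) auto
next
  case (Cons x xs)
  have I: "psub id I" by (rule Cons.prems(1))
  have x: "x \<in> carrier R" "set xs \<subseteq> carrier R" "nzd I x" "reg (adj I x) xs" "adjs (adj I x) xs \<subseteq> P" using Cons.prems by auto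
  obtain Q where Q: "Q (length xs) = P" "adj I x \<subseteq> Q 0" "\<forall>i\<le>length xs. primeI (Q i)" "\<forall>i<length xs. Q i \<subset> Q (Suc i)"
    using Cons.IH[OF adj_psub[OF I x(1)] x(2,4) Cons.prems(4) x(5)] by blast
  obtain Q0 where Q0: "primeI Q0" "I \<subseteq> Q0" "Q0 \<subset> Q 0" using prime_below[OF I x(1,3)] Q by blast
  show ?case
    by (rule exI[of _ "case_nat Q0 Q"]) (use Q Q0 in \<open>auto split: nat.split simp: less_Suc_eq_0_disj\<close>)
qed

text \<open>\<open>reg_prime_chain\<close> places a chain with \<open>length xs\<close> steps below
  \<open>P\<close>. If \<open>P\<close> were smaller than \<open>M\<close>, appending
  \<open>M\<close> would give a chain longer than the dimension.\<close>

lemma reg_krull_dim_primary: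
  assumes "set xs \<subseteq> carrier R" "reg {\<zero>} xs" "krull_dim R = enat (length xs)"
    and P: "primeI P" "adjs {\<zero>} xs \<subseteq> P" and M: "primeI M" "P \<subseteq> M"
  shows "P = M"
proof (rule ccontr)
  assume "P \<noteq> M"
  obtain Q where Q: "Q (length xs) = P" "\<forall>i\<le>length xs. primeI (Q i)" "\<forall>i<length xs. Q i \<subset> Q (Suc i)"
    using reg_prime_chain[OF psub_zero[OF endo_id] assms(1,2) P] by blast
  define Q' where "Q' i = (if i \<le> length xs then Q i else M)" for i
  have "\<forall>i\<le>Suc (length xs). primeideal (Q' i) R" using Q M unfolding Q'_def by (auto simp: primeI_iff[symmetric])
  moreover have "\<forall>i<Suc (length xs). Q' i \<subset> Q' (Suc i)"
    using Q M \<open>P \<noteq> M\<close> unfolding Q'_def by (auto simp: less_Suc_eq)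
  ultimately have "enat (Suc (length xs)) \<le> krull_dim R"
    unfolding krull_dim_def by (intro Sup_upper) blast
  then show False using assms(3) by simp
qed

end

section \<open>Length, rank and degree as chain lengths\<close>

context cring
begin

lemma coset_zero_iff: "psub id I \<Longrightarrow> x \<in> carrier R \<Longrightarrow> I +> x = I \<longleftrightarrow> x \<in> I"
proof -
  assume I: "psub id I" and x: "x \<in> carrier R"
  interpret ideal I R using I psub_id_iff_ideal by simp
  show ?thesis using a_rcos_const a_rcos_self[OF x] by blast
qed

lemma coset_add: "psub id I \<Longrightarrow> x \<in> carrier R \<Longrightarrow> y \<in> carrier R \<Longrightarrow> set_add R (I +> x) (I +> y) = I +> (x \<oplus> y)"
proof -
  assume I: "psub id I" and x: "x \<in> carrier R" "y \<in> carrier R"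
  interpret ideal I R using I psub_id_iff_ideal by simp
  show ?thesis using a_rcos_sum x by blast
qed

lemma coset_self: "psub id I \<Longrightarrow> x \<in> carrier R \<Longrightarrow> x \<in> I +> x"
proof -
  assume I: "psub id I" and x: "x \<in> carrier R"
  interpret ideal I R using I psub_id_iff_ideal by simp
  show ?thesis using a_rcos_self[OF x] by blast
qed

lemma in_coset_iff: "z \<in> I +> x \<longleftrightarrow> (\<exists>i\<in>I. z = i \<oplus> x)"
  unfolding a_r_coset_def' by auto

lemma rcosets_image: "a_rcosets I = (\<lambda>x. I +> x) ` carrier R"
  unfolding A_RCOSETS_def RCOSETS_def a_r_coset_def by auto

lemma smult_coset:
  assumes I: "psub id I" and \<phi>: "endo \<phi>" "\<phi> ` I \<subseteq> I" and c: "a \<in> carrier R" "x \<in> carrier R"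
  shows "set_add R I {\<phi> b \<otimes> z | b z. b \<in> I +> a \<and> z \<in> I +> x} = I +> (\<phi> a \<otimes> x)"
proof (intro equalityI subsetI)
  note Ic = psubD(1)[OF I]
  fix w assume "w \<in> set_add R I {\<phi> b \<otimes> z | b z. b \<in> I +> a \<and> z \<in> I +> x}"
  then obtain i j k where *: "i \<in> I" "j \<in> I" "k \<in> I" "w = i \<oplus> \<phi> (j \<oplus> a) \<otimes> (k \<oplus> x)"
    unfolding set_add_def' by (auto simp: in_coset_iff)
  have ic: "i \<in> carrier R" "j \<in> carrier R" "k \<in> carrier R" using * Ic by auto
  have "w = (i \<oplus> \<phi> j \<otimes> (k \<oplus> x) \<oplus> \<phi> a \<otimes> k) \<oplus> \<phi> a \<otimes> x"
    using * ic c \<phi> by (simp add: l_distr r_distr a_ac)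
  moreover have "i \<oplus> \<phi> j \<otimes> (k \<oplus> x) \<oplus> \<phi> a \<otimes> k \<in> I"
    using * ic c \<phi> by (intro psubD(3)[OF I] psub_idD(1)[OF I] psub_idD(2)[OF I]) auto
  ultimately show "w \<in> I +> (\<phi> a \<otimes> x)" unfolding in_coset_iff by blast
next
  fix w assume "w \<in> I +> (\<phi> a \<otimes> x)"
  then obtain i where "i \<in> I" "w = i \<oplus> \<phi> a \<otimes> x" unfolding in_coset_iff by blast
  then show "w \<in> set_add R I {\<phi> b \<otimes> z | b z. b \<in> I +> a \<and> z \<in> I +> x}"
    unfolding set_add_def' using coset_self[OF I] c by blast
qed

lemma smult_coset_ring:
  assumes I: "psub id I" and c: "a \<in> carrier R" "x \<in> carrier R"
  shows "set_add R I ((\<lambda>z. a \<otimes> z) ` (I +> x)) = I +> (a \<otimes> x)"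
proof (intro equalityI subsetI)
  note Ic = psubD(1)[OF I]
  fix w assume "w \<in> set_add R I ((\<lambda>z. a \<otimes> z) ` (I +> x))"
  then obtain i k where *: "i \<in> I" "k \<in> I" "w = i \<oplus> a \<otimes> (k \<oplus> x)"
    unfolding set_add_def' by (auto simp: in_coset_iff)
  have ic: "i \<in> carrier R" "k \<in> carrier R" using * Ic by auto
  have "w = (i \<oplus> a \<otimes> k) \<oplus> a \<otimes> x" using * ic c by (simp add: r_distr a_assoc)
  moreover have "i \<oplus> a \<otimes> k \<in> I" using * c by (intro psubD(3)[OF I] psub_idD(1)[OF I]) auto
  ultimately show "w \<in> I +> (a \<otimes> x)" unfolding in_coset_iff by blast
next
  fix w assume "w \<in> I +> (a \<otimes> x)"
  then obtain i where "i \<in> I" "w = i \<oplus> a \<otimes> x" unfolding in_coset_iff by blast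
  then show "w \<in> set_add R I ((\<lambda>z. a \<otimes> z) ` (I +> x))"
    unfolding set_add_def' using coset_self[OF I] c by blast
qed

lemma module_length_quot:
  assumes I: "psub id I"
  shows "module_length R (quot_module R I) = tlen {\<one>} id I (carrier R)"
proof (rule antisym)
  let ?M = "quot_module R I"
  interpret I: ideal I R using I psub_id_iff_ideal by simp
  interpret Q: ring "R Quot I" by (rule I.quotient_is_ring)
  \<comment> \<open>The quotient module has the same addition as \<open>R Quot I\<close>, from which
    the group laws are borrowed. The maps \<open>up\<close> and \<open>dn\<close> below are the two
    directions of the correspondence theorem.\<close>
  have am: "subgroup H (add_monoid ?M) \<longleftrightarrow> subgroup H (add_monoid (R Quot I))" for H
    by (simp add: subgroup_def m_inv_def quot_module_def FactRing_def)
  have sm: "submodule H R ?M \<longleftrightarrow> subgroup H (add_monoid (R Quot I)) \<and> (\<forall>a\<in>carrier R. \<forall>x\<in>H. set_add R I ((\<lambda>z. a \<otimes> z) ` x) \<in> H)" for H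
    unfolding submodule_def submodule_axioms_def am by (auto simp: quot_module_def)
  have carQ: "carrier (R Quot I) = (\<lambda>x. I +> x) ` carrier R" unfolding FactRing_def rcosets_image[symmetric] by simp
  have addQ: "add (R Quot I) = set_add R" "\<zero>\<^bsub>R Quot I\<^esub> = I" unfolding FactRing_def by auto
  define up where "up H = {x \<in> carrier R. I +> x \<in> H}" for H
  define dn where "dn J = (\<lambda>x. I +> x) ` J" for J
  have up: "psub id (up H) \<and> I \<subseteq> up H" if H: "submodule H R ?M" for H
  proof -
    have H': "subgroup H (add_monoid (R Quot I))" "\<And>a x. a \<in> carrier R \<Longrightarrow> x \<in> H \<Longrightarrow> set_add R I ((\<lambda>z. a \<otimes> z) ` x) \<in> H"
      using H sm by auto
    have IH: "I \<in> H" using subgroup.one_closed[OF H'(1)] addQ by simp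
    have g: "set_add R x y \<in> H" if "x \<in> H" "y \<in> H" for x y using subgroup.m_closed[OF H'(1) that] addQ by simp
    have "psub id (up H)" unfolding psub_def
    proof (intro conjI ballI)
      show "\<zero> \<in> up H" using IH coset_zero_iff[OF I, of \<zero>] psubD(2)[OF I] unfolding up_def by simp
      show "x \<oplus> y \<in> up H" if "x \<in> up H" "y \<in> up H" for x y
        using that g[of "I +> x" "I +> y"] coset_add[OF I] unfolding up_def by auto
      show "id a \<otimes> x \<in> up H" if "a \<in> carrier R" "x \<in> up H" for a x
        using that H'(2)[of a "I +> x"] smult_coset_ring[OF I] unfolding up_def by auto
    qed (auto simp: up_def)
    moreover have "x \<in> up H" if "x \<in> I" for x
      using IH coset_zero_iff[OF I psubD(1)[OF I that]] psubD(1)[OF I that] that unfolding up_def by simp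
    ultimately show ?thesis by blast
  qed
  have dn: "submodule (dn J) R ?M" if J: "psub id J" for J
    unfolding sm
  proof (intro conjI ballI)
    show "subgroup (dn J) (add_monoid (R Quot I))"
    proof (rule group.subgroupI)
      show "group (add_monoid (R Quot I))" using Q.add.is_group .
      show "dn J \<subseteq> carrier (add_monoid (R Quot I))" using carQ psubD(1)[OF J] unfolding dn_def by auto
      show "dn J \<noteq> {}" using psubD(2)[OF J] unfolding dn_def by auto
      show "x \<otimes>\<^bsub>add_monoid (R Quot I)\<^esub> y \<in> dn J" if "x \<in> dn J" "y \<in> dn J" for x y
        using that coset_add[OF I] psubD(1,3)[OF J] addQ unfolding dn_def by auto
      show "inv\<^bsub>add_monoid (R Quot I)\<^esub> x \<in> dn J" if "x \<in> dn J" for x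
      proof -
        obtain j where j: "j \<in> J" "x = I +> j" using \<open>x \<in> dn J\<close> unfolding dn_def by auto
        have jc: "j \<in> carrier R" using psubD(1)[OF J j(1)] .
        have "(I +> (\<ominus> j)) \<oplus>\<^bsub>R Quot I\<^esub> x = \<zero>\<^bsub>R Quot I\<^esub>"
          using coset_add[OF I, of "\<ominus> j" j] jc j coset_zero_iff[OF I, of \<zero>] psubD(2)[OF I] addQ by (simp add: l_neg)
        then have "\<ominus>\<^bsub>R Quot I\<^esub> x = I +> (\<ominus> j)" using jc j carQ by (intro Q.minus_equality) auto
        then show ?thesis using psub_uminus[OF endo_id J j(1)] unfolding dn_def a_inv_def by auto
      qed
    qed
    show "set_add R I ((\<lambda>z. a \<otimes> z) ` x) \<in> dn J" if "a \<in> carrier R" "x \<in> dn J" for a x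
      using that smult_coset_ring[OF I] psubD(1)[OF J] psub_idD(1)[OF J] unfolding dn_def by auto
  qed
  show "module_length R ?M \<le> tlen {\<one>} id I (carrier R)"
    unfolding module_length_def
  proof (rule Sup_least)
    fix k assume "k \<in> {enat n |n. \<exists>N. (\<forall>i\<le>n. submodule (N i) R ?M) \<and> (\<forall>i<n. N i \<subset> N (Suc i))}"
    then obtain n N where N: "k = enat n" "\<And>i. i \<le> n \<Longrightarrow> submodule (N i) R ?M" "\<And>i. i < n \<Longrightarrow> N i \<subset> N (Suc i)" by auto
    have "enat n \<le> tlen {\<one>} id I (carrier R)"
    proof (rule clen_upper, rule chain_inI)
      fix i assume i: "i < n"
      then obtain q where q: "q \<in> N (Suc i)" "q \<notin> N i" using N(3) by blast
      have "q \<in> carrier (R Quot I)"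
        using q N(2)[of "Suc i"] i sm subgroup.subset[of "N (Suc i)" "add_monoid (R Quot I)"] by auto
      then obtain x where "x \<in> carrier R" "q = I +> x" using carQ by auto
      then have "x \<in> up (N (Suc i))" "x \<notin> up (N i)" using q unfolding up_def by auto
      then show "up (N i) \<subset> up (N (Suc i))" using N(3)[OF i] unfolding up_def by blast
    qed (use N(2) up in \<open>auto simp: tsub_one up_def\<close>)
    then show "k \<le> tlen {\<one>} id I (carrier R)" using N by simp
  qed
  show "tlen {\<one>} id I (carrier R) \<le> module_length R ?M"
  proof (rule clen_least)
    fix n N assume c: "chain_in (Collect (tsub {\<one>} id)) I (carrier R) n N"
    have p: "psub id (N i)" if "i \<le> n" for i using chain_inD(1)[OF c that] by (simp add: tsub_one)
    have "dn (N i) \<subset> dn (N (Suc i))" if i: "i < n" for i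
    proof -
      obtain x where x: "x \<in> N (Suc i)" "x \<notin> N i" using chain_inD(4)[OF c i] by blast
      have xc: "x \<in> carrier R" using psubD(1)[OF p x(1)] i by simp
      have "I +> x \<notin> dn (N i)"
      proof
        assume "I +> x \<in> dn (N i)"
        then obtain y where y: "y \<in> N i" "x \<in> I +> y" using coset_self[OF I xc] unfolding dn_def by auto
        then obtain k where "k \<in> I" "x = k \<oplus> y" unfolding in_coset_iff by auto
        then have "x \<in> N i" using chain_inD(2)[OF c, of i] psubD(3)[OF p[of i]] y i by auto
        then show False using x by simp
      qed
      then show ?thesis using x chain_inD(4)[OF c i] unfolding dn_def by blast
    qed
    then show "enat n \<le> module_length R ?M"
      unfolding module_length_def using dn p
      by (intro Sup_upper CollectI exI[of _ n] exI[of _ "\<lambda>i. dn (N i)"] conjI) auto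
  qed
qed

text \<open>A triangular form of independence: each element is tested only against the span of those
  behind it in the list. This is the shape produced by a chain of submodules, where elements are
  added one by one.\<close>

primrec indep_mod :: "('a \<Rightarrow> 'a) \<Rightarrow> 'a set \<Rightarrow> 'a set \<Rightarrow> 'a list \<Rightarrow> bool" where
  "indep_mod \<psi> Y P [] \<longleftrightarrow> True"
| "indep_mod \<psi> Y P (e # es) \<longleftrightarrow> indep_mod \<psi> Y P es \<and> (\<forall>a\<in>carrier R. \<psi> a \<otimes> e \<in> span (carrier R) \<psi> Y es \<longrightarrow> a \<in> P)"

text \<open>Choosing a new element at each strict step of a chain gives an independent list, since a
  relation with coefficient outside \<open>P\<close> could be divided out. Conversely the saturated
  spans of the tails of an independent list increase strictly: a denominator in \<open>T\<close>
  cannot lie in \<open>P\<close>.\<close>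

lemma tlen_eq_indep:
  assumes pp: "prime_pair T P" and \<psi>: "endo \<psi>" and Y: "tsub T \<psi> Y"
  shows "tlen T \<psi> Y (carrier R) = Sup {enat (length es) | es. set es \<subseteq> carrier R \<and> indep_mod \<psi> Y P es}"
proof (rule antisym)
  note mT = prime_pairD(1)[OF pp] and pY = tsubD(1)[OF Y]
  show "tlen T \<psi> Y (carrier R) \<le> Sup {enat (length es) | es. set es \<subseteq> carrier R \<and> indep_mod \<psi> Y P es}"
  proof (rule clen_least)
    fix n N assume c: "chain_in (Collect (tsub T \<psi>)) Y (carrier R) n N"
    have "k \<le> n \<Longrightarrow> \<exists>es. length es = k \<and> set es \<subseteq> N k \<and> indep_mod \<psi> Y P es" for k
    proof (induction k)
      case 0
      then show ?case by (intro exI[of _ "[]"]) auto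
    next
      case (Suc k)
      then obtain es where es: "length es = k" "set es \<subseteq> N k" "indep_mod \<psi> Y P es" by auto
      have k: "tsub T \<psi> (N k)" "Y \<subseteq> N k" "N k \<subset> N (Suc k)" "N (Suc k) \<subseteq> carrier R"
        using chain_inD[OF c, of k] chain_inD(3)[OF c, of "Suc k"] Suc.prems by auto
      obtain e where e: "e \<in> N (Suc k)" "e \<notin> N k" using k by blast
      have "a \<in> P" if a: "a \<in> carrier R" "\<psi> a \<otimes> e \<in> span (carrier R) \<psi> Y es" for a
      proof (rule ccontr)
        assume "a \<notin> P"
        have "span (carrier R) \<psi> Y es \<subseteq> N k" using es k tsubD(1)[OF k(1)] by (intro span_least) auto
        then have "e \<in> N k" using prime_pair_mem[OF pp \<psi> k(1) a(1) \<open>a \<notin> P\<close>, of e] a e k by auto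
        then show False using e by simp
      qed
      then show ?case using es e k by (intro exI[of _ "e # es"]) auto
    qed
    from this[of n] obtain es where "length es = n" "set es \<subseteq> N n" "indep_mod \<psi> Y P es" by auto
    then show "enat n \<le> Sup {enat (length es) | es. set es \<subseteq> carrier R \<and> indep_mod \<psi> Y P es}"
      using chain_inD(3)[OF c, of n] by (intro Sup_upper) blast
  qed
  show "Sup {enat (length es) | es. set es \<subseteq> carrier R \<and> indep_mod \<psi> Y P es} \<le> tlen T \<psi> Y (carrier R)"
  proof (rule Sup_least)
    fix k assume "k \<in> {enat (length es) | es. set es \<subseteq> carrier R \<and> indep_mod \<psi> Y P es}"
    then obtain es where es: "k = enat (length es)" "set es \<subseteq> carrier R" "indep_mod \<psi> Y P es" by auto
    have "enat (length es) \<le> tlen T \<psi> Y (sat T \<psi> (span (carrier R) \<psi> Y es))"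
      using es(2,3)
    proof (induction es)
      case Nil
      then show ?case by (simp add: zero_enat_def[symmetric])
    next
      case (Cons e es)
      define S where "S = span (carrier R) \<psi> Y es"
      have ec: "e \<in> carrier R" "set es \<subseteq> carrier R" using Cons.prems by auto
      have S: "psub \<psi> S" unfolding S_def using \<psi> pY ec by (intro span_psub1) auto
      have S': "psub \<psi> (ext (carrier R) \<psi> S e)" using \<psi> S ec by (intro ext_psub1) auto
      have g: "S \<subseteq> ext (carrier R) \<psi> S e" "e \<in> ext (carrier R) \<psi> S e" 
        using ext_ge[OF \<psi> psubD(5)[OF S] zero_closed ec(1)] ext_self[OF \<psi> psubD(2)[OF S] one_closed ec(1)] by auto
      have YS: "Y \<subseteq> S" unfolding S_def using \<psi> psubD(5)[OF pY] ec by (intro span_ge) auto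
      have "e \<notin> sat T \<psi> S"
      proof
        assume "e \<in> sat T \<psi> S"
        then obtain t where t: "t \<in> T" "\<psi> t \<otimes> e \<in> S" unfolding sat_def by auto
        then have "t \<in> P" using Cons.prems msetD(1)[OF mT] unfolding S_def by auto
        then show False using prime_pairD(3)[OF pp t(1)] by simp
      qed
      moreover have "e \<in> sat T \<psi> (ext (carrier R) \<psi> S e)" using g sat_ge[OF mT \<psi> psubD(5)[OF S']] by blast
      ultimately have "sat T \<psi> S \<subset> sat T \<psi> (ext (carrier R) \<psi> S e)" using sat_mono[OF g(1), of T \<psi>] by blast
      moreover have "Y \<subseteq> sat T \<psi> S" using YS sat_ge[OF mT \<psi> psubD(5)[OF S]] by blast
      ultimately have "tlen T \<psi> Y (sat T \<psi> S) + 1 \<le> tlen T \<psi> Y (sat T \<psi> (ext (carrier R) \<psi> S e))"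
        using sat_tsub[OF mT \<psi>] S S' by (intro clen_snoc) auto
      moreover have "enat (length es) \<le> tlen T \<psi> Y (sat T \<psi> S)" using Cons unfolding S_def by auto
      moreover have "enat (length (e # es)) = enat (length es) + 1" by (simp add: one_enat_def)
      ultimately show ?case unfolding S_def by (metis add_right_mono order_trans span.simps(2))
    qed
    also have "\<dots> \<le> tlen T \<psi> Y (carrier R)" by (intro clen_mono) (auto simp: sat_def)
    finally show "k \<le> tlen T \<psi> Y (carrier R)" using es by simp
  qed
qed

end

text \<open>A module \<open>M\<close> over \<open>K\<close> presented as \<open>R/Y\<close> over \<open>R/P\<close>, with \<open>R\<close> acting on \<open>R/Y\<close> through \<open>\<psi>\<close>.\<close>
locale presented_module = cring R + M: abelian_monoid M
  for R :: "('a, 'b) ring_scheme" (structure) and M :: "('k, 'c, 'e) module_scheme"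
    and K :: "('k, 'l) ring_scheme" and \<pi> :: "'a \<Rightarrow> 'c" and \<kappa> :: "'a \<Rightarrow> 'k"
    and \<psi> :: "'a \<Rightarrow> 'a" and Y P :: "'a set" +
  assumes endo_\<psi>: "endo \<psi>" and psub_Y: "psub \<psi> Y"
    and carrier_M: "carrier M = \<pi> ` carrier R" and carrier_K: "carrier K = \<kappa> ` carrier R"
    and \<pi>_add: "x \<in> carrier R \<Longrightarrow> y \<in> carrier R \<Longrightarrow> \<pi> (x \<oplus> y) = \<pi> x \<oplus>\<^bsub>M\<^esub> \<pi> y"
    and \<pi>_zero_iff: "x \<in> carrier R \<Longrightarrow> \<pi> x = \<zero>\<^bsub>M\<^esub> \<longleftrightarrow> x \<in> Y"
    and \<kappa>_zero_iff: "a \<in> carrier R \<Longrightarrow> \<kappa> a = \<zero>\<^bsub>K\<^esub> \<longleftrightarrow> a \<in> P"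
    and \<pi>_smult: "a \<in> carrier R \<Longrightarrow> x \<in> carrier R \<Longrightarrow> \<kappa> a \<odot>\<^bsub>M\<^esub> \<pi> x = \<pi> (\<psi> a \<otimes> x)"
begin

definition lincomb :: "('c \<Rightarrow> 'k) \<Rightarrow> 'c set \<Rightarrow> 'c" where
  "lincomb c S = finsum M (\<lambda>s. c s \<odot>\<^bsub>M\<^esub> s) S"

lemma \<pi>_closed [simp]: "x \<in> carrier R \<Longrightarrow> \<pi> x \<in> carrier M"
  using carrier_M by auto

lemma \<kappa>_closed [simp]: "x \<in> carrier R \<Longrightarrow> \<kappa> x \<in> carrier K"
  using carrier_K by auto

lemma smult_M_closed: "k \<in> carrier K \<Longrightarrow> s \<in> carrier M \<Longrightarrow> k \<odot>\<^bsub>M\<^esub> s \<in> carrier M"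
  using carrier_K carrier_M \<pi>_smult endo_\<psi> by auto

lemma \<pi>_zero: "\<pi> \<zero> = \<zero>\<^bsub>M\<^esub>"
  using \<pi>_zero_iff[of \<zero>] psubD(2)[OF psub_Y] by simp

lemma lincomb_insert:
  assumes "finite S" "S \<subseteq> carrier M" "s \<in> carrier M" "s \<notin> S" "c \<in> insert s S \<rightarrow> carrier K"
  shows "lincomb c (insert s S) = c s \<odot>\<^bsub>M\<^esub> s \<oplus>\<^bsub>M\<^esub> lincomb c S"
  unfolding lincomb_def using assms smult_M_closed by (intro M.finsum_insert) (auto simp: Pi_iff subset_iff)

lemma lincomb_cong:
  assumes "S \<subseteq> carrier M" "c \<in> S \<rightarrow> carrier K" "\<And>s. s \<in> S \<Longrightarrow> c' s = c s"
  shows "lincomb c' S = lincomb c S"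
  unfolding lincomb_def using assms smult_M_closed by (intro M.finsum_cong') (auto simp: Pi_iff subset_iff)

text \<open>Coefficients belong to list positions in \<open>span\<close> and to elements of a set in
  \<open>lincomb\<close>; distinctness of the images makes the passage possible.\<close>

lemma lincomb_of_span:
  assumes "set es \<subseteq> carrier R" "distinct (map \<pi> es)" "x \<in> span (carrier R) \<psi> {\<zero>} es"
  shows "\<exists>c \<in> set (map \<pi> es) \<rightarrow> carrier K. lincomb c (set (map \<pi> es)) = \<pi> x"
  using assms
proof (induction es arbitrary: x)
  case Nil
  then show ?case using \<pi>_zero by (auto simp: lincomb_def)
next
  case (Cons e es)
  obtain y a where y: "y \<in> span (carrier R) \<psi> {\<zero>} es" "a \<in> carrier R" "x = y \<oplus> \<psi> a \<otimes> e"
    using Cons.prems by (auto elim!: in_extE)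
  have ec: "e \<in> carrier R" "set es \<subseteq> carrier R" using Cons.prems by auto
  have yc: "y \<in> carrier R" using y span_carrier[OF endo_\<psi>, of "{\<zero>}" "carrier R" es] ec by auto
  obtain c where c: "c \<in> set (map \<pi> es) \<rightarrow> carrier K" "lincomb c (set (map \<pi> es)) = \<pi> y"
    using Cons.IH[OF ec(2) _ y(1)] Cons.prems by auto
  have ne: "\<pi> e \<notin> set (map \<pi> es)" using Cons.prems by auto
  let ?S = "set (map \<pi> es)"
  let ?c = "c(\<pi> e := \<kappa> a)"
  have S: "?S \<subseteq> carrier M" using ec by auto
  have cc: "?c \<in> insert (\<pi> e) ?S \<rightarrow> carrier K" using c y by auto
  have "lincomb ?c (insert (\<pi> e) ?S) = ?c (\<pi> e) \<odot>\<^bsub>M\<^esub> \<pi> e \<oplus>\<^bsub>M\<^esub> lincomb ?c ?S"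
    using ne S ec cc by (intro lincomb_insert) auto
  also have "lincomb ?c ?S = lincomb c ?S" by (rule lincomb_cong[OF S c(1)]) (metis fun_upd_other ne)
  also have "?c (\<pi> e) \<odot>\<^bsub>M\<^esub> \<pi> e \<oplus>\<^bsub>M\<^esub> lincomb c ?S = \<pi> x"
    unfolding c(2) y(3) using \<pi>_smult \<pi>_add y yc ec endo_\<psi> M.a_comm by simp
  finally have "lincomb ?c (insert (\<pi> e) ?S) = \<pi> x" .
  then show ?case using cc by (intro bexI[of _ ?c]) (simp_all del: fun_upd_apply)
qed

lemma span_of_lincomb:
  assumes "set es \<subseteq> carrier R" "distinct (map \<pi> es)" "c \<in> set (map \<pi> es) \<rightarrow> carrier K"
  shows "\<exists>x \<in> span (carrier R) \<psi> {\<zero>} es. lincomb c (set (map \<pi> es)) = \<pi> x"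
  using assms
proof (induction es)
  case Nil
  then show ?case using \<pi>_zero by (auto simp: lincomb_def)
next
  case (Cons e es)
  have ec: "e \<in> carrier R" "set es \<subseteq> carrier R" using Cons.prems by auto
  let ?S = "set (map \<pi> es)"
  obtain y where y: "y \<in> span (carrier R) \<psi> {\<zero>} es" "lincomb c ?S = \<pi> y" using Cons by auto
  have yc: "y \<in> carrier R" using y span_carrier[OF endo_\<psi>, of "{\<zero>}" "carrier R" es] ec by auto
  obtain a where a: "a \<in> carrier R" "c (\<pi> e) = \<kappa> a" using Cons.prems carrier_K by auto
  have "lincomb c (insert (\<pi> e) ?S) = c (\<pi> e) \<odot>\<^bsub>M\<^esub> \<pi> e \<oplus>\<^bsub>M\<^esub> lincomb c ?S"
    using Cons.prems ec by (intro lincomb_insert) auto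
  also have "\<dots> = \<pi> (y \<oplus> \<psi> a \<otimes> e)"
    unfolding y(2) a(2) using \<pi>_smult \<pi>_add a yc ec endo_\<psi> M.a_comm by simp
  finally show ?case using in_extI[OF y(1) a(1), of \<psi> e] by auto
qed

lemma span_Y_iff:
  assumes "set es \<subseteq> carrier R"
  shows "x \<in> span (carrier R) \<psi> Y es \<longleftrightarrow> (\<exists>y\<in>Y. \<exists>z\<in>span (carrier R) \<psi> {\<zero>} es. x = y \<oplus> z)"
  using assms
proof (induction es arbitrary: x)
  case Nil
  then show ?case using psubD(1)[OF psub_Y] by auto
next
  case (Cons e es)
  have ec: "e \<in> carrier R" "set es \<subseteq> carrier R" using Cons.prems by auto
  have zc: "z \<in> carrier R" if "z \<in> span (carrier R) \<psi> {\<zero>} es" for z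
    using that span_carrier[OF endo_\<psi>, of "{\<zero>}" "carrier R" es] ec by auto
  have ass: "(y \<oplus> z) \<oplus> \<psi> a \<otimes> e = y \<oplus> (z \<oplus> \<psi> a \<otimes> e)" if "y \<in> Y" "z \<in> span (carrier R) \<psi> {\<zero>} es" "a \<in> carrier R" for y z a
    using that zc psubD(1)[OF psub_Y] ec endo_\<psi> by (simp add: a_assoc)
  show ?case
  proof
    assume "x \<in> span (carrier R) \<psi> Y (e # es)"
    then obtain w a where w: "w \<in> span (carrier R) \<psi> Y es" "a \<in> carrier R" "x = w \<oplus> \<psi> a \<otimes> e" by (auto elim!: in_extE)
    then obtain y z where "y \<in> Y" "z \<in> span (carrier R) \<psi> {\<zero>} es" "w = y \<oplus> z" using Cons.IH[OF ec(2)] by blast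
    then show "\<exists>y\<in>Y. \<exists>z\<in>span (carrier R) \<psi> {\<zero>} (e # es). x = y \<oplus> z"
      using w ass in_extI[of z _ a "carrier R" \<psi> e]
      by (intro bexI[of _ y] bexI[of _ "z \<oplus> \<psi> a \<otimes> e"]) auto
  next
    assume "\<exists>y\<in>Y. \<exists>z\<in>span (carrier R) \<psi> {\<zero>} (e # es). x = y \<oplus> z"
    then obtain y z a where *: "y \<in> Y" "z \<in> span (carrier R) \<psi> {\<zero>} es" "a \<in> carrier R" "x = y \<oplus> (z \<oplus> \<psi> a \<otimes> e)"
      by (auto elim!: in_extE)
    then have "y \<oplus> z \<in> span (carrier R) \<psi> Y es" using Cons.IH[OF ec(2)] by blast
    then show "x \<in> span (carrier R) \<psi> Y (e # es)"
      using in_extI[of "y \<oplus> z" _ a "carrier R" \<psi> e] * ass by auto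
  qed
qed

text \<open>In a vanishing combination, triangularity puts the coefficient of the head into
  \<open>P\<close>, so it is zero in \<open>K\<close>; the rest is the induction hypothesis.\<close>

lemma lin_indep_of_indep_mod:
  assumes pp: "prime_pair T P"
  shows "set es \<subseteq> carrier R \<Longrightarrow> indep_mod \<psi> Y P es \<Longrightarrow> distinct (map \<pi> es) \<and> lin_indep K M (set (map \<pi> es))"
proof (induction es)
  case Nil
  then show ?case by (auto simp: lin_indep_def)
next
  case (Cons e es)
  have ec: "e \<in> carrier R" "set es \<subseteq> carrier R" using Cons.prems by auto
  have IH: "distinct (map \<pi> es)" "lin_indep K M (set (map \<pi> es))" and
    ind: "\<And>a. a \<in> carrier R \<Longrightarrow> \<psi> a \<otimes> e \<in> span (carrier R) \<psi> Y es \<Longrightarrow> a \<in> P" using Cons by auto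
  let ?S = "set (map \<pi> es)"
  have spn: "psub \<psi> (span (carrier R) \<psi> Y es)" using endo_\<psi> psub_Y ec by (intro span_psub1) auto
  have z0: "psub \<psi> (span (carrier R) \<psi> {\<zero>} es)" using endo_\<psi> ec by (intro span_psub1) auto
  have one: "\<one> \<notin> P" using prime_pairD(3)[OF pp msetD(2)[OF prime_pairD(1)[OF pp]]] .
  have sub0: "span (carrier R) \<psi> {\<zero>} es \<subseteq> span (carrier R) \<psi> Y es" 
    using psubD(2)[OF psub_Y] by (intro span_mono) auto
  \<comment> \<open>Linear independence is a property of sets, so repetitions must be excluded: if
    \<open>e\<close> agreed with some \<open>f\<close> modulo \<open>Y\<close>, the coefficient
    \<open>\<one>\<close> would lie in \<open>P\<close>.\<close>
  have ne: "\<pi> e \<notin> ?S"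
  proof
    assume "\<pi> e \<in> ?S"
    then obtain f where f: "f \<in> set es" "\<pi> e = \<pi> f" by auto
    have fc: "f \<in> carrier R" using f ec by auto
    have "\<pi> (e \<oplus> \<ominus> f) = \<pi> (f \<oplus> \<ominus> f)" using \<pi>_add f fc ec by simp
    then have "e \<oplus> \<ominus> f \<in> Y" using \<pi>_zero_iff \<pi>_zero ec fc by (simp add: r_neg)
    then have "e \<oplus> \<ominus> f \<in> span (carrier R) \<psi> Y es"
      using span_ge[OF endo_\<psi> psubD(5)[OF psub_Y] zero_closed subset_refl ec(2)] by auto
    moreover have fs: "f \<in> span (carrier R) \<psi> Y es"
      using span_set[OF endo_\<psi> psubD(5)[OF psub_Y] psubD(2)[OF psub_Y] zero_closed one_closed subset_refl ec(2)] f by auto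
    ultimately have "e \<in> span (carrier R) \<psi> Y es"
      using psub_cancel[OF endo_\<psi> spn, of e "\<ominus> f"] psub_uminus[OF endo_\<psi> spn fs] ec by blast
    then have "\<one> \<in> P" using ind[of \<one>] ec endo_\<psi> by simp
    then show False using one by simp
  qed
  have "lin_indep K M (insert (\<pi> e) ?S)" unfolding lin_indep_def lincomb_def[symmetric]
  proof (intro conjI allI impI ballI)
    show "insert (\<pi> e) ?S \<subseteq> carrier M" using ec by auto
    fix c s assume c: "c \<in> insert (\<pi> e) ?S \<rightarrow> carrier K" "lincomb c (insert (\<pi> e) ?S) = \<zero>\<^bsub>M\<^esub>" and s: "s \<in> insert (\<pi> e) ?S"
    have cS: "c \<in> ?S \<rightarrow> carrier K" using c by auto
    obtain a where a: "a \<in> carrier R" "c (\<pi> e) = \<kappa> a" using c carrier_K by auto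
    obtain x where x: "x \<in> span (carrier R) \<psi> {\<zero>} es" "lincomb c ?S = \<pi> x"
      using span_of_lincomb[OF ec(2) IH(1) cS] by blast
    have xc: "x \<in> carrier R" using psubD(1)[OF z0 x(1)] .
    have sp: "lincomb c (insert (\<pi> e) ?S) = c (\<pi> e) \<odot>\<^bsub>M\<^esub> \<pi> e \<oplus>\<^bsub>M\<^esub> lincomb c ?S"
      using ne ec c by (intro lincomb_insert) auto
    then have e: "\<pi> (\<psi> a \<otimes> e \<oplus> x) = \<zero>\<^bsub>M\<^esub>" using c(2) x a \<pi>_smult \<pi>_add xc ec endo_\<psi> by simp
    then have "\<psi> a \<otimes> e \<oplus> x \<in> Y" using \<pi>_zero_iff xc ec a endo_\<psi> by simp
    then have "\<psi> a \<otimes> e \<oplus> x \<in> span (carrier R) \<psi> Y es"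
      using span_ge[OF endo_\<psi> psubD(5)[OF psub_Y] zero_closed subset_refl ec(2)] by auto
    then have "\<psi> a \<otimes> e \<in> span (carrier R) \<psi> Y es"
      using psub_cancel[OF endo_\<psi> spn, of "\<psi> a \<otimes> e" x] sub0 x ec a endo_\<psi> by auto
    then have aP: "a \<in> P" using ind a by blast
    then have ca: "c (\<pi> e) = \<zero>\<^bsub>K\<^esub>" using \<kappa>_zero_iff a by simp
    have zP: "\<kappa> \<zero> = \<zero>\<^bsub>K\<^esub>" using \<kappa>_zero_iff[of \<zero>] psubD(2)[OF prime_pairD(2)[OF pp]] by simp
    then have "c (\<pi> e) \<odot>\<^bsub>M\<^esub> \<pi> e = \<zero>\<^bsub>M\<^esub>" using ca \<pi>_smult[of \<zero> e] ec \<pi>_zero endo_\<psi> by simp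
    then have "lincomb c ?S = \<zero>\<^bsub>M\<^esub>"
      using c(2) sp x xc by simp
    then have "\<forall>s\<in>?S. c s = \<zero>\<^bsub>K\<^esub>" using IH(2) cS unfolding lin_indep_def lincomb_def[symmetric] by blast
    then show "c s = \<zero>\<^bsub>K\<^esub>" using s ca by auto
  qed auto
  then show ?case using IH ne by auto
qed

text \<open>Both parts extend a combination over the tail to the whole set: with coefficient zero at
  the head to restrict independence, and with coefficient \<open>\<kappa> a\<close> to turn a
  relation for \<open>\<psi> a \<otimes> e\<close> into a vanishing combination.\<close>

lemma indep_mod_of_lin_indep:
  assumes pp: "prime_pair T P"
  shows "set es \<subseteq> carrier R \<Longrightarrow> distinct (map \<pi> es) \<Longrightarrow> lin_indep K M (set (map \<pi> es)) \<Longrightarrow> indep_mod \<psi> Y P es"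
proof (induction es)
  case (Cons e es)
  have ec: "e \<in> carrier R" "set es \<subseteq> carrier R" using Cons.prems by auto
  let ?S = "set (map \<pi> es)"
  have d: "distinct (map \<pi> es)" "\<pi> e \<notin> ?S" using Cons.prems by auto
  have S: "?S \<subseteq> carrier M" using ec by auto
  have zK: "\<kappa> \<zero> = \<zero>\<^bsub>K\<^esub>" "\<zero>\<^bsub>K\<^esub> \<in> carrier K" using \<kappa>_zero_iff[of \<zero>] psubD(2)[OF prime_pairD(2)[OF pp]] \<kappa>_closed[of \<zero>] by auto
  have li: "c s = \<zero>\<^bsub>K\<^esub>" if "c \<in> insert (\<pi> e) ?S \<rightarrow> carrier K" "lincomb c (insert (\<pi> e) ?S) = \<zero>\<^bsub>M\<^esub>" "s \<in> insert (\<pi> e) ?S" for c s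
  proof -
    have "lin_indep K M (insert (\<pi> e) ?S)" using Cons.prems(3) by simp
    then show ?thesis using that unfolding lin_indep_def lincomb_def[symmetric] by blast
  qed
  have ins: "lincomb (c(\<pi> e := k)) (insert (\<pi> e) ?S) = k \<odot>\<^bsub>M\<^esub> \<pi> e \<oplus>\<^bsub>M\<^esub> lincomb c ?S"
    if "c \<in> ?S \<rightarrow> carrier K" "k \<in> carrier K" for c k
  proof -
    have "lincomb (c(\<pi> e := k)) (insert (\<pi> e) ?S) = (c(\<pi> e := k)) (\<pi> e) \<odot>\<^bsub>M\<^esub> \<pi> e \<oplus>\<^bsub>M\<^esub> lincomb (c(\<pi> e := k)) ?S"
      using d S ec that by (intro lincomb_insert) auto
    also have "lincomb (c(\<pi> e := k)) ?S = lincomb c ?S" by (rule lincomb_cong[OF S that(1)]) (metis fun_upd_other d(2))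
    finally show ?thesis by (simp only: fun_upd_same)
  qed
  have "lin_indep K M ?S" unfolding lin_indep_def lincomb_def[symmetric]
  proof (intro conjI allI impI ballI)
    fix c s assume c: "c \<in> ?S \<rightarrow> carrier K" "lincomb c ?S = \<zero>\<^bsub>M\<^esub>" "s \<in> ?S"
    have "\<zero>\<^bsub>K\<^esub> \<odot>\<^bsub>M\<^esub> \<pi> e = \<zero>\<^bsub>M\<^esub>" using zK \<pi>_smult[of \<zero> e] ec \<pi>_zero endo_\<psi> by simp
    then have "lincomb (c(\<pi> e := \<zero>\<^bsub>K\<^esub>)) (insert (\<pi> e) ?S) = \<zero>\<^bsub>M\<^esub>" using ins[OF c(1) zK(2)] c(2) by simp
    moreover have "c(\<pi> e := \<zero>\<^bsub>K\<^esub>) \<in> insert (\<pi> e) ?S \<rightarrow> carrier K" using c(1) zK(2) by auto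
    ultimately have "(c(\<pi> e := \<zero>\<^bsub>K\<^esub>)) s = \<zero>\<^bsub>K\<^esub>" using li c(3) by blast
    then show "c s = \<zero>\<^bsub>K\<^esub>" using c(3) d(2) by (metis fun_upd_other)
  qed (use S in auto)
  then have "indep_mod \<psi> Y P es" using Cons.IH ec d by blast
  moreover have "a \<in> P" if a: "a \<in> carrier R" "\<psi> a \<otimes> e \<in> span (carrier R) \<psi> Y es" for a
  proof -
    obtain y z where y: "y \<in> Y" "z \<in> span (carrier R) \<psi> {\<zero>} es" "\<psi> a \<otimes> e = y \<oplus> z"
      using a span_Y_iff[OF ec(2)] by blast
    have c: "y \<in> carrier R" "z \<in> carrier R"
      using y psubD(1)[OF psub_Y] span_carrier[OF endo_\<psi>, of "{\<zero>}" "carrier R" es] ec by auto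
    have z0: "psub \<psi> (span (carrier R) \<psi> {\<zero>} es)" using endo_\<psi> ec by (intro span_psub1) auto
    obtain d where d: "d \<in> ?S \<rightarrow> carrier K" "lincomb d ?S = \<pi> (\<ominus> z)"
      using lincomb_of_span[OF ec(2) \<open>distinct (map \<pi> es)\<close> psub_uminus[OF endo_\<psi> z0 y(2)]] by blast
    have "\<psi> a \<otimes> e \<oplus> \<ominus> z = y" unfolding y(3) using c by (simp add: a_assoc r_neg)
    then have "\<pi> (\<psi> a \<otimes> e \<oplus> \<ominus> z) = \<zero>\<^bsub>M\<^esub>" using \<pi>_zero_iff c y(1) by simp
    then have "lincomb (d(\<pi> e := \<kappa> a)) (insert (\<pi> e) ?S) = \<zero>\<^bsub>M\<^esub>"
      using ins[OF d(1), of "\<kappa> a"] d(2) \<pi>_smult \<pi>_add a ec c endo_\<psi> by simp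
    moreover have "d(\<pi> e := \<kappa> a) \<in> insert (\<pi> e) ?S \<rightarrow> carrier K" using d(1) a by auto
    ultimately have "(d(\<pi> e := \<kappa> a)) (\<pi> e) = \<zero>\<^bsub>K\<^esub>" using li by blast
    then show ?thesis using \<kappa>_zero_iff a by simp
  qed
  ultimately show ?case by simp
qed auto

theorem module_rank_eq_tlen:
  assumes pp: "prime_pair T P" and Y: "tsub T \<psi> Y"
  shows "module_rank K M = tlen T \<psi> Y (carrier R)"
  unfolding tlen_eq_indep[OF pp endo_\<psi> Y] module_rank_def
proof (rule arg_cong[where f = Sup], intro equalityI subsetI)
  fix k assume "k \<in> {enat (card S) |S. lin_indep K M S}"
  then obtain S where S: "k = enat (card S)" "lin_indep K M S" by auto
  obtain ss where ss: "set ss = S" "distinct ss" using S(2) finite_distinct_list unfolding lin_indep_def by metis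
  have "\<forall>s\<in>S. \<exists>x\<in>carrier R. \<pi> x = s" using S(2) carrier_M unfolding lin_indep_def by fastforce
  then obtain r where r: "\<And>s. s \<in> S \<Longrightarrow> r s \<in> carrier R \<and> \<pi> (r s) = s" by metis
  have m: "map \<pi> (map r ss) = ss" using r ss by (auto intro!: map_idI)
  have rc: "set (map r ss) \<subseteq> carrier R" using r ss by auto
  have "indep_mod \<psi> Y P (map r ss)"
    by (rule indep_mod_of_lin_indep[OF pp rc]) (use m ss S in simp_all)
  then show "k \<in> {enat (length es) |es. set es \<subseteq> carrier R \<and> indep_mod \<psi> Y P es}"
    using rc S ss distinct_card[of ss] by (intro CollectI exI[of _ "map r ss"]) auto
next
  fix k assume "k \<in> {enat (length es) |es. set es \<subseteq> carrier R \<and> indep_mod \<psi> Y P es}"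
  then obtain es where es: "k = enat (length es)" "set es \<subseteq> carrier R" "indep_mod \<psi> Y P es" by auto
  from lin_indep_of_indep_mod[OF pp es(2,3)] show "k \<in> {enat (card S) |S. lin_indep K M S}"
    using es(1) distinct_card[of "map \<pi> es"] by (intro CollectI exI[of _ "set (map \<pi> es)"]) auto
qed

end

section \<open>The degrees in the statement as chain lengths\<close>

context cring
begin

lemma residue_degree_eq:
  assumes pp: "prime_pair {\<one>} m" and \<phi>: "endo \<phi>" "\<phi> ` m \<subseteq> m"
  shows "residue_degree R m \<phi> = tlen {\<one>} \<phi> m (carrier R)"
proof -
  note m = prime_pairD(2)[OF pp]
  interpret I: ideal m R using m psub_id_iff_ideal by simp
  interpret Q: ring "R Quot m" by (rule I.quotient_is_ring)
  have "abelian_monoid (residue_push R m \<phi>)"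
  proof -
    have c: "carrier (residue_push R m \<phi>) = carrier (R Quot m)" "add (residue_push R m \<phi>) = add (R Quot m)"
      "\<zero>\<^bsub>residue_push R m \<phi>\<^esub> = \<zero>\<^bsub>R Quot m\<^esub>" by (simp_all add: residue_push_def FactRing_def)
    show ?thesis by (rule abelian_monoidI; unfold c) (fact Q.a_closed Q.zero_closed Q.a_assoc Q.l_zero Q.a_comm)+
  qed
  then interpret abelian_monoid "residue_push R m \<phi>" .
  interpret presented_module R "residue_push R m \<phi>" "R Quot m" "\<lambda>x. m +> x" "\<lambda>x. m +> x" \<phi> m m
  proof
    show "endo \<phi>" by fact
    show "psub \<phi> m" using psub_of_id[OF \<phi>(1) m] .
  qed (use coset_add[OF m] coset_zero_iff[OF m] smult_coset[OF m \<phi>] in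
      \<open>auto simp: residue_push_def FactRing_def rcosets_image\<close>)
  have "tsub {\<one>} \<phi> m" using psub_of_id[OF \<phi>(1) m] \<phi> by (simp add: tsub_one)
  then show ?thesis unfolding residue_degree_def by (rule module_rank_eq_tlen[OF pp])
qed

end

lemma (in cring) presented_module_pushforward:
  assumes \<phi>: "endo \<phi>"
  shows "presented_module R (pushforward R \<phi>) R id id \<phi> {\<zero>} {\<zero>}"
proof -
  have "abelian_monoid (pushforward R \<phi>)"
    by (rule abelian_monoidI) (auto simp: pushforward_def a_ac)
  then interpret abelian_monoid "pushforward R \<phi>" .
  show ?thesis by standard (use \<phi> in \<open>auto simp: pushforward_def\<close>)
qed

lemma (in cring) fin_gen_pushforward:
  assumes \<phi>: "endo \<phi>" "fin_gen_module R (pushforward R \<phi>)"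
  obtains es where "set es \<subseteq> carrier R" "carrier R \<subseteq> span (carrier R) \<phi> {\<zero>} es"
proof -
  interpret presented_module R "pushforward R \<phi>" R id id \<phi> "{\<zero>}" "{\<zero>}"
    by (rule presented_module_pushforward[OF \<phi>(1)])
  obtain S where S: "finite S" "S \<subseteq> carrier R" "\<And>x. x \<in> carrier R \<Longrightarrow> \<exists>c \<in> S \<rightarrow> carrier R. x = lincomb c S"
    using \<phi>(2) unfolding fin_gen_module_def lincomb_def by (auto simp: pushforward_def)
  obtain es where es: "set es = S" "distinct es" using finite_distinct_list[OF S(1)] by blast
  have "x \<in> span (carrier R) \<phi> {\<zero>} es" if x: "x \<in> carrier R" for x
  proof -
    obtain c where c: "c \<in> S \<rightarrow> carrier R" "x = lincomb c S" using S(3)[OF x] by blast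
    then show ?thesis using span_of_lincomb[of es c] es S(2) by auto
  qed
  then show ?thesis using that[of es] es S(2) by blast
qed

context domain
begin

lemma prime_pair_nonzero: "prime_pair (carrier R - {\<zero>}) {\<zero>}"
proof -
  have "{t \<in> carrier R. id t \<noteq> \<zero>} = carrier R - {\<zero>}" "{t \<in> carrier R. id t = \<zero>} = {\<zero>}" by auto
  then show ?thesis using prime_pair_kernel[OF endo_id] by metis
qed

lemma map_degree_eq:
  assumes \<phi>: "endo \<phi>" "\<And>x. x \<in> carrier R \<Longrightarrow> \<phi> x = \<zero> \<Longrightarrow> x = \<zero>"
  shows "map_degree R \<phi> = tlen (carrier R - {\<zero>}) \<phi> {\<zero>} (carrier R)"
proof -
  interpret presented_module R "pushforward R \<phi>" R id id \<phi> "{\<zero>}" "{\<zero>}"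
    by (rule presented_module_pushforward[OF \<phi>(1)])
  have "tsub (carrier R - {\<zero>}) \<phi> {\<zero>}" using \<phi> unfolding tsub_def by (auto simp: integral_iff)
  then show ?thesis unfolding map_degree_def by (rule module_rank_eq_tlen[OF prime_pair_nonzero])
qed

end

section \<open>Finite local endomorphisms\<close>

context cring
begin

text \<open>The variant of \<open>span_least\<close> for coefficient sets without
  \<open>\<one>\<close>, such as \<open>m\<close>, where the generators themselves need not lie in
  \<open>U\<close>.\<close>

lemma span_least_coeff:
  assumes "psub \<psi> U" "Y \<subseteq> U" "\<And>a e. a \<in> C \<Longrightarrow> e \<in> set es \<Longrightarrow> \<psi> a \<otimes> e \<in> U"
  shows "span C \<psi> Y es \<subseteq> U"
  using assms(3)
proof (induction es)
  case (Cons e es)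
  then have "span C \<psi> Y es \<subseteq> U" by auto
  then show ?case using Cons.prems psubD(3)[OF assms(1)] by (auto elim!: in_extE)
qed (use assms in auto)

lemma psub_preimage: "endo \<psi> \<Longrightarrow> psub id J \<Longrightarrow> psub id {a \<in> carrier R. \<psi> a \<in> J}"
  unfolding psub_def by auto

lemma tlen_id_le: "endo \<psi> \<Longrightarrow> psub id J \<Longrightarrow> tlen {\<one>} id J (carrier R) \<le> tlen {\<one>} \<psi> J (carrier R)"
  by (rule clen_le_transfer[where f = "\<lambda>N. N"]) (auto simp: tsub_one psub_of_id simp del: id_apply)

lemma tlen_prime_one:
  assumes pp: "prime_pair T P" and P: "tsub T id P"
  shows "tlen T id P (carrier R) = 1"
proof (rule antisym)
  note mT = prime_pairD(1)[OF pp]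
  have pP: "psub id P" using tsubD(1)[OF P] .
  have one: "\<one> \<notin> P" using prime_pairD(3)[OF pp msetD(2)[OF mT]] .
  have "a \<in> ext (carrier R) id P \<one>" if "a \<in> carrier R" for a
    using ext_mem[of id P a "carrier R" \<one>] psubD(2)[OF pP] that by simp
  then have "carrier R \<subseteq> sat T id (ext (carrier R) id P \<one>)"
    using sat_ge[OF mT endo_id, of "ext (carrier R) id P \<one>"] psubD(5)[OF ext_psub1[OF endo_id pP, of "carrier R" \<one>]] by auto
  moreover have "tlen T id P (sat T id (ext (carrier R) id P \<one>)) \<le> 1"
    by (rule simple_step_le[OF pp endo_id P]) (use psubD(1)[OF pP] in auto)
  ultimately show "tlen T id P (carrier R) \<le> 1" by (rule clen_le_mono[rotated])
  have "tlen T id P P + 1 \<le> tlen T id P (carrier R)"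
    by (rule clen_snoc) (use P one psubD(5)[OF pP] in auto)
  then show "1 \<le> tlen T id P (carrier R)" by (simp add: clen_same)
qed

text \<open>An element outside the saturated span could be put in front of an independent list of
  maximal length. For \<open>T = {\<one>}\<close> the list spans modulo \<open>Y\<close>; for
  \<open>T\<close> the nonzero elements and \<open>Y = {\<zero>}\<close> it spans up to
  denominators.\<close>

lemma maximal_indep:
  assumes pp: "prime_pair T P" and \<psi>: "endo \<psi>" and Y: "tsub T \<psi> Y"
    and k: "tlen T \<psi> Y (carrier R) = enat k"
  obtains es where "length es = k" "set es \<subseteq> carrier R" "carrier R \<subseteq> sat T \<psi> (span (carrier R) \<psi> Y es)"
proof -
  note mT = prime_pairD(1)[OF pp]
  define S where "S = {enat (length es) | es. set es \<subseteq> carrier R \<and> indep_mod \<psi> Y P es}"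
  have SS: "Sup S = enat k" using k tlen_eq_indep[OF pp \<psi> Y] unfolding S_def by simp
  have "\<exists>es. length es \<ge> k \<and> set es \<subseteq> carrier R \<and> indep_mod \<psi> Y P es"
  proof (cases k)
    case 0
    then show ?thesis by (intro exI[of _ "[]"]) auto
  next
    case (Suc j)
    then have "enat j < Sup S" using SS by simp
    then obtain s where "s \<in> S" "enat j < s" unfolding less_Sup_iff by blast
    then obtain es where "j < length es" "set es \<subseteq> carrier R" "indep_mod \<psi> Y P es" unfolding S_def by auto
    then show ?thesis using Suc by (intro exI[of _ es]) auto
  qed
  then obtain es where es: "length es \<ge> k" "set es \<subseteq> carrier R" "indep_mod \<psi> Y P es" by blast
  have le: "length fs \<le> k" if "set fs \<subseteq> carrier R" "indep_mod \<psi> Y P fs" for fs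
  proof -
    have "enat (length fs) \<le> Sup S" unfolding S_def using that by (intro Sup_upper) blast
    then show ?thesis using SS by simp
  qed
  have "e \<in> sat T \<psi> (span (carrier R) \<psi> Y es)" if e: "e \<in> carrier R" for e
  proof (rule ccontr)
    assume n: "e \<notin> sat T \<psi> (span (carrier R) \<psi> Y es)"
    have p: "psub \<psi> (span (carrier R) \<psi> Y es)" using \<psi> tsubD(1)[OF Y] es by (intro span_psub1) auto
    have "a \<in> P" if a: "a \<in> carrier R" "\<psi> a \<otimes> e \<in> span (carrier R) \<psi> Y es" for a
    proof (rule ccontr)
      assume "a \<notin> P"
      then show False
        using prime_pair_mem[OF pp \<psi> sat_tsub[OF mT \<psi> p] a(1) _ e] sat_ge[OF mT \<psi> psubD(5)[OF p]] a n by blast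
    qed
    then have "indep_mod \<psi> Y P (e # es)" using es by simp
    then have "length (e # es) \<le> k" using e es by (intro le) auto
    then show False using es by simp
  qed
  moreover have "length es = k" using es le by (simp add: order_antisym)
  ultimately show ?thesis using that es by blast
qed

end

section \<open>The local endomorphism: injectivity, degree and residue degree\<close>

locale finite_local_endo = noetherian_domain R for R :: "('a, 'b) ring_scheme" (structure) +
  fixes m :: "'a set" and \<phi> :: "'a \<Rightarrow> 'a"
  assumes local: "local_ring R m" and fin: "finite_local_self_map R m \<phi>"
begin

lemma endo_phi [simp]: "endo \<phi>"
  using fin unfolding finite_local_self_map_def endo_def by auto

lemma phi_m: "\<phi> ` m \<subseteq> m"
  using fin unfolding finite_local_self_map_def by auto

lemma psub_m: "psub id m"
  using local unfolding local_ring_def maximalideal_def psub_id_iff_ideal by auto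

lemma m_ne: "m \<noteq> carrier R"
  using local maximalideal.I_notcarr unfolding local_ring_def by blast

lemma proper_sub_m:
  assumes I: "psub id I" "I \<noteq> carrier R" shows "I \<subseteq> m"
proof -
  define F where "F = {K. psub id K \<and> K \<noteq> carrier R \<and> I \<subseteq> K}"
  have "\<exists>M\<in>F. \<forall>U\<in>F. M \<subseteq> U \<longrightarrow> U = M" by (rule ideal_family_maximal) (use I in \<open>auto simp: F_def\<close>)
  then obtain M where M: "M \<in> F" "\<And>U. U \<in> F \<Longrightarrow> M \<subseteq> U \<Longrightarrow> U = M" by blast
  have "maximalideal M R"
  proof (rule maximalidealI)
    show "ideal M R" "carrier R \<noteq> M" using M unfolding F_def psub_id_iff_ideal by auto
    fix J assume "ideal J R" "M \<subseteq> J" "J \<subseteq> carrier R"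
    moreover have "J \<in> F" if "J \<noteq> carrier R"
      using that calculation M(1) unfolding F_def psub_id_iff_ideal by auto
    ultimately show "J = M \<or> J = carrier R" using M(2) by blast
  qed
  then have "M = m" using local unfolding local_ring_def by blast
  then show ?thesis using M unfolding F_def by auto
qed

lemma prime_pair_m: "prime_pair {\<one>} m"
proof -
  have one: "\<one> \<notin> m" using psub_idD(2)[OF psub_m, of _ \<one>] m_ne psubD(5)[OF psub_m] by auto
  have "\<exists>b\<in>carrier R. a \<otimes> b \<in> {\<one>}" if a: "a \<in> carrier R" "a \<notin> m" for a
  proof -
    have p: "psub id (adj {\<zero>} a)" using a by simp
    have "a \<in> adj {\<zero>} a" using adj_self[OF psub_zero[OF endo_id] a(1)] .
    then have "adj {\<zero>} a = carrier R" using proper_sub_m[OF p] a by blast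
    then have "\<one> \<in> adj {\<zero>} a" by simp
    then obtain k r where "k \<in> {\<zero>}" "r \<in> carrier R" "\<one> = k \<oplus> r \<otimes> a" by (rule in_adjE)
    then show ?thesis using a by (intro bexI[of _ r]) (auto simp: m_comm)
  qed
  then show ?thesis unfolding prime_pair_def using psub_m one by auto
qed

lemma primeI_m: "primeI m"
  unfolding primeI_def
proof (intro conjI ballI impI psub_m m_ne)
  fix a b assume ab: "a \<in> carrier R" "b \<in> carrier R" "a \<otimes> b \<in> m"
  have "tsub {\<one>} id m" using psub_m by (simp add: tsub_one)
  then show "a \<in> m \<or> b \<in> m" using prime_pair_mem[OF prime_pair_m endo_id, of m a b] ab by auto
qed

lemma gens_phi:
  obtains es where "set es \<subseteq> carrier R" "carrier R \<subseteq> span (carrier R) (\<phi> ^^ n) {\<zero>} es"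
proof -
  have "\<exists>es. set es \<subseteq> carrier R \<and> carrier R \<subseteq> span (carrier R) (\<phi> ^^ n) {\<zero>} es"
  proof (induction n)
    case 0
    have "a \<in> ext (carrier R) id {\<zero>} \<one>" if "a \<in> carrier R" for a
      using ext_mem[of id "{\<zero>}" a "carrier R" \<one>] that by simp
    then show ?case by (intro exI[of _ "[\<one>]"]) (auto simp: id_def)
  next
    case (Suc n)
    then obtain fs where fs: "set fs \<subseteq> carrier R" "carrier R \<subseteq> span (carrier R) (\<phi> ^^ n) {\<zero>} fs" by blast
    obtain es where es: "set es \<subseteq> carrier R" "carrier R \<subseteq> span (carrier R) \<phi> {\<zero>} es"
      using fin_gen_pushforward[OF endo_phi] fin unfolding finite_local_self_map_def by blast
    obtain gs where "set gs \<subseteq> carrier R" "span (carrier R) \<phi> {\<zero>} es \<subseteq> span (carrier R) (\<phi> \<circ> \<phi> ^^ n) {\<zero>} gs"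
      by (rule span_comp_gens[OF endo_phi endo_funpow[OF endo_phi] _ fs es(1)]) (auto intro!: psub_zero)
    then show ?case using es by (intro exI[of _ gs]) (auto simp: o_def)
  qed
  then show ?thesis using that by blast
qed

text \<open>On a domain a finite endomorphism is injective: with \<open>ker \<psi>\<^sup>2 = ker \<psi>\<close> for a power \<open>\<psi>\<close>,
  integrality of a nonzero \<open>x \<in> ker \<psi>\<close> over \<open>\<psi> R\<close> yields a nonzero element of \<open>\<psi> R \<inter> ker \<psi>\<close>.\<close>
lemma phi_inj:
  assumes "x \<in> carrier R" "\<phi> x = \<zero>" shows "x = \<zero>"
proof (rule ccontr)
  assume "x \<noteq> \<zero>"
  define ker where "ker n = {a \<in> carrier R. (\<phi> ^^ n) a = \<zero>}" for n
  have "\<exists>M\<in>range ker. \<forall>U\<in>range ker. M \<subseteq> U \<longrightarrow> U = M"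
  proof (rule ideal_family_maximal)
    fix I assume "I \<in> range ker"
    then obtain n where "I = {a \<in> carrier R. (\<phi> ^^ n) a \<in> {\<zero>}}" unfolding ker_def by auto
    then show "psub id I" using psub_preimage[OF endo_funpow[OF endo_phi] psub_zero[OF endo_id]] by simp
  qed auto
  then obtain N where N: "\<And>k. ker N \<subseteq> ker k \<Longrightarrow> ker k = ker N" by auto
  have inc: "ker n \<subseteq> ker (k + n)" for n k
    unfolding ker_def by (auto simp: funpow_add endo_simps(5)[OF endo_funpow[OF endo_phi]])
  have x: "x \<in> ker (Suc N)" using assms inc[of 1 N] unfolding ker_def by auto
  then have x: "x \<in> ker N" using N[of "Suc N"] inc[of N 1] by auto
  obtain es where es: "set es \<subseteq> carrier R" "carrier R \<subseteq> span (carrier R) (\<phi> ^^ N) {\<zero>} es" using gens_phi .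
  obtain t r where t: "t \<in> carrier R" "r \<in> carrier R" "(\<phi> ^^ N) t \<noteq> \<zero>" "(\<phi> ^^ N) t = x \<otimes> r"
    using integral_torsion[OF endo_funpow[OF endo_phi] es assms(1) \<open>x \<noteq> \<zero>\<close>] .
  \<comment> \<open>The element \<open>x\<close> is killed by \<open>\<phi> ^^ N\<close>, and so is
    its multiple \<open>(\<phi> ^^ N) t\<close>. Since the kernels are stationary from N on,
    \<open>(\<phi> ^^ N) t\<close> is itself zero, a contradiction.\<close>
  have "(\<phi> ^^ N) ((\<phi> ^^ N) t) = \<zero>"
    unfolding t(4) using x assms t endo_simps(2)[OF endo_funpow[OF endo_phi]] endo_simps(1)[OF endo_funpow[OF endo_phi]]
    unfolding ker_def by simp
  then have "t \<in> ker (N + N)" using t unfolding ker_def by (simp add: funpow_add)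
  then have "t \<in> ker N" using N[of "N + N"] inc[of N N] by auto
  then show False using t unfolding ker_def by simp
qed

lemma phin_inj: "x \<in> carrier R \<Longrightarrow> (\<phi> ^^ n) x = \<zero> \<Longrightarrow> x = \<zero>"
proof (induction n)
  case (Suc n)
  then have "\<phi> ((\<phi> ^^ n) x) = \<zero>" by simp
  then have "(\<phi> ^^ n) x = \<zero>"
    by (rule phi_inj[OF endo_simps(1)[OF endo_funpow[OF endo_phi] Suc.prems(1)]])
  then show ?case using Suc by blast
qed auto

text \<open>\<open>integral_torsion\<close> in the shape of the denominator condition of
  \<open>tlen_scale\<close>.\<close>

lemma torsion:
  assumes "x \<in> carrier R" "x \<noteq> \<zero>"
  shows "\<exists>t\<in>carrier R - {\<zero>}. \<exists>r\<in>carrier R. (\<phi> ^^ n) t = r \<otimes> x"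
proof -
  obtain es where es: "set es \<subseteq> carrier R" "carrier R \<subseteq> span (carrier R) (\<phi> ^^ n) {\<zero>} es" using gens_phi .
  obtain t r where t: "t \<in> carrier R" "r \<in> carrier R" "(\<phi> ^^ n) t \<noteq> \<zero>" "(\<phi> ^^ n) t = x \<otimes> r"
    using integral_torsion[OF endo_funpow[OF endo_phi] es assms] .
  then show ?thesis using assms by (intro bexI[of _ t] bexI[of _ r]) (auto simp: m_comm endo_simps(5)[OF endo_funpow[OF endo_phi]])
qed

abbreviation "T0 \<equiv> carrier R - {\<zero>}"

lemma tsub_zero: "endo \<psi> \<Longrightarrow> (\<And>x. x \<in> carrier R \<Longrightarrow> \<psi> x = \<zero> \<Longrightarrow> x = \<zero>) \<Longrightarrow> tsub T0 \<psi> {\<zero>}"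
  unfolding tsub_def by (auto simp: integral_iff)

lemma tsub_zero_phin: "tsub T0 (\<phi> ^^ n) {\<zero>}"
  using tsub_zero[OF endo_funpow[OF endo_phi]] phin_inj by blast

lemma rank_le_gens:
  assumes "set es \<subseteq> carrier R" "carrier R \<subseteq> span (carrier R) (\<phi> ^^ n) {\<zero>} es"
  shows "tlen T0 (\<phi> ^^ n) {\<zero>} (carrier R) \<le> enat (length es)"
proof -
  let ?p = "\<phi> ^^ n"
  note e = endo_funpow[OF endo_phi, of n]
  note mT = prime_pairD(1)[OF prime_pair_nonzero]
  have z: "sat T0 ?p {\<zero>} = {\<zero>}"
    using sat_least[OF tsub_zero_phin order_refl] sat_ge[OF mT e, of "{\<zero>}"] by auto
  have "tlen T0 ?p (sat T0 ?p {\<zero>}) (sat T0 ?p (span (carrier R) ?p {\<zero>} es)) \<le> enat (length es)"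
    by (rule tlen_span_le_length[OF prime_pair_nonzero e psub_zero[OF e] assms(1)])
      (use assms e in \<open>auto simp: endo_simps(5)[OF e] subset_iff\<close>)
  moreover have "carrier R \<subseteq> sat T0 ?p (span (carrier R) ?p {\<zero>} es)"
    using sat_ge[OF mT e, of "span (carrier R) ?p {\<zero>} es"] assms span_carrier[OF e, of "{\<zero>}" "carrier R" es] by auto
  ultimately show ?thesis unfolding z by (rule clen_le_mono)
qed

definition deg :: nat where "deg = the_enat (tlen T0 \<phi> {\<zero>} (carrier R))"

lemma deg_eq: "tlen T0 \<phi> {\<zero>} (carrier R) = enat deg"
proof -
  obtain es where es: "set es \<subseteq> carrier R" "carrier R \<subseteq> span (carrier R) (\<phi> ^^ 1) {\<zero>} es" using gens_phi .
  have "tlen T0 (\<phi> ^^ 1) {\<zero>} (carrier R) \<le> enat (length es)" using rank_le_gens[OF es] .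
  then show ?thesis unfolding deg_def by (cases "tlen T0 \<phi> {\<zero>} (carrier R)") auto
qed

lemma map_degree_deg: "map_degree R \<phi> = enat deg"
  using map_degree_eq[OF endo_phi phi_inj] deg_eq by simp

lemma deg_pos: "deg \<ge> 1"
proof -
  have ne: "{\<zero>} \<subset> carrier R" using one_closed one_not_zero zero_closed by blast
  have "tlen T0 \<phi> {\<zero>} {\<zero>} + 1 \<le> tlen T0 \<phi> {\<zero>} (carrier R)"
    by (rule clen_snoc) (use tsub_zero_phin[of 1] ne in auto)
  then show ?thesis using deg_eq by (simp add: clen_same one_enat_def)
qed

text \<open>Multiplicativity of ranks in a tower is \<open>tlen_scale\<close> with
  \<open>P = {\<zero>}\<close>: injectivity keeps the nonzero elements stable, and
  \<open>torsion\<close> makes denominators interchangeable.\<close>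

lemma rank_phin: "tlen T0 (\<phi> ^^ n) {\<zero>} (carrier R) = enat (deg ^ n)"
proof (induction n)
  case 0
  have "tsub T0 id {\<zero>}" using tsub_zero_phin[of 0] by simp
  then show ?case using tlen_prime_one[OF prime_pair_nonzero] by (simp add: one_enat_def id_def)
next
  case (Suc n)
  have T: "(\<phi> ^^ n) ` T0 \<subseteq> T0"
  proof (rule image_subsetI)
    fix x assume x: "x \<in> T0"
    then have "(\<phi> ^^ n) x \<noteq> \<zero>" using phin_inj[of x n] by blast
    then show "(\<phi> ^^ n) x \<in> T0" using endo_simps(1)[OF endo_funpow[OF endo_phi], of x n] x by simp
  qed
  have "tlen T0 (\<phi> \<circ> \<phi> ^^ n) {\<zero>} (carrier R) = enat deg * tlen T0 (\<phi> ^^ n) {\<zero>} (carrier R)"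
    by (rule tlen_scale[OF prime_pair_nonzero endo_phi endo_funpow[OF endo_phi] T])
      (use torsion tsub_zero_phin[of 1] deg_eq in auto)
  then show ?case using Suc by (simp add: o_def)
qed

definition resdeg :: nat where "resdeg = the_enat (tlen {\<one>} \<phi> m (carrier R))"

lemma tsub_m: "tsub {\<one>} \<phi> m"
  using psub_of_id[OF endo_phi psub_m] by (simp add: tsub_one)

lemma resdeg_eq: "tlen {\<one>} \<phi> m (carrier R) = enat resdeg"
proof -
  obtain es where es: "set es \<subseteq> carrier R" "carrier R \<subseteq> span (carrier R) (\<phi> ^^ 1) {\<zero>} es" using gens_phi .
  have "tlen {\<one>} \<phi> (sat {\<one>} \<phi> m) (sat {\<one>} \<phi> (span (carrier R) \<phi> m es)) \<le> enat (length es)"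
    by (rule tlen_span_le_length[OF prime_pair_m endo_phi psub_of_id[OF endo_phi psub_m] es(1)])
      (use psub_idD(2)[OF psub_m] phi_m es in blast)
  moreover have "sat {\<one>} \<phi> m = m" using sat_one[OF endo_phi psubD(5)[OF psub_m]] .
  moreover have "carrier R \<subseteq> sat {\<one>} \<phi> (span (carrier R) \<phi> m es)"
  proof -
    have "span (carrier R) \<phi> {\<zero>} es \<subseteq> span (carrier R) \<phi> m es" using psubD(2)[OF psub_m] by (intro span_mono) auto
    moreover have "span (carrier R) \<phi> m es \<subseteq> carrier R" using span_carrier[OF endo_phi psubD(5)[OF psub_m] _ es(1)] by blast
    ultimately show ?thesis using es sat_ge[OF mset_one endo_phi, of "span (carrier R) \<phi> m es"] by auto
  qed
  ultimately have "tlen {\<one>} \<phi> m (carrier R) \<le> enat (length es)"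
    using clen_le_mono[of _ m "sat {\<one>} \<phi> (span (carrier R) \<phi> m es)"] by simp
  then show ?thesis unfolding resdeg_def by (cases "tlen {\<one>} \<phi> m (carrier R)") auto
qed

lemma residue_degree_resdeg: "residue_degree R m \<phi> = enat resdeg"
  using residue_degree_eq[OF prime_pair_m endo_phi phi_m] resdeg_eq by simp

lemma resdeg_pos: "resdeg \<ge> 1"
proof -
  have "tlen {\<one>} \<phi> m m + 1 \<le> tlen {\<one>} \<phi> m (carrier R)"
    by (rule clen_snoc) (use tsub_m m_ne psubD(5)[OF psub_m] in auto)
  then show ?thesis using resdeg_eq by (simp add: clen_same one_enat_def)
qed

lemma resdeg_phin: "tlen {\<one>} (\<phi> ^^ n) m (carrier R) = enat (resdeg ^ n)"
proof (induction n)
  case 0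
  have "tsub {\<one>} id m" using psub_m by (simp add: tsub_one)
  then show ?case using tlen_prime_one[OF prime_pair_m] by (simp add: one_enat_def id_def)
next
  case (Suc n)
  have "tlen {\<one>} (\<phi> \<circ> \<phi> ^^ n) m (carrier R) = enat resdeg * tlen {\<one>} (\<phi> ^^ n) m (carrier R)"
    by (rule tlen_scale[OF prime_pair_m endo_phi endo_funpow[OF endo_phi]])
      (use tsub_m resdeg_eq psubD(5)[OF psub_m] endo_simps(4)[OF endo_funpow[OF endo_phi]] in auto)
  then show ?case using Suc by (simp add: o_def)
qed

section \<open>Generators through the iterates\<close>

definition Jn :: "nat \<Rightarrow> 'a set" where "Jn n = Idl ((\<phi> ^^ n) ` m)"

lemma phin_m: "(\<phi> ^^ n) ` m \<subseteq> m"
  by (induction n) (use phi_m in auto)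

lemma Jn: "psub id (Jn n)" "(\<phi> ^^ n) ` m \<subseteq> Jn n" "Jn n \<subseteq> m"
proof -
  have c: "(\<phi> ^^ n) ` m \<subseteq> carrier R" using phin_m psubD(5)[OF psub_m] by blast
  show "psub id (Jn n)" unfolding Jn_def psub_id_iff_ideal using genideal_ideal[OF c] .
  show "(\<phi> ^^ n) ` m \<subseteq> Jn n" unfolding Jn_def using genideal_self[OF c] .
  show "Jn n \<subseteq> m" unfolding Jn_def using genideal_minimal[OF _ phin_m] psub_m psub_id_iff_ideal by blast
qed

lemma Jn_least: "psub id U \<Longrightarrow> (\<phi> ^^ n) ` m \<subseteq> U \<Longrightarrow> Jn n \<subseteq> U"
  unfolding Jn_def psub_id_iff_ideal by (rule genideal_minimal)

text \<open>The number of generators is encoded as the length of R modulo \<open>Jn n\<close>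
  through \<open>\<phi> ^^ n\<close>. There \<open>m\<close> acts as zero, so this is a dimension
  over the residue field, and \<open>mu_gens\<close> lifts a basis to generators.\<close>

definition mu :: "nat \<Rightarrow> nat" where "mu n = the_enat (tlen {\<one>} (\<phi> ^^ n) (Jn n) (carrier R))"

definition lam :: "nat \<Rightarrow> nat" where "lam n = the_enat (lambda_len R m \<phi> n)"

lemma mu_eq: "tlen {\<one>} (\<phi> ^^ n) (Jn n) (carrier R) = enat (mu n)"
proof -
  let ?p = "\<phi> ^^ n"
  note e = endo_funpow[OF endo_phi, of n]
  obtain es where es: "set es \<subseteq> carrier R" "carrier R \<subseteq> span (carrier R) ?p {\<zero>} es" using gens_phi .
  have pJ: "psub ?p (Jn n)" using psub_of_id[OF e Jn(1)] .
  have "tlen {\<one>} ?p (sat {\<one>} ?p (Jn n)) (sat {\<one>} ?p (span (carrier R) ?p (Jn n) es)) \<le> enat (length es)"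
  proof (rule tlen_span_le_length[OF prime_pair_m e pJ es(1)])
    fix a x assume "a \<in> m" "x \<in> set es"
    then show "?p a \<otimes> x \<in> Jn n" using psub_idD(2)[OF Jn(1)] Jn(2) es by blast
  qed
  moreover have "sat {\<one>} ?p (Jn n) = Jn n" using sat_one[OF e psubD(5)[OF pJ]] .
  moreover have "carrier R \<subseteq> sat {\<one>} ?p (span (carrier R) ?p (Jn n) es)"
  proof -
    have "span (carrier R) ?p {\<zero>} es \<subseteq> span (carrier R) ?p (Jn n) es" using psubD(2)[OF pJ] by (intro span_mono) auto
    moreover have "span (carrier R) ?p (Jn n) es \<subseteq> carrier R" using span_carrier[OF e psubD(5)[OF pJ] _ es(1)] by blast
    ultimately show ?thesis using es sat_ge[OF mset_one e, of "span (carrier R) ?p (Jn n) es"] by auto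
  qed
  ultimately have "tlen {\<one>} ?p (Jn n) (carrier R) \<le> enat (length es)"
    using clen_le_mono[of _ "Jn n" "sat {\<one>} ?p (span (carrier R) ?p (Jn n) es)"] by simp
  then show ?thesis unfolding mu_def by (cases "tlen {\<one>} ?p (Jn n) (carrier R)") auto
qed

text \<open>\<open>tlen_scale\<close> starting from the identity: each of the \<open>lam n\<close>
  simple factors of R modulo \<open>Jn n\<close> is a residue field, whose length through
  \<open>\<phi> ^^ n\<close> is \<open>resdeg ^ n\<close>. Finiteness of \<open>lam n\<close> comes
  from \<open>mu n\<close>, since every ideal is also a submodule through
  \<open>\<phi> ^^ n\<close>.\<close>

lemma mu_lam: "mu n = lam n * resdeg ^ n"
proof -
  note e = endo_funpow[OF endo_phi, of n]
  have l: "lambda_len R m \<phi> n = tlen {\<one>} id (Jn n) (carrier R)"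
    unfolding lambda_len_def Jn_def[symmetric] by (rule module_length_quot[OF Jn(1)])
  have "tlen {\<one>} id (Jn n) (carrier R) \<le> enat (mu n)" using tlen_id_le[OF e Jn(1), of n] mu_eq by simp
  then have l': "tlen {\<one>} id (Jn n) (carrier R) = enat (lam n)" unfolding lam_def l
    by (cases "tlen {\<one>} id (Jn n) (carrier R)") auto
  have "tlen {\<one>} (id \<circ> (\<phi> ^^ n)) (Jn n) (carrier R) = enat (lam n) * tlen {\<one>} (\<phi> ^^ n) m (carrier R)"
  proof (rule tlen_scale[OF prime_pair_m endo_id e])
    show "tsub {\<one>} id (Jn n)" using Jn(1) by (simp add: tsub_one)
    show "tlen {\<one>} id (Jn n) (carrier R) = enat (lam n)" by (rule l')
  qed (use endo_simps(4)[OF e] psubD(5)[OF Jn(1)] in auto)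
  then have "enat (mu n) = enat (lam n) * enat (resdeg ^ n)" unfolding resdeg_phin id_o mu_eq .
  then show ?thesis by simp
qed

lemma mu_pos: "mu n \<ge> 1"
proof -
  note e = endo_funpow[OF endo_phi, of n]
  have "tlen {\<one>} (\<phi> ^^ n) (Jn n) (Jn n) + 1 \<le> tlen {\<one>} (\<phi> ^^ n) (Jn n) (carrier R)"
    by (rule clen_snoc) (use psub_of_id[OF e Jn(1)] Jn(3)[of n] m_ne psubD(5)[OF psub_m] e in \<open>auto simp: tsub_one\<close>)
  then show ?thesis using mu_eq by (simp add: clen_same one_enat_def)
qed

text \<open>\<open>maximal_indep\<close> generates only modulo the ideal \<open>Jn n\<close>,
  whereas \<open>nakayama\<close> asks for combinations of the given generators \<open>gs\<close>
  with coefficients from \<open>m\<close>. The gap is closed by \<open>W\<close>, the set of such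
  combinations: since \<open>gs\<close> generates R through \<open>\<phi> ^^ n\<close>,
  \<open>W\<close> absorbs all of R, hence is an ideal, and it contains \<open>Jn n\<close>.\<close>

lemma mu_gens:
  obtains es where "length es = mu n" "set es \<subseteq> carrier R" "carrier R \<subseteq> span (carrier R) (\<phi> ^^ n) {\<zero>} es"
proof -
  let ?p = "\<phi> ^^ n"
  note e = endo_funpow[OF endo_phi, of n]
  have pJ: "psub ?p (Jn n)" using psub_of_id[OF e Jn(1)] .
  have tJ: "tsub {\<one>} ?p (Jn n)" using pJ tsub_one[OF e] by simp
  obtain es where es: "length es = mu n" "set es \<subseteq> carrier R" "carrier R \<subseteq> sat {\<one>} ?p (span (carrier R) ?p (Jn n) es)"
    using maximal_indep[OF prime_pair_m e tJ mu_eq] .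
  have es3: "carrier R \<subseteq> span (carrier R) ?p (Jn n) es"
    using es(3) sat_one[OF e span_carrier[OF e psubD(5)[OF pJ] _ es(2)]] by simp
  obtain gs where gs: "set gs \<subseteq> carrier R" "carrier R \<subseteq> span (carrier R) ?p {\<zero>} gs" using gens_phi .
  define Q where "Q = span (carrier R) ?p {\<zero>} es"
  have Q: "psub ?p Q" unfolding Q_def using e es psub_zero[OF e] by (intro span_psub1) auto
  define W where "W = span m ?p {\<zero>} gs"
  have W: "psub ?p W" unfolding W_def using e psub_m gs psub_zero[OF e] by (intro span_psub1)
  have mW: "?p a \<otimes> x \<in> W" if a: "a \<in> m" "x \<in> carrier R" for a x
  proof -
    have ac: "?p a \<in> carrier R" using a psubD(1)[OF psub_m] endo_simps(1)[OF e] by blast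
    have 1: "psub ?p {y \<in> carrier R. ?p a \<otimes> y \<in> W}"
      unfolding psub_def
    proof (intro conjI ballI)
      show "x \<oplus> y \<in> {y \<in> carrier R. ?p a \<otimes> y \<in> W}"
        if "x \<in> {y \<in> carrier R. ?p a \<otimes> y \<in> W}" "y \<in> {y \<in> carrier R. ?p a \<otimes> y \<in> W}" for x y
        using that ac psubD(3)[OF W] by (auto simp: r_distr)
      show "?p b \<otimes> y \<in> {y \<in> carrier R. ?p a \<otimes> y \<in> W}"
        if "b \<in> carrier R" "y \<in> {y \<in> carrier R. ?p a \<otimes> y \<in> W}" for b y
        using that ac psubD(4)[OF W that(1), of "?p a \<otimes> y"] endo_simps(1)[OF e that(1)] by (auto simp: m_lcomm)
    qed (use ac psubD(2)[OF W] in auto)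
    have "span (carrier R) ?p {\<zero>} gs \<subseteq> {y \<in> carrier R. ?p a \<otimes> y \<in> W}"
      by (rule span_least[OF 1])
        (use psubD(2)[OF 1] gs(1) span_coeff_mem[OF e psub_zero[OF e] psub_m gs(1) _ a(1)] in \<open>auto simp: W_def\<close>)
    then show ?thesis using gs(2) a(2) by blast
  qed
  have W': "psub id W"
    unfolding psub_def
  proof (intro conjI ballI)
    show "id x \<otimes> w \<in> W" if x: "x \<in> carrier R" and w: "w \<in> W" for x w
    proof -
      have 1: "psub ?p {y \<in> carrier R. x \<otimes> y \<in> W}"
        unfolding psub_def
      proof (intro conjI ballI)
        show "u \<oplus> v \<in> {y \<in> carrier R. x \<otimes> y \<in> W}"
          if "u \<in> {y \<in> carrier R. x \<otimes> y \<in> W}" "v \<in> {y \<in> carrier R. x \<otimes> y \<in> W}" for u v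
          using that x psubD(3)[OF W] by (auto simp: r_distr)
        show "?p b \<otimes> y \<in> {y \<in> carrier R. x \<otimes> y \<in> W}"
          if "b \<in> carrier R" "y \<in> {y \<in> carrier R. x \<otimes> y \<in> W}" for b y
          using that x psubD(4)[OF W that(1), of "x \<otimes> y"] endo_simps(1)[OF e that(1)] by (auto simp: m_lcomm)
      qed (use x psubD(2)[OF W] in auto)
      have "W \<subseteq> {y \<in> carrier R. x \<otimes> y \<in> W}"
        unfolding W_def
      proof (rule span_least_coeff[OF 1[unfolded W_def]])
        fix a g assume ag: "a \<in> m" "g \<in> set gs"
        then have c: "?p a \<in> carrier R" "g \<in> carrier R" using psubD(1)[OF psub_m] endo_simps(1)[OF e] gs by blast+
        have "?p a \<otimes> (x \<otimes> g) \<in> W" using mW[OF ag(1)] x c by simp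
        then have "x \<otimes> (?p a \<otimes> g) \<in> W" using x c by (simp add: m_lcomm)
        then show "?p a \<otimes> g \<in> {y \<in> carrier R. x \<otimes> y \<in> span m ?p {\<zero>} gs}" using c unfolding W_def by simp
      qed (use psubD(2)[OF 1] in \<open>simp add: W_def\<close>)
      then show ?thesis using w by auto
    qed
  qed (use psubD[OF W] in auto)
  have "?p a \<in> W" if "a \<in> m" for a
    using mW[OF that, of \<one>] psubD(1)[OF psub_m that] endo_simps(1)[OF e] by simp
  then have JW: "Jn n \<subseteq> W" using Jn_least[OF W'] by blast
  define U where "U = span m ?p Q gs"
  have U: "psub ?p U" unfolding U_def using e Q psub_m gs by (intro span_psub1)
  have QU: "Q \<subseteq> U" unfolding U_def using span_ge[OF e psubD(5)[OF Q] psubD(2)[OF psub_m] psubD(5)[OF psub_m] gs(1)] .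
  have "W \<subseteq> U" unfolding W_def U_def using psubD(2)[OF Q] by (intro span_mono) auto
  moreover have "set es \<subseteq> Q" unfolding Q_def by (rule span_set[OF e]) (use es in auto)
  ultimately have "span (carrier R) ?p (Jn n) es \<subseteq> U" using JW QU by (intro span_least[OF U]) auto
  then have "set gs \<subseteq> U" using es3 gs(1) by blast
  then have "set gs \<subseteq> Q" using nakayama[OF prime_pair_m e Q gs(1)] unfolding U_def by blast
  then have "span (carrier R) ?p {\<zero>} gs \<subseteq> Q" using psubD(2)[OF Q] by (intro span_least[OF Q]) auto
  then show ?thesis using that[OF es(1,2)] gs unfolding Q_def by blast
qed

lemma deg_le_mu: "deg ^ n \<le> mu n"
proof -
  obtain es where "length es = mu n" "set es \<subseteq> carrier R" "carrier R \<subseteq> span (carrier R) (\<phi> ^^ n) {\<zero>} es" using mu_gens .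
  then show ?thesis using rank_le_gens[of es n] rank_phin by simp
qed

lemma phin_Jn: "a \<in> Jn k \<Longrightarrow> (\<phi> ^^ n) a \<in> Jn (n + k)"
proof -
  note e = endo_funpow[OF endo_phi, of n]
  have "Jn k \<subseteq> {a \<in> carrier R. (\<phi> ^^ n) a \<in> Jn (n + k)}"
  proof (rule Jn_least[OF psub_preimage[OF e Jn(1)]], safe)
    fix a assume a: "a \<in> m"
    then show "(\<phi> ^^ k) a \<in> carrier R" using phin_m psubD(5)[OF psub_m] by blast
    have "(\<phi> ^^ (n + k)) a \<in> Jn (n + k)" using Jn(2) a by blast
    then show "(\<phi> ^^ n) ((\<phi> ^^ k) a) \<in> Jn (n + k)" by (simp add: funpow_add)
  qed
  then show "a \<in> Jn k \<Longrightarrow> (\<phi> ^^ n) a \<in> Jn (n + k)" by blast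
qed

text \<open>Modulo \<open>Jn (n + k)\<close>, the ring is generated through
  \<open>\<phi> ^^ n\<close> by \<open>mu n\<close> elements annihilated by \<open>Jn k\<close>.
  Through \<open>\<phi> ^^ k\<close> each of the corresponding cyclic quotients has length at most
  \<open>mu k\<close>.\<close>

lemma mu_submult: "mu (n + k) \<le> mu n * mu k"
proof -
  note en = endo_funpow[OF endo_phi, of n] and ek = endo_funpow[OF endo_phi, of k]
  let ?J = "Jn (n + k)"
  obtain es where es: "length es = mu n" "set es \<subseteq> carrier R" "carrier R \<subseteq> span (carrier R) (\<phi> ^^ n) {\<zero>} es" using mu_gens .
  have "tlen {\<one>} (\<phi> ^^ n \<circ> \<phi> ^^ k) ?J (span (carrier R) (\<phi> ^^ n) ?J es) \<le> enat (length es) * tlen {\<one>} (\<phi> ^^ k) (Jn k) (carrier R)"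
  proof (rule tlen_span_le[OF en ek _ psub_of_id[OF ek Jn(1)] es(2)])
    show "psub (\<phi> ^^ n \<circ> \<phi> ^^ k) ?J" using psub_of_id[OF endo_comp[OF en ek] Jn(1)] .
    fix a x assume "a \<in> Jn k" "x \<in> set es"
    then show "(\<phi> ^^ n) a \<otimes> x \<in> ?J" using psub_idD(2)[OF Jn(1)] phin_Jn es by blast
  qed
  moreover have "carrier R \<subseteq> span (carrier R) (\<phi> ^^ n) ?J es"
    using es(3) span_mono[of "{\<zero>}" ?J "carrier R" "carrier R"] psubD(2)[OF Jn(1)] by blast
  then have "tlen {\<one>} (\<phi> ^^ (n + k)) ?J (carrier R) \<le> tlen {\<one>} (\<phi> ^^ n \<circ> \<phi> ^^ k) ?J (span (carrier R) (\<phi> ^^ n) ?J es)"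
    unfolding funpow_add by (intro clen_mono) auto
  ultimately have "enat (mu (n + k)) \<le> enat (mu n) * enat (mu k)"
    unfolding mu_eq es(1) by (rule order_trans[rotated])
  then show ?thesis by simp
qed

end

section \<open>The Cohen--Macaulay case\<close>

context finite_local_endo
begin

definition primary :: "'a set \<Rightarrow> bool" where
  "primary I \<longleftrightarrow> (\<forall>P. primeI P \<longrightarrow> I \<subseteq> P \<longrightarrow> P = m)"

lemma prime_sub_m: "primeI P \<Longrightarrow> P \<subseteq> m"
  using proper_sub_m unfolding primeI_def by blast

lemma primary_reg:
  assumes "set xs \<subseteq> m" "reg {\<zero>} xs" "krull_dim R = enat (length xs)"
  shows "primary (adjs {\<zero>} xs)"
  unfolding primary_def using reg_krull_dim_primary[OF _ assms(2,3) _ _ primeI_m] prime_sub_m assms(1) psubD(5)[OF psub_m]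
  by blast

lemma psub_adjs_zero: "set xs \<subseteq> carrier R \<Longrightarrow> psub id (adjs {\<zero>} xs)"
  using adjs_psub[OF psub_zero[OF endo_id]] .

lemma primary_finite:
  assumes "primary I" "psub id I"
  obtains L where "tlen {\<one>} id I (carrier R) = enat L"
  using finite_length_of_primary[OF prime_pair_m assms(2)] assms(1) unfolding primary_def
  by (cases "tlen {\<one>} id I (carrier R)") auto

lemma pow_mem_mono:
  assumes "psub id J" "x \<in> carrier R" "x [^] (n::nat) \<in> J" "n \<le> k" shows "x [^] k \<in> J"
proof -
  have "x [^] k = x [^] (k - n) \<otimes> x [^] n" using assms by (simp add: nat_pow_mult)
  then show ?thesis using psub_idD(1)[OF assms(1) _ assms(3)] assms(2) by simp
qed

lemma common_pow:
  assumes J: "psub id J" and fin: "tlen {\<one>} id J (carrier R) \<noteq> \<infinity>" and xs: "set xs \<subseteq> m"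
  obtains N where "\<And>x. x \<in> set xs \<Longrightarrow> x [^] (N::nat) \<in> J"
proof -
  have "\<exists>N::nat. \<forall>x\<in>set xs. x [^] N \<in> J" using xs
  proof (induction xs)
    case (Cons x xs)
    then obtain N :: nat where N: "\<forall>x\<in>set xs. x [^] N \<in> J" by auto
    obtain n :: nat where n: "x [^] n \<in> J" using pow_mem_of_finite_length[OF prime_pair_m J fin, of x] Cons.prems by auto
    have c: "set (x # xs) \<subseteq> carrier R" using Cons.prems psubD(5)[OF psub_m] by blast
    have "y [^] (n + N) \<in> J" if "y \<in> set (x # xs)" for y
      using that n N c pow_mem_mono[OF J, of y n "n + N"] pow_mem_mono[OF J, of y N "n + N"] by auto
    then show ?case by blast
  qed auto
  then show ?thesis using that by blast
qed

lemma adjs_mapsto: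
  assumes "psub id B" "endo \<psi>" "set ys \<subseteq> carrier R" "\<And>y. y \<in> set ys \<Longrightarrow> \<psi> y \<in> B" "x \<in> adjs {\<zero>} ys"
  shows "\<psi> x \<in> B"
proof -
  have "adjs {\<zero>} ys \<subseteq> {a \<in> carrier R. \<psi> a \<in> B}"
    using assms psubD(2)[OF assms(1)] by (intro adjs_least psub_preimage) auto
  then show ?thesis using assms by blast
qed

text \<open>A multiple of \<open>b\<close> starts a regular sequence of length \<open>d = dim R\<close>, so modulo \<open>c\<close> only
  \<open>d - 1\<close> directions are left for powers to grow in.\<close>
lemma quotient_growth:
  assumes xs: "set xs \<subseteq> m" "reg {\<zero>} xs" "krull_dim R = enat (length xs)"
    and b: "b \<in> carrier R" "b \<noteq> \<zero>"
  obtains c Z where "c \<in> carrier R"  "c \<noteq> \<zero>" "b divides c"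
    "\<And>a. a \<ge> 1 \<Longrightarrow> enat a * tlen {\<one>} id (adj (adjs {\<zero>} (map (\<lambda>x. x [^] (length xs * a + 1)) xs)) c) (carrier R)
      \<le> enat (Z * a ^ length xs)"
proof (cases xs)
  \<comment> \<open>In dimension \<open>0\<close> the zero ideal is prime and primary, so
    \<open>m\<close> is zero and \<open>b\<close> is a unit. With \<open>c = b\<close> the quotient
    vanishes, whence \<open>Z = 0\<close>.\<close>
  case Nil
  have "primary {\<zero>}" using primary_reg[OF xs] Nil by simp
  moreover have "{\<zero>} \<noteq> carrier R" using one_closed one_not_zero by blast
  then have "primeI {\<zero>}" unfolding primeI_def by (auto simp: integral_iff)
  ultimately have "{\<zero>} = m" unfolding primary_def by blast
  then have "b \<notin> m" using b by blast
  then have "adj {\<zero>} b = carrier R"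
    using proper_sub_m[OF adj_psub[OF psub_zero[OF endo_id] b(1)]] adj_self[OF psub_zero[OF endo_id] b(1)] by blast
  then show ?thesis using that[of b 0] b Nil by (simp add: clen_same)
next
  case (Cons x xs')
  let ?d = "length xs"
  have d: "?d = Suc (length xs')" using Cons by simp
  have xc: "set xs \<subseteq> carrier R" using xs psubD(5)[OF psub_m] by blast
  have x: "x \<in> m" "x \<in> carrier R" "x \<noteq> \<zero>"
  proof -
    show "x \<in> m" "x \<in> carrier R" using xs xc Cons by auto
    have "nzd {\<zero>} x" using xs Cons by simp
    then show "x \<noteq> \<zero>" using nzdD[of "{\<zero>}" x \<one>] one_not_zero by auto
  qed
  \<comment> \<open>The factor \<open>x\<close> moves \<open>b\<close> into \<open>m\<close>, as
    \<open>grade_exchange\<close> requires, while \<open>b\<close> still divides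
    \<open>c\<close>.\<close>
  define c where "c = b \<otimes> x"
  have c: "c \<in> m" "c \<in> carrier R" "c \<noteq> \<zero>" unfolding c_def using psub_idD(1)[OF psub_m] b x by (auto simp: integral_iff)
  have "nzd {\<zero>} c" using c unfolding nzd_def by (auto simp: integral_iff)
  moreover have "has_grade m (Suc (length xs')) {\<zero>}"
    using xs Cons by (subst has_grade_iff) (auto intro!: exI[of _ xs])
  ultimately have "has_grade m (length xs') (adj {\<zero>} c)"
    using grade_exchange[OF psub_m psub_zero[OF endo_id]] c by blast
  then obtain zs where zs: "length zs = length xs'" "set zs \<subseteq> m" "reg (adj {\<zero>} c) zs" unfolding has_grade_iff by blast
  have zc: "set zs \<subseteq> carrier R" using zs psubD(5)[OF psub_m] by blast
  have "primary (adjs {\<zero>} (c # zs))"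
    using zs c \<open>nzd {\<zero>} c\<close> xs(3) d by (intro primary_reg) auto
  then obtain L' where L': "tlen {\<one>} id (adjs (adj {\<zero>} c) zs) (carrier R) = enat L'"
    using primary_finite[of "adjs {\<zero>} (c # zs)"] psub_adjs_zero[of "c # zs"] zc c by auto
  obtain L where L: "tlen {\<one>} id (adjs {\<zero>} xs) (carrier R) = enat L"
    using primary_finite[OF primary_reg[OF xs] psub_adjs_zero[OF xc]] .
  obtain M :: nat where M: "\<And>z. z \<in> set zs \<Longrightarrow> z [^] M \<in> adjs {\<zero>} xs"
    using common_pow[OF psub_adjs_zero[OF xc] _ zs(2)] L by auto
  \<comment> \<open>The exponent \<open>q\<close> below comes from \<open>z [^] M\<close> lying in
    the ideal of \<open>xs\<close>, followed by \<open>adjs_pow_mem\<close> for exponent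
    \<open>?d * a + 1\<close>. It is at most \<open>M * (?d * (?d + 1) + 1) * a\<close>, and only
    \<open>?d - 1\<close> elements are raised to it; the extra factor \<open>a\<close> on the left
    of the estimate turns the exponent into \<open>?d\<close>.\<close>
  define Z where "Z = (M * (?d * (?d + 1) + 1)) ^ length xs' * L'"
  have "enat a * tlen {\<one>} id (adj (adjs {\<zero>} (map (\<lambda>x. x [^] (?d * a + 1)) xs)) c) (carrier R) \<le> enat (Z * a ^ ?d)"
    if a: "a \<ge> 1" for a
  proof -
    define q where "q = M * (?d * (?d * a + 1) + 1)"
    define A where "A = adjs {\<zero>} (map (\<lambda>x. x [^] (?d * a + 1)) xs)"
    have mc: "set (map (\<lambda>x. x [^] (?d * a + 1)) xs) \<subseteq> carrier R" using xc by auto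
    have A: "psub id A" unfolding A_def by (rule psub_adjs_zero[OF mc])
    have "z [^] q \<in> A" if z: "z \<in> set zs" for z
    proof -
      have "(z [^] M) [^] (?d * (?d * a + 1) + 1) \<in> A" unfolding A_def by (rule adjs_pow_mem[OF xc M[OF z]])
      moreover have "(z [^] M) [^] (?d * (?d * a + 1) + 1) = z [^] q"
        unfolding q_def by (rule nat_pow_pow) (use z zc in blast)
      ultimately show ?thesis by (simp only:)
    qed
    then have "set (map (\<lambda>z. z [^] q) zs) \<subseteq> adj A c" using adj_ge[OF A c(2)] by auto
    moreover have "adj {\<zero>} c \<subseteq> adj A c" using adj_self[OF A c(2)] psubD(2)[OF adj_psub[OF A c(2)]] A c
      by (intro adj_least) auto
    ultimately have "adjs (adj {\<zero>} c) (map (\<lambda>z. z [^] q) zs) \<subseteq> adj A c"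
      using adj_psub[OF A c(2)] by (intro adjs_least)
    then have "tlen {\<one>} id (adj A c) (carrier R) \<le> tlen {\<one>} id (adjs (adj {\<zero>} c) (map (\<lambda>z. z [^] q) zs)) (carrier R)"
      by (intro clen_mono) auto
    also have "\<dots> = enat (q ^ length xs' * L')"
      using reg_powers(2)[OF prime_pair_m adj_psub[OF psub_zero[OF endo_id] c(2)] endo_id zs(2,3), of q] L' zs by simp
    finally have 1: "tlen {\<one>} id (adj A c) (carrier R) \<le> enat (q ^ length xs' * L')" .
    have "q \<le> M * (?d * (?d + 1) + 1) * a"
    proof -
      have "?d * (?d * a + 1) + 1 \<le> (?d * (?d + 1) + 1) * a" 
      proof -
        have "?d \<le> a * ?d" using a by simp
        then have "?d + 1 \<le> a * ?d + a" using a by (rule add_mono)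
        then show ?thesis by (simp add: algebra_simps)
      qed
      then show ?thesis unfolding q_def mult.assoc[of M] by (rule mult_le_mono2)
    qed
    then have "q ^ length xs' \<le> (M * (?d * (?d + 1) + 1)) ^ length xs' * a ^ length xs'"
      by (metis power_mono power_mult_distrib zero_le)
    then have "a * (q ^ length xs' * L') \<le> Z * a ^ ?d" unfolding Z_def d by (simp add: algebra_simps)
    then have "enat a * enat (q ^ length xs' * L') \<le> enat (Z * a ^ ?d)" by simp
    then show ?thesis using 1 unfolding A_def by (meson mult_left_mono order_trans zero_le)
  qed
  moreover have "b divides c" unfolding c_def using x by (auto simp: factor_def)
  ultimately show ?thesis using that[of c Z] c by blast
qed

lemma common_denominator:
  assumes \<psi>: "endo \<psi>" "\<And>x. x \<in> carrier R \<Longrightarrow> \<psi> x = \<zero> \<Longrightarrow> x = \<zero>"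
    and F: "psub \<psi> F" and gs: "set gs \<subseteq> carrier R" "set gs \<subseteq> sat T0 \<psi> F"
  obtains b where "b \<in> carrier R" "b \<noteq> \<zero>" "\<And>g. g \<in> set gs \<Longrightarrow> \<psi> b \<otimes> g \<in> F"
proof -
  have "\<exists>b\<in>carrier R. b \<noteq> \<zero> \<and> (\<forall>g\<in>set gs. \<psi> b \<otimes> g \<in> F)" using gs
  proof (induction gs)
    case Nil
    then show ?case using one_not_zero by (intro bexI[of _ \<one>]) auto
  next
    case (Cons g gs)
    then obtain b where b: "b \<in> carrier R" "b \<noteq> \<zero>" "\<forall>g\<in>set gs. \<psi> b \<otimes> g \<in> F" by auto
    obtain t where t: "t \<in> carrier R" "t \<noteq> \<zero>" "\<psi> t \<otimes> g \<in> F" using Cons.prems unfolding sat_def by auto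
    have gc: "g \<in> carrier R" "set gs \<subseteq> carrier R" using Cons.prems by auto
    have "\<psi> (t \<otimes> b) \<otimes> h \<in> F" if h: "h \<in> set (g # gs)" for h
    proof (cases "h = g")
      case True
      have "\<psi> b \<otimes> (\<psi> t \<otimes> g) \<in> F" by (rule psubD(4)[OF F b(1) t(3)])
      then show ?thesis using True t b gc \<psi>(1) by (simp add: m_ac)
    next
      case False
      then have "\<psi> t \<otimes> (\<psi> b \<otimes> h) \<in> F" using psubD(4)[OF F t(1)] b h by auto
      then show ?thesis using False h t b gc \<psi>(1) by (auto simp: m_assoc)
    qed
    moreover have "t \<otimes> b \<noteq> \<zero>" using t b by (simp add: integral_iff)
    ultimately show ?case using t b by (intro bexI[of _ "t \<otimes> b"]) auto
  qed
  then show ?thesis using that by blast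
qed

text \<open>With \<open>J = \<psi>(xs) R\<close> generated by a regular sequence \<open>zs\<close>, the ideal of the \<open>a\<close>-th powers of \<open>zs\<close>
  has \<open>\<psi>\<close>-colength \<open>a\<^sup>d\<close> times that of \<open>J\<close> and contains \<open>\<psi>\<close> of the \<open>(da + 1)\<close>-st powers of \<open>xs\<close>. Filtering \<open>R\<close> through
  a subspace \<open>F\<close> of full rank with \<open>deg\<^sup>n\<close> generators bounds it by \<open>deg\<^sup>n (d + 1)\<^sup>d a\<^sup>d L\<close> up to \<open>O(a\<^sup>d\<^sup>-\<^sup>1)\<close>.\<close>
lemma mu_le_of_regular_system:
  assumes xs: "set xs \<subseteq> m" "reg {\<zero>} xs" "krull_dim R = enat (length xs)"
    and L: "tlen {\<one>} id (adjs {\<zero>} xs) (carrier R) = enat L"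
  shows "mu n \<le> deg ^ n * (length xs + 1) ^ length xs * L"
proof -
  define \<psi> where "\<psi> = \<phi> ^^ n"
  define d where "d = length xs"
  have \<psi>: "endo \<psi>" unfolding \<psi>_def by simp
  have inj: "x = \<zero>" if "x \<in> carrier R" "\<psi> x = \<zero>" for x using phin_inj that unfolding \<psi>_def by blast
  have xc: "set xs \<subseteq> carrier R" using xs psubD(5)[OF psub_m] by blast
  have \<psi>m: "\<psi> a \<in> m" if "a \<in> m" for a using phin_m[of n] that unfolding \<psi>_def by blast
  define J where "J = adjs {\<zero>} (map \<psi> xs)"
  have Jc: "set (map \<psi> xs) \<subseteq> carrier R" using xc \<psi> by auto
  have J: "psub id J" unfolding J_def by (rule psub_adjs_zero[OF Jc])
  have Jx: "\<psi> x \<in> J" if "x \<in> set xs" for x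
    using adjs_ge[OF psub_zero[OF endo_id] Jc] that unfolding J_def by auto
  \<comment> \<open>Hence the colength \<open>l\<close> of \<open>J\<close> through \<psi> bounds
    \<open>mu n\<close>. The estimate is made for \<open>J\<close> because it has only
    \<open>d\<close> generators.\<close>
  have JJ: "J \<subseteq> Jn n" unfolding J_def
    using Jn(1)[of n] Jn(2)[of n] xs(1) psubD(2)[OF Jn(1)] unfolding \<psi>_def by (intro adjs_least) auto
  have Jm: "J \<subseteq> m" using JJ Jn(3) by blast
  obtain gs where gs: "set gs \<subseteq> carrier R" "carrier R \<subseteq> span (carrier R) \<psi> {\<zero>} gs" using gens_phi[of n] unfolding \<psi>_def .
  have quot_le: "tlen {\<one>} \<psi> U (span (carrier R) \<psi> U es) \<le> enat (length es) * tlen {\<one>} id A (carrier R)"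
    if "psub \<psi> U" "psub id A" "set es \<subseteq> carrier R" "\<And>a e. a \<in> A \<Longrightarrow> e \<in> set es \<Longrightarrow> \<psi> a \<otimes> e \<in> U" for U A es
    using tlen_span_le[OF \<psi> endo_id, of U A es] that by simp
  have span_R: "carrier R \<subseteq> span (carrier R) \<psi> U gs" if "psub \<psi> U" for U
    using gs(2) span_mono[of "{\<zero>}" U "carrier R" "carrier R" \<psi> gs] psubD(2)[OF that] by blast
  have "tlen {\<one>} \<psi> J (span (carrier R) \<psi> J gs) \<le> enat (length gs) * tlen {\<one>} id (adjs {\<zero>} xs) (carrier R)"
  proof (rule quot_le[OF psub_of_id[OF \<psi> J] psub_adjs_zero[OF xc] gs(1)])
    fix a e assume "a \<in> adjs {\<zero>} xs" "e \<in> set gs"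
    then show "\<psi> a \<otimes> e \<in> J" using adjs_mapsto[OF J \<psi> xc Jx] psub_idD(2)[OF J] gs by blast
  qed
  then have "tlen {\<one>} \<psi> J (carrier R) \<le> enat (length gs * L)"
    unfolding L using clen_le_mono[OF _ span_R[OF psub_of_id[OF \<psi> J]]] by simp
  then obtain l where l: "tlen {\<one>} \<psi> J (carrier R) = enat l" by (cases "tlen {\<one>} \<psi> J (carrier R)") auto
  have "tlen {\<one>} id J (carrier R) \<le> enat l" using tlen_id_le[OF \<psi> J] l by simp
  then have "tlen {\<one>} id J (carrier R) \<noteq> \<infinity>" by (cases "tlen {\<one>} id J (carrier R)") auto
  then obtain N :: nat where N: "\<And>x. x \<in> set xs \<Longrightarrow> x [^] N \<in> J" using common_pow[OF J _ xs(1)] by blast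
  \<comment> \<open>The powers of \<open>xs\<close> that lie in \<open>J\<close> form a regular
    sequence as long as the list of generators of \<open>J\<close>, which is the equality case of
    \<open>grade_le_generators\<close>.\<close>
  have "has_grade J d {\<zero>}"
    unfolding has_grade_iff d_def
    using reg_powers(1)[OF prime_pair_m psub_zero[OF endo_id] endo_id xs(1,2), of N] N
    by (intro exI[of _ "map (\<lambda>x. x [^] N) xs"]) auto
  moreover have "J \<noteq> carrier R" using Jm m_ne psubD(5)[OF psub_m] by blast
  ultimately obtain zs where zs: "length zs = d" "set zs \<subseteq> J" "reg {\<zero>} zs" "adjs {\<zero>} zs = J"
    using grade_le_generators[OF J _ psub_zero[OF endo_id] Jc, of d] unfolding J_def d_def by auto
  have zc: "set zs \<subseteq> carrier R" "set zs \<subseteq> m" using zs psubD(5)[OF J] Jm by auto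
  have t: "tlen T0 \<psi> {\<zero>} (carrier R) = enat (deg ^ n)" unfolding \<psi>_def by (rule rank_phin)
  have ts: "tsub T0 \<psi> {\<zero>}" unfolding \<psi>_def by (rule tsub_zero_phin)
  obtain es where es: "length es = deg ^ n" "set es \<subseteq> carrier R" "carrier R \<subseteq> sat T0 \<psi> (span (carrier R) \<psi> {\<zero>} es)"
    using maximal_indep[OF prime_pair_nonzero \<psi> ts t] .
  define F where "F = span (carrier R) \<psi> {\<zero>} es"
  have F: "psub \<psi> F" unfolding F_def using \<psi> es by (intro span_psub1) auto
  \<comment> \<open>\<open>F\<close> has full rank, so every generator in \<open>gs\<close> has a
    denominator; their product serves for all of them.\<close>
  obtain b where b: "b \<in> carrier R" "b \<noteq> \<zero>" "\<And>g. g \<in> set gs \<Longrightarrow> \<psi> b \<otimes> g \<in> F"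
    using common_denominator[OF \<psi> inj F gs(1)] es(3) gs(1) unfolding F_def by blast
  obtain c Z where c: "c \<in> carrier R" "b divides c"
    "\<And>a. a \<ge> 1 \<Longrightarrow> enat a * tlen {\<one>} id (adj (adjs {\<zero>} (map (\<lambda>x. x [^] (d * a + 1)) xs)) c) (carrier R) \<le> enat (Z * a ^ d)"
    using quotient_growth[OF xs b(1,2)] unfolding d_def by metis
  obtain s where s: "s \<in> carrier R" "c = b \<otimes> s" using c(2) unfolding factor_def by auto
  have cF: "\<psi> c \<otimes> g \<in> F" if "g \<in> set gs" for g
  proof -
    have "\<psi> s \<otimes> (\<psi> b \<otimes> g) \<in> F" using psubD(4)[OF F s(1) b(3)[OF that]] .
    moreover have "g \<in> carrier R" using that gs by blast
    ultimately show ?thesis using s b \<psi> by (simp add: m_ac)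
  qed
  have main: "a * l \<le> a * (deg ^ n * (d + 1) ^ d * L) + length gs * Z" if a: "a \<ge> 1" for a
  proof -
    \<comment> \<open>The exponent of \<open>adjs_pow_mem\<close>: elements of \<open>J\<close>
      raised to it lie in the ideal \<open>B\<close> of \<open>a\<close>-th powers of
      \<open>zs\<close>, so \<psi> maps \<open>A\<close> into \<open>B\<close>.\<close>
    define k where "k = d * a + 1"
    define B where "B = adjs {\<zero>} (map (\<lambda>z. z [^] a) zs)"
    define A where "A = adjs {\<zero>} (map (\<lambda>x. x [^] k) xs)"
    have Ac: "set (map (\<lambda>x. x [^] k) xs) \<subseteq> carrier R" using xc by auto
    have A: "psub id A" unfolding A_def by (rule psub_adjs_zero[OF Ac])
    have B: "psub id B" unfolding B_def by (rule psub_adjs_zero) (use zc in auto)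
    have powc: "\<psi> (x [^] (j::nat)) = \<psi> x [^] j" if "x \<in> carrier R" for x j
      using that \<psi> by (induction j) auto
    have AB: "\<psi> x \<in> B" if "x \<in> A" for x
    proof (rule adjs_mapsto[OF B \<psi> Ac _ that[unfolded A_def]])
      fix y assume "y \<in> set (map (\<lambda>x. x [^] k) xs)"
      then obtain x where x: "x \<in> set xs" "y = x [^] k" by auto
      have "\<psi> x [^] (length zs * a + 1) \<in> B" unfolding B_def
        by (rule adjs_pow_mem[OF zc(1)]) (use Jx[OF x(1)] zs in simp)
      then have "\<psi> x [^] k \<in> B" unfolding k_def zs(1) .
      then show "\<psi> y \<in> B" using powc[of x k] x xc by auto
    qed
    have lenB: "tlen {\<one>} \<psi> B (carrier R) = enat (a ^ d * l)"
      using reg_powers(2)[OF prime_pair_m psub_zero[OF endo_id] \<psi> zc(2) zs(3), of a] l zs unfolding B_def by simp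
    have lenA: "tlen {\<one>} id A (carrier R) = enat (k ^ d * L)"
      using reg_powers(2)[OF prime_pair_m psub_zero[OF endo_id] endo_id xs(1,2), of k] L unfolding A_def d_def by simp
    \<comment> \<open>\<open>G\<close> is \<open>F\<close> plus \<open>B\<close>. Below it,
      \<open>deg ^ n\<close> generators each contribute at most the colength of \<open>A\<close>,
      the main term. Above it, the generators \<open>gs\<close> are annihilated through \<psi> even
      by \<open>adj A c\<close>, which leaves a term of lower order in \<open>a\<close>.\<close>
    define G where "G = span (carrier R) \<psi> B es"
    have pB: "psub \<psi> B" using psub_of_id[OF \<psi> B] .
    have G: "psub \<psi> G" unfolding G_def using \<psi> pB es by (intro span_psub1) auto
    have BG: "B \<subseteq> G" unfolding G_def using span_ge[OF \<psi> psubD(5)[OF B] zero_closed _ es(2)] by auto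
    have FG: "F \<subseteq> G" unfolding F_def G_def using psubD(2)[OF B] by (intro span_mono) auto
    have 1: "tlen {\<one>} \<psi> B G \<le> enat (deg ^ n) * enat (k ^ d * L)"
      unfolding G_def lenA[symmetric] es(1)[symmetric]
      by (rule quot_le[OF pB A es(2)]) (use AB psub_idD(2)[OF B] es in blast)
    have "tlen {\<one>} \<psi> G (span (carrier R) \<psi> G gs) \<le> enat (length gs) * tlen {\<one>} id (adj A c) (carrier R)"
    proof (rule quot_le[OF G adj_psub[OF A c(1)] gs(1)])
      fix y g assume y: "y \<in> adj A c" and g: "g \<in> set gs"
      then obtain \<alpha> r where \<alpha>: "\<alpha> \<in> A" "r \<in> carrier R" "y = \<alpha> \<oplus> r \<otimes> c" by (auto elim: in_adjE)
      have cc: "g \<in> carrier R" "\<alpha> \<in> carrier R" using g gs psubD(1)[OF A \<alpha>(1)] by auto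
      have "\<psi> \<alpha> \<otimes> g \<oplus> \<psi> r \<otimes> (\<psi> c \<otimes> g) \<in> G"
        using psubD(3)[OF G] BG FG psub_idD(2)[OF B cc(1) AB[OF \<alpha>(1)]] psubD(4)[OF F \<alpha>(2) cF[OF g]] by blast
      then show "\<psi> y \<otimes> g \<in> G" using \<alpha> cc c \<psi> by (simp add: l_distr m_assoc)
    qed
    then have 2: "tlen {\<one>} \<psi> G (carrier R) \<le> enat (length gs) * tlen {\<one>} id (adj A c) (carrier R)"
      using clen_le_mono[OF _ span_R[OF G]] by blast
    have "tlen {\<one>} \<psi> B (carrier R) = tlen {\<one>} \<psi> B G + tlen {\<one>} \<psi> G (carrier R)"
      using \<psi> G pB BG psubD(5)[OF G] by (intro tlen_add) (auto simp: tsub_one)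
    also have "\<dots> \<le> enat (deg ^ n) * enat (k ^ d * L) + enat (length gs) * tlen {\<one>} id (adj A c) (carrier R)"
      using 1 2 by (rule add_mono)
    finally have "enat a * enat (a ^ d * l) \<le> enat a * (enat (deg ^ n) * enat (k ^ d * L) + enat (length gs) * tlen {\<one>} id (adj A c) (carrier R))"
      unfolding lenB by (rule mult_left_mono) simp
    also have "\<dots> = enat (a * (deg ^ n * (k ^ d * L))) + enat (length gs) * (enat a * tlen {\<one>} id (adj A c) (carrier R))"
      by (simp add: distrib_left mult.left_commute)
    also have "\<dots> \<le> enat (a * (deg ^ n * (k ^ d * L))) + enat (length gs) * enat (Z * a ^ d)"
      using c(3)[OF a] unfolding A_def k_def by (intro add_left_mono mult_left_mono) auto
    finally have 3: "a * (a ^ d * l) \<le> a * (deg ^ n * (k ^ d * L)) + length gs * (Z * a ^ d)" by simp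
    \<comment> \<open>This is the origin of the constant \<open>(d + 1) ^ d\<close>.\<close>
    have "k \<le> (d + 1) * a" unfolding k_def using a by simp
    then have "k ^ d \<le> (d + 1) ^ d * a ^ d" by (metis power_mono power_mult_distrib zero_le)
    then have "a * (deg ^ n * (k ^ d * L)) \<le> a * (deg ^ n * (((d + 1) ^ d * a ^ d) * L))"
      by (intro mult_le_mono) auto
    then have 4: "a * (deg ^ n * (k ^ d * L)) + length gs * (Z * a ^ d)
        \<le> a * (deg ^ n * (((d + 1) ^ d * a ^ d) * L)) + length gs * (Z * a ^ d)" by simp
    have "a ^ d * (a * l) = a * (a ^ d * l)" by simp
    also note 3
    also note 4
    also have "a * (deg ^ n * (((d + 1) ^ d * a ^ d) * L)) + length gs * (Z * a ^ d)
        = a ^ d * (a * (deg ^ n * (d + 1) ^ d * L) + length gs * Z)" by (simp add: algebra_simps)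
    finally have "a ^ d * (a * l) \<le> a ^ d * (a * (deg ^ n * (d + 1) ^ d * L) + length gs * Z)" .
    then show ?thesis using a by simp
  qed
  \<comment> \<open>The lower order term is removed by evaluating \<open>main\<close> at
    \<open>a = length gs * Z + 1\<close>, where an excess of one in \<open>l\<close> would already
    outweigh it.\<close>
  have "l \<le> deg ^ n * (d + 1) ^ d * L"
  proof (rule ccontr)
    assume "\<not> ?thesis"
    then have "deg ^ n * (d + 1) ^ d * L + 1 \<le> l" by simp
    then have "(length gs * Z + 1) * (deg ^ n * (d + 1) ^ d * L + 1) \<le> (length gs * Z + 1) * l" by (rule mult_le_mono2)
    also have "\<dots> \<le> (length gs * Z + 1) * (deg ^ n * (d + 1) ^ d * L) + length gs * Z" by (rule main) simp
    finally show False by (simp add: algebra_simps)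
  qed
  moreover have "enat (mu n) \<le> enat l"
    unfolding mu_eq[symmetric] l[symmetric] \<psi>_def[symmetric] using JJ by (intro clen_mono) auto
  ultimately show ?thesis unfolding d_def by simp
qed

lemma regular_seq_iff_reg: "set xs \<subseteq> m \<Longrightarrow> regular_seq R xs \<longleftrightarrow> reg {\<zero>} xs"
proof -
  assume xs: "set xs \<subseteq> m"
  then have xc: "set xs \<subseteq> carrier R" using psubD(5)[OF psub_m] by blast
  have t: "Idl (set (take i xs)) = adjs {\<zero>} (take i xs)" for i
    using genideal_set_eq_adjs[of "take i xs"] xc set_take_subset[of i xs] by blast
  have "Idl (set xs) \<subseteq> m" using xs psub_m psub_id_iff_ideal by (intro genideal_minimal) auto
  then have "Idl (set xs) \<noteq> carrier R" using m_ne psubD(5)[OF psub_m] by blast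
  then show ?thesis unfolding regular_seq_def reg_iff_nth nzd_def t using xc by auto
qed

text \<open>Depth is only a supremum; an actual regular sequence of that length exists because
  \<open>grade_le_generators\<close> bounds all lengths by the number of generators of
  \<open>m\<close>, so that the supremum is attained. Its ideal is primary and has finite colength
  \<open>L\<close>.\<close>

lemma mu_le_cohen_macaulay:
  assumes "cohen_macaulay_local R m"
  obtains C where "\<And>n. mu n \<le> C * deg ^ n"
proof -
  obtain ms where ms: "set ms \<subseteq> m" "m = adjs {\<zero>} ms" using ideal_fg[OF psub_m] .
  have mc: "set ms \<subseteq> carrier R" using ms psubD(5)[OF psub_m] by blast
  define S where "S = {enat (length xs) | xs. set xs \<subseteq> m \<and> regular_seq R xs}"
  have bound: "length xs \<le> length ms" if "set xs \<subseteq> m" "reg {\<zero>} xs" for xs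
  proof -
    have "has_grade m (length xs) {\<zero>}" using that has_grade_iff by blast
    then show ?thesis using grade_le_generators[OF psub_m m_ne psub_zero[OF endo_id] mc ms(2)] by blast
  qed
  have dS: "local_depth R m = Sup S" unfolding local_depth_def S_def ..
  have "s \<le> enat (length ms)" if "s \<in> S" for s using that bound regular_seq_iff_reg unfolding S_def by auto
  then have SS: "S \<subseteq> enat ` {..length ms}" using regular_seq_iff_reg bound unfolding S_def by auto
  then have "finite S" by (rule finite_subset) auto
  moreover have "S \<noteq> {}" using regular_seq_iff_reg[of "[]"] unfolding S_def by (auto intro!: exI[of _ "[]"])
  ultimately have "Sup S \<in> S" by (metis Max_Sup Max_in)
  then obtain xs where xs: "set xs \<subseteq> m" "regular_seq R xs" "Sup S = enat (length xs)" unfolding S_def by auto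
  have r: "reg {\<zero>} xs" using xs regular_seq_iff_reg by blast
  have k: "krull_dim R = enat (length xs)" using assms xs(3) dS unfolding cohen_macaulay_local_def by simp
  have xc: "set xs \<subseteq> carrier R" using xs psubD(5)[OF psub_m] by blast
  obtain L where L: "tlen {\<one>} id (adjs {\<zero>} xs) (carrier R) = enat L"
    using primary_finite[OF primary_reg[OF xs(1) r k] psub_adjs_zero[OF xc]] .
  show ?thesis
    by (rule that[of "(length xs + 1) ^ length xs * L"]) (use mu_le_of_regular_system[OF xs(1) r k L] in \<open>simp add: ac_simps\<close>)
qed

end

section \<open>Entropy\<close>

lemma fekete_subadditive:
  fixes a :: "nat \<Rightarrow> real"
  assumes sub: "\<And>n k. a (n + k) \<le> a n + a k" and pos: "\<And>n. 0 \<le> a n"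
  shows "\<exists>L. (\<lambda>n. a n / real n) \<longlonglongrightarrow> L"
proof -
  define L where "L = (INF n\<in>{1..}. a n / real n)"
  have bdd: "bdd_below ((\<lambda>n. a n / real n) ` {1..})" using pos by (intro bdd_belowI[of _ 0]) auto
  have mult: "a (q * k + s) \<le> real q * a k + a s" for q k s
  proof (induction q)
    case (Suc q)
    have "a (Suc q * k + s) = a (k + (q * k + s))" by (simp add: add.assoc)
    also have "\<dots> \<le> a k + a (q * k + s)" by (rule sub)
    finally show ?case using Suc by (simp add: algebra_simps)
  qed simp
  have "(\<lambda>n. a n / real n) \<longlonglongrightarrow> L"
  proof (rule LIMSEQ_I)
    fix e :: real assume e: "e > 0"
    have "\<exists>x\<in>(\<lambda>n. a n / real n) ` {1..}. x < L + e / 2"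
      unfolding L_def by (rule cInf_lessD) (use e in auto)
    then obtain k where k: "k \<ge> 1" "a k / real k < L + e / 2" by auto
    \<comment> \<open>One bound for the values of \<open>a\<close> at all remainders modulo
      \<open>k\<close>, so that the error \<open>B / n\<close> is uniform.\<close>
    define B where "B = (\<Sum>s<k. a s)"
    have B: "a s \<le> B" if "s < k" for s
      unfolding B_def by (rule member_le_sum) (use that pos in auto)
    have B0: "0 \<le> B" unfolding B_def using pos by (intro sum_nonneg) auto
    obtain n0 :: nat where n0: "2 * B / e < real n0" using reals_Archimedean2 by blast
    show "\<exists>no. \<forall>n\<ge>no. norm (a n / real n - L) < e"
    proof (intro exI allI impI)
      fix n assume n: "n \<ge> max 1 n0"
      have n1: "real n > 0" using n by simp
      define q s where "q = n div k" and "s = n mod k"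
      have nq: "n = q * k + s" "s < k" unfolding q_def s_def using k by auto
      have "a n \<le> real q * a k + B" using mult[of q k s] B[OF nq(2)] nq(1) by simp
      also have "real q * a k = real (q * k) * (a k / real k)" using k by simp
      also have "\<dots> \<le> real n * (a k / real k)"
        using nq pos k by (intro mult_right_mono) auto
      finally have "a n \<le> real n * (a k / real k) + B" by simp
      then have "a n / real n \<le> a k / real k + B / real n" using n1 by (simp add: field_simps)
      moreover have "B / real n < e / 2"
      proof -
        have "2 * B / e < real n" using n0 n by simp
        then show ?thesis using e n1 by (simp add: field_simps)
      qed
      moreover have "L \<le> a n / real n" unfolding L_def by (rule cINF_lower[OF bdd]) (use n in auto)
      ultimately have "0 \<le> a n / real n - L" "a n / real n - L < e" using k(2) by linarith+
      then show "norm (a n / real n - L) < e" by simp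
    qed
  qed
  then show ?thesis by blast
qed

context finite_local_endo
begin

text \<open>The entropy is given by \<open>lim\<close>, which is meaningful only after convergence
  is shown. Convergence is proved for \<open>mu\<close> by \<open>fekete_subadditive\<close> and
  carried over to the lengths by \<open>mu_lam\<close>.\<close>

lemma entropy_limit:
  obtains L where "(\<lambda>n. ln (real (mu n)) / real n) \<longlonglongrightarrow> L" "alg_entropy R m \<phi> = L - ln (real resdeg)"
proof -
  have "\<exists>L. (\<lambda>n. ln (real (mu n)) / real n) \<longlonglongrightarrow> L"
  proof (rule fekete_subadditive)
    fix n k
    have p: "real (mu n) > 0" "real (mu k) > 0" "real (mu (n + k)) > 0" using mu_pos[of n] mu_pos[of k] mu_pos[of "n + k"] by auto
    have "real (mu (n + k)) \<le> real (mu n) * real (mu k)" using mu_submult[of n k] by (metis of_nat_le_iff of_nat_mult)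
    then have "ln (real (mu (n + k))) \<le> ln (real (mu n) * real (mu k))" using p by (intro ln_mono) auto
    then show "ln (real (mu (n + k))) \<le> ln (real (mu n)) + ln (real (mu k))"
      using p by (simp add: ln_mult)
    show "0 \<le> ln (real (mu n))" using mu_pos[of n] by simp
  qed
  then obtain L where L: "(\<lambda>n. ln (real (mu n)) / real n) \<longlonglongrightarrow> L" by blast
  \<comment> \<open>At \<open>n = 0\<close> both quotients are \<open>0\<close> by convention and
    the identity can fail, so it is claimed only eventually.\<close>
  have "\<forall>\<^sub>F n in sequentially. ln (real (mu n)) / real n - ln (real resdeg) = ln (real (the_enat (lambda_len R m \<phi> n))) / real n"
    using eventually_ge_at_top[of 1]
  proof eventually_elim
    case (elim n)
    have "lam n > 0" using mu_lam[of n] mu_pos[of n] by (cases "lam n") auto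
    then have "ln (real (mu n)) = ln (real (lam n)) + real n * ln (real resdeg)"
      unfolding mu_lam using resdeg_pos by (simp add: ln_mult ln_realpow)
    then show ?case using elim unfolding lam_def by (simp add: field_simps)
  qed
  then have "(\<lambda>n. ln (real (the_enat (lambda_len R m \<phi> n))) / real n) \<longlonglongrightarrow> L - ln (real resdeg)"
    by (rule Lim_transform_eventually[OF tendsto_diff[OF L tendsto_const]])
  then show ?thesis using that[OF L] unfolding alg_entropy_def by (simp add: limI)
qed

lemma log_degree_le_entropy: "ln (real deg) \<le> ln (real resdeg) + alg_entropy R m \<phi>"
proof -
  obtain L where L: "(\<lambda>n. ln (real (mu n)) / real n) \<longlonglongrightarrow> L" "alg_entropy R m \<phi> = L - ln (real resdeg)" by (rule entropy_limit)
  have "ln (real deg) \<le> L"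
  proof (rule LIMSEQ_le_const[OF L(1)], intro exI allI impI)
    fix n :: nat assume n: "n \<ge> 1"
    have "real (deg ^ n) \<le> real (mu n)" using deg_le_mu[of n] by (simp only: of_nat_le_iff)
    then have "ln (real (deg ^ n)) \<le> ln (real (mu n))" using deg_pos by (intro ln_mono) auto
    then have "real n * ln (real deg) \<le> ln (real (mu n))" using deg_pos by (simp add: ln_realpow)
    then show "ln (real deg) \<le> ln (real (mu n)) / real n" using n by (simp add: field_simps)
  qed
  then show ?thesis using L(2) by simp
qed

lemma entropy_le_log_degree:
  assumes "cohen_macaulay_local R m"
  shows "ln (real resdeg) + alg_entropy R m \<phi> \<le> ln (real deg)"
proof -
  obtain L where L: "(\<lambda>n. ln (real (mu n)) / real n) \<longlonglongrightarrow> L" "alg_entropy R m \<phi> = L - ln (real resdeg)" by (rule entropy_limit)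
  obtain C where C: "\<And>n. mu n \<le> C * deg ^ n" using mu_le_cohen_macaulay[OF assms] by blast
  have C0: "C > 0" using C[of 0] mu_pos[of 0] by (cases C) auto
  have "(\<lambda>n. ln (real C) / real n + ln (real deg)) \<longlonglongrightarrow> 0 + ln (real deg)"
    by (intro tendsto_add tendsto_const lim_const_over_n)
  moreover have "ln (real (mu n)) / real n \<le> ln (real C) / real n + ln (real deg)" if n: "n \<ge> 1" for n
  proof -
    have "real (mu n) \<le> real (C * deg ^ n)" using C[of n] by (simp only: of_nat_le_iff)
    then have "ln (real (mu n)) \<le> ln (real (C * deg ^ n))" using mu_pos[of n] by (intro ln_mono) auto
    also have "\<dots> = ln (real C) + real n * ln (real deg)" using C0 deg_pos by (simp add: ln_mult ln_realpow)
    finally show ?thesis using n by (simp add: field_simps)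
  qed
  ultimately have "L \<le> 0 + ln (real deg)" using LIMSEQ_le[OF L(1)] by blast
  then show ?thesis using L(2) by simp
qed

end

theorem mainTheorem19:
  fixes R :: "('a, 'b) ring_scheme" and m :: "'a set" and \<phi> :: "'a \<Rightarrow> 'a"
  assumes "noetherian_domain R"
    and "local_ring R m"
    and "finite_local_self_map R m \<phi>"
  shows "ln (real (the_enat (map_degree R \<phi>)))
           \<le> ln (real (the_enat (residue_degree R m \<phi>))) + alg_entropy R m \<phi>
         \<and> (cohen_macaulay_local R m \<longrightarrow>
            ln (real (the_enat (map_degree R \<phi>)))
              = ln (real (the_enat (residue_degree R m \<phi>))) + alg_entropy R m \<phi>)"
proof -
  interpret finite_local_endo R m \<phi>
    using assms by (simp add: finite_local_endo_def finite_local_endo_axioms_def)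
  show ?thesis
    unfolding map_degree_deg residue_degree_resdeg the_enat.simps
    using log_degree_le_entropy entropy_le_log_degree by (auto intro: antisym)
qed

end
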